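(* Let $k\geq 1$ be an integer, let $R=\mathbb{C}[x,y,z]$ and $\mathfrak{m}=(x,y,z)\subset R$. Then the maximum singularity of $\mathrm{Hilb}^{\binom{k+2}{3}}(\mathbb{A}^3)$ occurs at the point $[\mathfrak{m}^k]$. That is, for every ideal $J\subset R$ with $\dim_{\mathbb{C}}R/J=\binom{k+2}{3}$ one has $$T(J)\leq T(\mathfrak{m}^k),$$ where $T(J)=\dim_{\mathbb{C}}\mathrm{Hom}_R(J,R/J)$; and $\mathfrak{m}^k$ is the only Borel-fixed ideal of colength $\binom{k+2}{3}$ in $R$ at which this maximal value is attained.
   Context: Points of $\mathrm{Hilb}^l(\mathbb{A}^3)$ correspond to ideals $J\subset R=\mathbb{C}[x,y,z]$ of colength $\dim_{\mathbb{C}}R/J=l$; the point corresponding to $J$ is denoted $[J]$, and $T(J)=\dim_{\mathbb{C}}\mathrm{Hom}_R(J,R/J)$ is the dimension of the tangent space at $[J]$. A point $[I]$ has the maximal singularity if $T(I)\geq T(J)$ for all $[J]\in\mathrm{Hilb}^l(\mathbb{A}^3)$. A monomial ideal $I\subset R$ is called Borel-fixed if for every minimal monomial generator $g$ of $I$: if $z\mid g$ then $xg/z\in I$ and $yg/z\in I$; and if $y\mid g$ then $xg/y\in I$. *)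

theory Defs
  imports
    "HOL-Library.Poly_Mapping"
    "HOL-Algebra.Ideal_Product"
    "HOL-Algebra.QuotRing"
    "Jordan_Normal_Form.VS_Connect"
begin

section \<open>The polynomial ring in three variables over the complex numbers\<close>

datatype indet = Vx | Vy | Vz

type_synonym poly3 = "(indet \<Rightarrow>\<^sub>0 nat) \<Rightarrow>\<^sub>0 complex"

abbreviation complex_field :: "complex ring"
  where "complex_field \<equiv> class_ring"

abbreviation polyring :: "poly3 ring"
  where "polyring \<equiv> class_ring"

definition const :: "complex \<Rightarrow> poly3"
  where "const c = Poly_Mapping.single 0 c"

definition monomial :: "(indet \<Rightarrow>\<^sub>0 nat) \<Rightarrow> poly3"
  where "monomial e = Poly_Mapping.single e 1"

definition var :: "indet \<Rightarrow> poly3"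
  where "var v = monomial (Poly_Mapping.single v 1)"

definition max_ideal :: "poly3 set"
  where "max_ideal = Idl\<^bsub>polyring\<^esub> {var Vx, var Vy, var Vz}"


section \<open>Ideals and quotients as modules, and modules of homomorphisms\<close>

text \<open>The fields \<^term>\<open>mult\<close> and \<^term>\<open>one\<close> of a module record play no role in the notion of
  a module; they are filled with the evident or with dummy values.\<close>

definition ideal_module :: "('a, 'm) ring_scheme \<Rightarrow> 'a set \<Rightarrow> ('a, 'a) module"
  where "ideal_module R I =
    \<lparr>carrier = I, mult = mult R, one = one R, zero = zero R, add = add R, smult = mult R\<rparr>"

definition quotient_module :: "('a, 'm) ring_scheme \<Rightarrow> 'a set \<Rightarrow> ('a, 'a set) module"
  where "quotient_module R I =
    \<lparr>carrier = carrier (R Quot I), mult = mult (R Quot I), one = one (R Quot I),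
     zero = zero (R Quot I), add = add (R Quot I),
     smult = (\<lambda>r C. (I +>\<^bsub>R\<^esub> r) \<otimes>\<^bsub>R Quot I\<^esub> C)\<rparr>"

text \<open>The set \<^const>\<open>module_hom\<close> only constrains its members on the carrier of the source.
  Intersecting with \<^const>\<open>extensional\<close> makes each homomorphism one HOL function.\<close>

definition hom_module ::
  "('a, 'r) ring_scheme \<Rightarrow> ('a, 'b, 'm) module_scheme \<Rightarrow> ('a, 'c, 'n) module_scheme
    \<Rightarrow> ('a, 'b \<Rightarrow> 'c) module"
  where "hom_module R M N =
    \<lparr>carrier = LinearCombinations.module_hom R M N \<inter> extensional (carrier M),
     mult = (\<lambda>f g. \<lambda>m\<in>carrier M. \<zero>\<^bsub>N\<^esub>),
     one = (\<lambda>m\<in>carrier M. \<zero>\<^bsub>N\<^esub>),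
     zero = (\<lambda>m\<in>carrier M. \<zero>\<^bsub>N\<^esub>),
     add = (\<lambda>f g. \<lambda>m\<in>carrier M. f m \<oplus>\<^bsub>N\<^esub> g m),
     smult = (\<lambda>r f. \<lambda>m\<in>carrier M. r \<odot>\<^bsub>N\<^esub> f m)\<rparr>"

definition restrict_scalars :: "('k \<Rightarrow> 'a) \<Rightarrow> ('a, 'b) module \<Rightarrow> ('k, 'b) module"
  where "restrict_scalars h M =
    \<lparr>carrier = carrier M, mult = mult M, one = one M, zero = zero M, add = add M,
     smult = (\<lambda>c. smult M (h c))\<rparr>"

lemma (in cring) ideal_module_is_module:
  assumes "ideal I R"
  shows "Module.module R (ideal_module R I)"
proof -
  interpret I: ideal I R by fact
  show ?thesis
  proof (rule moduleI)
    show "abelian_group (ideal_module R I)"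
    proof (rule abelian_groupI)
      fix x assume "x \<in> carrier (ideal_module R I)"
      then show "\<exists>y\<in>carrier (ideal_module R I).
          y \<oplus>\<^bsub>ideal_module R I\<^esub> x = \<zero>\<^bsub>ideal_module R I\<^esub>"
        by (intro bexI[of _ "\<ominus> x"]) (auto simp: ideal_module_def l_neg)
    qed (auto simp: ideal_module_def a_ac)
  qed (auto simp: ideal_module_def l_distr r_distr m_assoc I.I_l_closed is_cring)
qed

lemma quotient_module_simps:
  "carrier (quotient_module R I) = carrier (R Quot I)"
  "zero (quotient_module R I) = zero (R Quot I)"
  "add (quotient_module R I) = add (R Quot I)"
  "smult (quotient_module R I) r C = (I +>\<^bsub>R\<^esub> r) \<otimes>\<^bsub>R Quot I\<^esub> C"
  by (simp_all add: quotient_module_def)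

lemma (in cring) quotient_module_is_module:
  assumes "ideal I R"
  shows "Module.module R (quotient_module R I)"
proof -
  interpret I: ideal I R by fact
  interpret Q: cring "R Quot I" by (rule I.quotient_is_cring[OF is_cring])
  interpret h: ring_hom_ring R "R Quot I" "(+>) I" by (rule I.rcos_ring_hom_ring)
  show ?thesis
  proof (rule moduleI, goal_cases)
    case 2
    show ?case
    proof (rule abelian_groupI, unfold quotient_module_simps)
      fix x assume "x \<in> carrier (R Quot I)"
      then show "\<exists>y\<in>carrier (R Quot I). y \<oplus>\<^bsub>R Quot I\<^esub> x = \<zero>\<^bsub>R Quot I\<^esub>"
        by (intro bexI[of _ "\<ominus>\<^bsub>R Quot I\<^esub> x"] Q.l_neg Q.a_inv_closed)
    qed (rule Q.a_closed Q.zero_closed Q.a_assoc Q.a_comm Q.l_zero; assumption)+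
  qed (unfold quotient_module_simps,
      simp_all only: is_cring Q.m_closed h.hom_closed h.hom_add h.hom_mult h.hom_one
        Q.l_distr Q.r_distr Q.m_assoc Q.l_one)
qed

lemma hom_module_is_module:
  assumes "Module.module R M" "Module.module R N"
  shows "Module.module R (hom_module R M N)"
proof -
  interpret M: Module.module R M by fact
  interpret N: Module.module R N by fact
  have cl: "f m \<in> carrier N" if "f \<in> LinearCombinations.module_hom R M N" "m \<in> carrier M" for f m
    using that by (auto simp: LinearCombinations.module_hom_def)
  have mh: "(\<lambda>m\<in>carrier M. f m) \<in> LinearCombinations.module_hom R M N"
    if "\<And>m. m \<in> carrier M \<Longrightarrow> f m \<in> carrier N"
      "\<And>m m'. m \<in> carrier M \<Longrightarrow> m' \<in> carrier M \<Longrightarrow> f (m \<oplus>\<^bsub>M\<^esub> m') = f m \<oplus>\<^bsub>N\<^esub> f m'"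
      "\<And>r m. r \<in> carrier R \<Longrightarrow> m \<in> carrier M \<Longrightarrow> f (r \<odot>\<^bsub>M\<^esub> m) = r \<odot>\<^bsub>N\<^esub> f m" for f
    using that by (auto simp: LinearCombinations.module_hom_def)
  have add: "(\<lambda>m\<in>carrier M. f m \<oplus>\<^bsub>N\<^esub> g m) \<in> LinearCombinations.module_hom R M N"
    if "f \<in> LinearCombinations.module_hom R M N" "g \<in> LinearCombinations.module_hom R M N" for f g
    using that cl[OF that(1)] cl[OF that(2)]
    by (intro mh) (simp_all add: LinearCombinations.module_hom_add LinearCombinations.module_hom_smult N.smult_r_distr N.M.a_ac)
  have smult: "(\<lambda>m\<in>carrier M. r \<odot>\<^bsub>N\<^esub> f m) \<in> LinearCombinations.module_hom R M N"
    if "f \<in> LinearCombinations.module_hom R M N" "r \<in> carrier R" for f r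
    using that cl[OF that(1)]
    by (intro mh) (simp_all add: LinearCombinations.module_hom_add LinearCombinations.module_hom_smult N.smult_r_distr
        N.smult_assoc1[symmetric] M.R.m_comm)
  have zero: "(\<lambda>m\<in>carrier M. \<zero>\<^bsub>N\<^esub>) \<in> LinearCombinations.module_hom R M N"
    by (intro mh) (simp_all add: N.smult_r_null)
  show ?thesis
  proof (rule moduleI)
    show "abelian_group (hom_module R M N)"
    proof (rule abelian_groupI)
      fix f assume f: "f \<in> carrier (hom_module R M N)"
      let ?g = "\<lambda>m\<in>carrier M. (\<ominus>\<^bsub>R\<^esub> \<one>\<^bsub>R\<^esub>) \<odot>\<^bsub>N\<^esub> f m"
      have "?g \<in> carrier (hom_module R M N)"
        using f smult by (simp add: hom_module_def)
      moreover have "?g \<oplus>\<^bsub>hom_module R M N\<^esub> f = \<zero>\<^bsub>hom_module R M N\<^esub>"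
        using f cl by (auto simp: hom_module_def N.smult_l_minus N.M.l_neg intro!: restrict_ext)
      ultimately show "\<exists>g\<in>carrier (hom_module R M N).
          g \<oplus>\<^bsub>hom_module R M N\<^esub> f = \<zero>\<^bsub>hom_module R M N\<^esub>" by blast
    qed (auto simp: hom_module_def add zero cl N.M.a_ac intro!: extensionalityI[of _ "carrier M"])
  qed (auto simp: hom_module_def smult cl N.smult_l_distr N.smult_r_distr N.smult_assoc1
        M.R.is_cring intro!: extensionalityI[of _ "carrier M"])
qed

lemma restrict_scalars_is_module:
  assumes "Module.module R M" "cring K" "h \<in> Ring.ring_hom K R"
  shows "Module.module K (restrict_scalars h M)"
proof -
  interpret M: Module.module R M by fact
  interpret K: cring K by fact
  show ?thesis
  proof (rule moduleI)
    show "abelian_group (restrict_scalars h M)"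
    proof (rule abelian_groupI)
      fix x assume "x \<in> carrier (restrict_scalars h M)"
      then show "\<exists>y\<in>carrier (restrict_scalars h M).
          y \<oplus>\<^bsub>restrict_scalars h M\<^esub> x = \<zero>\<^bsub>restrict_scalars h M\<^esub>"
        by (intro bexI[of _ "\<ominus>\<^bsub>M\<^esub> x"]) (auto simp: restrict_scalars_def M.M.l_neg)
    qed (auto simp: restrict_scalars_def M.M.a_ac)
  qed (auto simp: restrict_scalars_def assms(2) Ring.ring_hom_closed[OF assms(3)]
        Ring.ring_hom_add[OF assms(3)] Ring.ring_hom_mult[OF assms(3)] Ring.ring_hom_one[OF assms(3)]
        M.smult_l_distr M.smult_r_distr M.smult_assoc1)
qed


section \<open>Points of the Hilbert scheme and their tangent spaces\<close>

definition quotient_space :: "poly3 set \<Rightarrow> (complex, poly3 set) module"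
  where "quotient_space J = restrict_scalars const (quotient_module polyring J)"

definition tangent_space :: "poly3 set \<Rightarrow> (complex, poly3 \<Rightarrow> poly3 set) module"
  where "tangent_space J = restrict_scalars const
    (hom_module polyring (ideal_module polyring J) (quotient_module polyring J))"

text \<open>The function \<^const>\<open>vectorspace.dim\<close> has an unspecified value on infinite-dimensional
  spaces, hence the explicit finiteness condition.\<close>

definition hilbert_points :: "nat \<Rightarrow> poly3 set set"
  where "hilbert_points l =
    {J. ideal J polyring \<and> vectorspace.fin_dim complex_field (quotient_space J) \<and>
        vectorspace.dim complex_field (quotient_space J) = l}"

text \<open>For ideals of finite colength the tangent space is finite-dimensional, because the
  polynomial ring is Noetherian.\<close>

definition tangent_dim :: "poly3 set \<Rightarrow> nat"
  where "tangent_dim J = vectorspace.dim complex_field (tangent_space J)"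

lemma const_ring_hom: "const \<in> Ring.ring_hom complex_field polyring"
  by (rule Ring.ring_hom_memI) (simp_all add: const_def single_add mult_single single_one)

lemma vectorspace_quotient_space:
  assumes "ideal J polyring"
  shows "vectorspace complex_field (quotient_space J)"
proof -
  have "cring polyring" "field complex_field" "cring complex_field" by unfold_locales
  then show ?thesis
    unfolding quotient_space_def vectorspace_def
    by (intro conjI restrict_scalars_is_module[where R = polyring]
        cring.quotient_module_is_module assms const_ring_hom)
qed

lemma vectorspace_tangent_space:
  assumes "ideal J polyring"
  shows "vectorspace complex_field (tangent_space J)"
proof -
  have "cring polyring" "field complex_field" "cring complex_field" by unfold_locales
  then show ?thesis
    unfolding tangent_space_def vectorspace_def
    by (intro conjI restrict_scalars_is_module[where R = polyring] hom_module_is_module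
        cring.ideal_module_is_module cring.quotient_module_is_module assms const_ring_hom)
qed


section \<open>Borel-fixed ideals\<close>

definition monomial_ideal :: "poly3 set \<Rightarrow> bool"
  where "monomial_ideal I \<longleftrightarrow> (\<exists>S \<subseteq> range monomial. I = Idl\<^bsub>polyring\<^esub> S)"

definition minimal_generators :: "poly3 set \<Rightarrow> poly3 set"
  where "minimal_generators I =
    {g \<in> I \<inter> range monomial. \<forall>h \<in> I \<inter> range monomial. h dvd g \<longrightarrow> h = g}"

text \<open>Below, \<open>h\<close> is the quotient of the generator by the variable it is divided by.\<close>

definition borel_fixed :: "poly3 set \<Rightarrow> bool"
  where "borel_fixed I \<longleftrightarrow> monomial_ideal I \<and>
    (\<forall>g \<in> minimal_generators I.
      (\<forall>h. g = var Vz * h \<longrightarrow> var Vx * h \<in> I \<and> var Vy * h \<in> I) \<and>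
      (\<forall>h. g = var Vy * h \<longrightarrow> var Vx * h \<in> I))"

end

theory Submission
  imports Defs "HOL-Computational_Algebra.Fundamental_Theorem_Algebra"
begin

text \<open>For \<open>g \<in> R\<close> consider the submodule \<open>V_g = (gR + J) / J\<close> of \<open>R / J\<close>, its annihilator \<open>K_g = (J : g)\<close>
  and \<open>T(g) = dim Hom(K_g, V_g)\<close>, so that \<open>T(1) = T(J)\<close>. The key inequality is
  \<open>T(g) \<le> T(gz) + n (2e + 1)\<close> with \<open>n = dim V_g / V_gz\<close> and \<open>e = dim V_g / (y, z) V_g\<close>, valid if \<open>y\<close> is
  nilpotent on the kernel of \<open>z\<close>. To see it, look at \<open>f \<mapsto> \<phi>(zf)\<close> on \<open>K_gz\<close>: modulo \<open>V_gz\<close> this is a map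
  \<open>K_gz / K_g \<rightarrow> V_g / V_gz\<close>, for which there are at most \<open>ne\<close> parameters; with values in \<open>V_gz\<close> it belongs to
  \<open>Hom(K_gz, V_gz)\<close>; and if it is zero, \<open>\<phi>\<close> is a map from \<open>K_g / (K_g \<inter> zR)\<close> to the kernel of \<open>z\<close>,
  for which there are at most \<open>n (e + 1)\<close> parameters.

  Let \<open>m\<close> be the largest order to which all of \<open>K_g\<close> vanishes at some point. If \<open>y = z = 0\<close> is a
  general line through such a point, then \<open>e \<le> m\<close>, and the largest order for \<open>K_gz\<close> is \<open>m\<close> or \<open>m - 1\<close>.
  As an ideal vanishing to order \<open>m\<close> at a point has colength at least \<open>binom(m+2, 3)\<close>, induction gives
  \<open>T(J) + 2 binom(m+2, 4) \<le> (2m + 1) l\<close>. For \<open>l = binom(k+2, 3)\<close> this forces \<open>m \<le> k\<close>, the resulting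
  bound is strictly increasing in \<open>m\<close>, and for \<open>m = k\<close> it equals \<open>binom(k+2, 2) binom(k+1, 2)\<close>, which
  is the number of maps from the monomial generators of the \<open>k\<close>-th power of the maximal ideal to the
  monomials of degree \<open>k - 1\<close> in the socle. Finally \<open>m = k\<close> means that \<open>J\<close> is the \<open>k\<close>-th power of the
  maximal ideal of a point, and the only zero of a monomial ideal of finite colength is the origin.\<close>

section \<open>Dimensions modulo an ideal\<close>

text \<open>Multiplication by \<open>g\<close> identifies \<open>V_g\<close> with
  \<open>R / K_g\<close>, so \<open>T(g)\<close> is the tangent dimension at the ideal
  \<open>K_g\<close>, and \<open>dim V_g\<close> is its colength. The induction thus descends
  through colon ideals, with source and target shrinking together.

  The quotients \<open>K_gz / K_g\<close> and \<open>V_g / V_gz\<close> both have dimension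
  \<open>n\<close>, so a naive count of linear maps would give \<open>n * n\<close>. Nilpotency of
  \<open>y\<close> reduces this to \<open>n * e\<close>: filter by kernels of powers of
  \<open>y\<close>; a basis vector of a layer then has its value in the kernel of \<open>y\<close>,
  and this kernel is as large as the cokernel of \<open>y\<close>, hence of dimension at most
  \<open>e\<close>.

  The maximal order is taken over all points because \<open>K_gz\<close> contains
  \<open>K_g\<close>: no point can gain order, although the point of maximal order may change
  between steps. The line must be general for the order along it to be \<open>m\<close>, and the
  plane \<open>z = 0\<close> must miss the other zeros, whose contributions would otherwise enter
  \<open>e\<close>. The term \<open>2 binom(m+2, 4)\<close> is the sum over \<open>j < m\<close> of
  \<open>2 binom(j+2, 3)\<close>, the amounts gained each time the maximal order drops.\<close>

lemma const_add: "const (c + d) = const c + const d"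
  by (simp add: const_def single_add)

lemma const_mult: "const (c * d) = const c * const d"
  by (simp add: const_def mult_single)

lemma const_one [simp]: "const 1 = 1"
  by (simp add: const_def)

lemma const_zero [simp]: "const 0 = 0"
  by (simp add: const_def)

lemma const_uminus: "const (- c) = - const c"
  by (simp add: const_def single_uminus)

text \<open>The carrier of \<open>polyring\<close> is a whole type, so ideals can be handled without
  records; \<open>is_ideal_iff\<close> connects the two notions.\<close>

definition is_ideal :: "poly3 set \<Rightarrow> bool"
  where "is_ideal A \<longleftrightarrow> 0 \<in> A \<and> (\<forall>a\<in>A. \<forall>b\<in>A. a + b \<in> A) \<and> (\<forall>r. \<forall>a\<in>A. r * a \<in> A)"

lemma is_idealD:
  assumes "is_ideal A"
  shows is_ideal_0: "0 \<in> A"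
    and is_ideal_add: "a \<in> A \<Longrightarrow> b \<in> A \<Longrightarrow> a + b \<in> A"
    and is_ideal_mult: "a \<in> A \<Longrightarrow> r * a \<in> A"
    and is_ideal_mult_right: "a \<in> A \<Longrightarrow> a * r \<in> A"
    and is_ideal_uminus: "a \<in> A \<Longrightarrow> - a \<in> A"
    and is_ideal_diff: "a \<in> A \<Longrightarrow> b \<in> A \<Longrightarrow> a - b \<in> A"
proof -
  show m: "r * a \<in> A" if "a \<in> A" for r a
    using assms that by (auto simp: is_ideal_def)
  show "a * r \<in> A" if "a \<in> A" for r a
    using m[OF that, of r] by (simp add: mult.commute)
  show s: "a + b \<in> A" if "a \<in> A" "b \<in> A" for a b
    using assms that by (auto simp: is_ideal_def)
  show u: "- a \<in> A" if "a \<in> A" for a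
    using m[OF that, of "-1"] by simp
  show "a - b \<in> A" if "a \<in> A" "b \<in> A" for a b
    using s[OF that(1) u[OF that(2)]] by simp
qed (use assms in \<open>auto simp: is_ideal_def\<close>)

lemma is_ideal_iff: "ideal A polyring \<longleftrightarrow> is_ideal A"
proof
  assume "ideal A polyring"
  then interpret ideal A polyring .
  show "is_ideal A"
    unfolding is_ideal_def
    using a_subset zero_closed a_closed I_l_closed by auto
next
  assume A: "is_ideal A"
  show "ideal A polyring"
  proof (rule idealI)
    show "ring polyring" by unfold_locales
    show "subgroup A (add_monoid polyring)"
    proof (rule group.subgroupI)
      show "group (add_monoid polyring)"
        using class_ring.add.is_group by simp
      fix a assume "a \<in> A"
      have inv: "inv\<^bsub>add_monoid polyring\<^esub> a = - a"
        unfolding m_inv_def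
        by (rule the1_equality, rule ex1I[of _ "- a"]) (auto simp: minus_unique)
      show "inv\<^bsub>add_monoid polyring\<^esub> a \<in> A"
        using is_ideal_uminus[OF A \<open>a \<in> A\<close>] inv by simp
    qed (use is_idealD[OF A] in auto)
  qed (use is_idealD[OF A] in auto)
qed

section \<open>Polynomials as a complex vector space\<close>

definition cscale :: "complex \<Rightarrow> poly3 \<Rightarrow> poly3"
  where "cscale c f = const c * f"

lemma mult_cscale: "f * cscale c g = cscale c (f * g)"
  by (simp add: cscale_def mult.left_commute)

interpretation pv: Vector_Spaces.vector_space cscale
  by unfold_locales (simp_all add: cscale_def const_add const_mult algebra_simps)

lemma subspace_ideal: "is_ideal A \<Longrightarrow> pv.subspace A"
  unfolding pv.subspace_def cscale_def by (auto simp: is_idealD)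

definition functional :: "(poly3 \<Rightarrow> complex) \<Rightarrow> bool"
  where "functional F \<longleftrightarrow> (\<forall>a b. F (a + b) = F a + F b) \<and> (\<forall>c a. F (cscale c a) = c * F a)"

lemma functional_0: "functional F \<Longrightarrow> F 0 = 0"
  unfolding functional_def by (metis pv.scale_zero_left mult_zero_left)

lemma functional_mult:
  assumes "functional F"
  shows "functional (\<lambda>a. F (z * a))"
  unfolding functional_def
proof (intro conjI allI)
  show "F (z * (a + b)) = F (z * a) + F (z * b)" for a b
    using assms by (simp add: functional_def distrib_left)
  show "F (z * cscale c a) = c * F (z * a)" for c a
    using assms unfolding mult_cscale by (simp add: functional_def)
qed

text \<open>The span of \<open>B\<close> is a linear complement of \<open>J\<close>, so residue
  classes are modelled by actual polynomials and dimension theory stays inside one type. A subspace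
  containing \<open>J\<close> is the direct sum of \<open>J\<close> and its part in the complement,
  which is the reason that intersecting with \<open>W\<close> measures it modulo
  \<open>J\<close>.\<close>

locale finite_colength =
  fixes J :: "poly3 set" and B :: "poly3 set"
  assumes J: "is_ideal J"
    and finB: "finite B"
    and indB: "pv.independent B"
    and disj: "\<And>f. f \<in> J \<Longrightarrow> f \<in> pv.span B \<Longrightarrow> f = 0"
    and cover: "\<And>f. \<exists>w \<in> pv.span B. f - w \<in> J"
begin

abbreviation "W \<equiv> pv.span B"

text \<open>For \<open>J \<subseteq> A\<close>, this is the dimension of \<open>A / J\<close>.\<close>

definition qdim :: "poly3 set \<Rightarrow> nat" where "qdim A = pv.dim (A \<inter> W)"

definition nf :: "poly3 \<Rightarrow> poly3" where "nf f = (SOME w. w \<in> W \<and> f - w \<in> J)"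

lemma nf: "nf f \<in> W" "f - nf f \<in> J"
  using someI_ex[of "\<lambda>w. w \<in> W \<and> f - w \<in> J"] cover[of f] by (auto simp: nf_def)

lemma nf_unique: "w \<in> W \<Longrightarrow> f - w \<in> J \<Longrightarrow> nf f = w"
proof -
  assume w: "w \<in> W" "f - w \<in> J"
  have "nf f - w \<in> J"
    using is_ideal_diff[OF J w(2) nf(2)[of f]] by simp
  moreover have "nf f - w \<in> W" by (intro pv.span_diff nf w)
  ultimately show ?thesis using disj[of "nf f - w"] by simp
qed

lemma nf_add: "nf (f + g) = nf f + nf g"
  by (rule nf_unique) (use is_ideal_add[OF J nf(2)[of f] nf(2)[of g]] in
    \<open>auto intro: pv.span_add nf simp: add_diff_add\<close>)

lemma nf_scale: "nf (cscale c f) = cscale c (nf f)"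
  by (rule nf_unique) (use is_ideal_mult[OF J nf(2)[of f], of "const c"] in
    \<open>auto intro: pv.span_scale nf simp: cscale_def[symmetric] pv.scale_right_diff_distrib\<close>)

lemma nf_mem: 
  assumes "pv.subspace A" "J \<subseteq> A" 
  shows "nf f \<in> A \<longleftrightarrow> f \<in> A"
  using pv.subspace_add[OF assms(1), of "nf f" "f - nf f"] nf(2)[of f]
    pv.subspace_diff[OF assms(1), of f "f - nf f"] assms(2) by auto

lemma finite_independent: "pv.independent C \<Longrightarrow> C \<subseteq> W \<Longrightarrow> finite C"
  using pv.independent_span_bound[OF finB] by blast

lemma qdim_J: "qdim J = 0"
proof -
  have "J \<inter> W = {0}" using disj is_ideal_0[OF J] pv.span_zero by auto
  then have "J \<inter> W \<subseteq> pv.span {}" by simp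
  then show ?thesis unfolding qdim_def using pv.dim_le_card[of "J \<inter> W" "{}"] by simp
qed

lemma qdim_UNIV: "qdim UNIV = card B"
  unfolding qdim_def using pv.dim_span_eq_card_independent[OF indB] by simp

lemma basis_extension:
  assumes A: "pv.subspace A" and A': "pv.subspace A'" "A' \<subseteq> A"
  obtains C C' where "C \<subseteq> C'" "C \<subseteq> A' \<inter> W" "C' \<subseteq> A \<inter> W" "pv.independent C'"
    "A' \<inter> W \<subseteq> pv.span C" "A \<inter> W \<subseteq> pv.span C'" "finite C'" "card C = qdim A'" "card C' = qdim A"
proof -
  obtain C where C: "C \<subseteq> A' \<inter> W" "pv.independent C" "A' \<inter> W \<subseteq> pv.span C" "card C = qdim A'"
    using pv.basis_exists[of "A' \<inter> W"] by (auto simp: qdim_def)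
  have "C \<subseteq> A \<inter> W" using C A' by auto
  from pv.maximal_independent_subset_extend[OF this C(2)]
  obtain C' where C': "C \<subseteq> C'" "C' \<subseteq> A \<inter> W" "pv.independent C'" "A \<inter> W \<subseteq> pv.span C'" by blast
  have "card C' = qdim A" unfolding qdim_def using pv.basis_card_eq_dim[OF C'(2,4,3)] .
  then show thesis using that[OF C'(1) C(1) C'(2,3) C(3) C'(4)] C(4) finite_independent[OF C'(3)] C'(2) by auto
qed

lemma qdim_mono:
  assumes "pv.subspace A" "pv.subspace A'" "A' \<subseteq> A"
  shows "qdim A' \<le> qdim A"
proof -
  obtain C C' where "C \<subseteq> C'" "C \<subseteq> A' \<inter> W" "C' \<subseteq> A \<inter> W" "pv.independent C'"
    "A' \<inter> W \<subseteq> pv.span C" "A \<inter> W \<subseteq> pv.span C'" "finite C'" "card C = qdim A'" "card C' = qdim A"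
    by (rule basis_extension[OF assms])
  then show ?thesis using card_mono[of C' C] by simp
qed

lemma qdim_eq:
  assumes A: "pv.subspace A" and A': "pv.subspace A'" "A' \<subseteq> A" and "J \<subseteq> A'" and "qdim A \<le> qdim A'"
  shows "A = A'"
proof -
  obtain C C' where C: "C \<subseteq> C'" "C \<subseteq> A' \<inter> W" "C' \<subseteq> A \<inter> W" "pv.independent C'"
    "A' \<inter> W \<subseteq> pv.span C" "A \<inter> W \<subseteq> pv.span C'" "finite C'" "card C = qdim A'" "card C' = qdim A"
    by (rule basis_extension[OF A A'])
  have "C = C'" using C assms(5) card_seteq[of C' C] by simp
  then have sub: "A \<inter> W \<subseteq> A'" using C pv.span_minimal[OF _ A'(1), of C] by blast
  have "f \<in> A'" if "f \<in> A" for f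
    using nf_mem[OF A, of f] nf_mem[OF A'(1) assms(4), of f] nf(1)[of f] that sub assms(3,4) by auto
  then show ?thesis using assms by auto
qed

lemma qdim_le_generators:
  assumes A: "pv.subspace A" and A': "pv.subspace A'" "J \<subseteq> A'" "J \<subseteq> A"
    and gen: "\<And>a. a \<in> A \<Longrightarrow> \<exists>c. a - (\<Sum>i<m. cscale (c i) (b i)) \<in> A'"
  shows "qdim A \<le> qdim A' + m"
proof -
  obtain C where C: "C \<subseteq> A' \<inter> W" "pv.independent C" "A' \<inter> W \<subseteq> pv.span C" "card C = qdim A'"
    using pv.basis_exists[of "A' \<inter> W"] by (auto simp: qdim_def)
  have fin: "finite C" using C finite_independent by auto
  let ?G = "C \<union> (\<lambda>i. nf (b i)) ` {..<m}"
  have nfs: "nf (\<Sum>i<k. cscale (c i) (b i)) = (\<Sum>i<k. cscale (c i) (nf (b i)))" for c k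
    by (induction k) (auto simp: nf_add nf_scale intro!: nf_unique pv.span_zero is_ideal_0[OF J])
  have "A \<inter> W \<subseteq> pv.span ?G"
  proof
    fix a assume a: "a \<in> A \<inter> W"
    then obtain c where c: "a - (\<Sum>i<m. cscale (c i) (b i)) \<in> A'" using gen by blast
    define s where "s = (\<Sum>i<m. cscale (c i) (b i))"
    have "nf (a - s) \<in> A'" using c nf_mem[OF A'(1,2)] s_def by simp
    then have 1: "nf (a - s) \<in> pv.span C" using nf(1) C by auto
    have "a = nf a" using nf_unique[of a a] a is_ideal_0[OF J] by simp
    also have "nf a = nf (a - s) + nf s" using nf_add[of "a - s" s] by simp
    finally have eq: "a = nf (a - s) + nf s" .
    have "nf s \<in> pv.span ?G" unfolding s_def nfs
      by (intro pv.span_sum pv.span_scale pv.span_base) auto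
    moreover have "nf (a - s) \<in> pv.span ?G" using 1 pv.span_mono[of C ?G] by auto
    ultimately have "nf (a - s) + nf s \<in> pv.span ?G" by (intro pv.span_add)
    then show "a \<in> pv.span ?G" using eq by simp
  qed
  then have "qdim A \<le> card ?G" unfolding qdim_def using fin by (intro pv.dim_le_card) auto
  also have "\<dots> \<le> card C + card ((\<lambda>i. nf (b i)) ` {..<m})" by (rule card_Un_le)
  also have "\<dots> \<le> qdim A' + m" using card_image_le[of "{..<m}" "\<lambda>i. nf (b i)"] C by simp
  finally show ?thesis .
qed

text \<open>A basis of \<open>A / A'\<close> together with coordinate functionals. The functionals
  are linear on all polynomials, not only on \<open>A\<close>, so that they can later be composed
  with evaluation of arbitrary functions.\<close>

definition coordinates ::
  "poly3 set \<Rightarrow> poly3 set \<Rightarrow> (nat \<Rightarrow> poly3) \<Rightarrow> (nat \<Rightarrow> poly3 \<Rightarrow> complex) \<Rightarrow> bool"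
  where "coordinates A A' b F \<longleftrightarrow>
    (\<forall>i<qdim A - qdim A'. b i \<in> A \<and> functional (F i) \<and> (\<forall>a\<in>A'. F i a = 0)) \<and>
    (\<forall>a\<in>A. \<exists>c. a - (\<Sum>i<qdim A - qdim A'. cscale (c i) (b i)) \<in> A') \<and>
    (\<forall>a\<in>A. (\<forall>i<qdim A - qdim A'. F i a = 0) \<longrightarrow> a \<in> A')"

lemma coordinatesD:
  assumes "coordinates A A' b F"
  shows "i < qdim A - qdim A' \<Longrightarrow> b i \<in> A"
    and "i < qdim A - qdim A' \<Longrightarrow> functional (F i)"
    and "i < qdim A - qdim A' \<Longrightarrow> a \<in> A' \<Longrightarrow> F i a = 0"
    and "a \<in> A \<Longrightarrow> \<exists>c. a - (\<Sum>i<qdim A - qdim A'. cscale (c i) (b i)) \<in> A'"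
    and "a \<in> A \<Longrightarrow> (\<And>i. i < qdim A - qdim A' \<Longrightarrow> F i a = 0) \<Longrightarrow> a \<in> A'"
  using assms unfolding coordinates_def by simp_all

lemma quotient_basis:
  assumes A: "pv.subspace A" and A': "pv.subspace A'" "A' \<subseteq> A" "J \<subseteq> A'"
  obtains b F where "coordinates A A' b F"
proof -
  obtain C C' where C: "C \<subseteq> C'" "C \<subseteq> A' \<inter> W" "C' \<subseteq> A \<inter> W" "pv.independent C'"
    "A' \<inter> W \<subseteq> pv.span C" "A \<inter> W \<subseteq> pv.span C'" "finite C'" "card C = qdim A'" "card C' = qdim A"
    by (rule basis_extension[OF A A'(1,2)])
  let ?m = "qdim A - qdim A'"
  have "card (C' - C) = ?m" using C by (simp add: card_Diff_subset finite_subset)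
  then obtain b where b: "bij_betw b {..<?m} (C' - C)"
    using ex_bij_betw_nat_finite[of "C' - C"] C(7) atLeast0LessThan by auto
  have bC: "b i \<in> C' - C" if "i < ?m" for i using b that by (auto simp: bij_betw_def)
  have JA: "J \<subseteq> A" using A' by auto
  define F where "F i a = pv.representation C' (nf a) (b i)" for i a
  \<comment> \<open>A representation in \<open>C'\<close> is zero outside the span of
    \<open>C'\<close>, so \<open>F\<close> need not be additive on all polynomials. A basis
    \<open>E\<close> of the whole space extending \<open>C'\<close> gives functionals
    \<open>G\<close> that are, and that agree with \<open>F\<close> on \<open>A\<close>.\<close>
  define E where "E = pv.extend_basis C'"
  have E: "C' \<subseteq> E" "pv.independent E" "pv.span E = UNIV"
    using pv.extend_basis_superset[OF C(4)] pv.independent_extend_basis[OF C(4)] pv.span_extend_basis[OF C(4)]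
    by (auto simp: E_def)
  define G where "G i a = pv.representation E (nf a) (b i)" for i a
  have GF: "G i a = F i a" if "a \<in> A" for i a
  proof -
    have "nf a \<in> pv.span C'" using nf_mem[OF A JA] that nf(1) C(6) by auto
    then show ?thesis unfolding G_def F_def
      using pv.representation_extend[OF E(2) _ E(1)] by simp
  qed
  have sumC: "(\<Sum>i<?m. cscale (G i a) (b i)) + (\<Sum>x\<in>C. cscale (pv.representation C' (nf a) x) x) = nf a"
    if "a \<in> A" for a
  proof -
    have s: "nf a \<in> pv.span C'" using nf_mem[OF A JA] that nf(1) C(6) by auto
    have "nf a = (\<Sum>x\<in>C'. cscale (pv.representation C' (nf a) x) x)"
      using pv.sum_representation_eq[OF C(4) s C(7) subset_refl] by simp
    also have "\<dots> = (\<Sum>x\<in>C'-C. cscale (pv.representation C' (nf a) x) x) 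
        + (\<Sum>x\<in>C. cscale (pv.representation C' (nf a) x) x)"
      by (rule sum.subset_diff[OF C(1) C(7)])
    also have "(\<Sum>x\<in>C'-C. cscale (pv.representation C' (nf a) x) x) = (\<Sum>i<?m. cscale (G i a) (b i))"
      using sum.reindex_bij_betw[OF b, of "\<lambda>x. cscale (pv.representation C' (nf a) x) x"] GF[OF that]
      by (simp add: F_def)
    finally show ?thesis by simp
  qed
  have inA': "(\<Sum>x\<in>C. cscale (r x) x) \<in> A'" for r
    using C(2) by (intro pv.subspace_sum[OF A'(1)] pv.subspace_scale[OF A'(1)]) auto
  have key: "a - (\<Sum>i<?m. cscale (G i a) (b i)) \<in> A'" if "a \<in> A" for a
  proof -
    have eq: "a - s = (a - n) + t" if "s + t = n" for s t n :: poly3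
      using that by (auto simp: algebra_simps)
    have "a - nf a \<in> A'" using nf(2)[of a] A'(3) by auto
    then show ?thesis unfolding eq[OF sumC[OF that]]
      by (rule pv.subspace_add[OF A'(1) _ inA'])
  qed
  show thesis
  proof (rule that[of b G], unfold coordinates_def, intro conjI allI ballI impI)
    show "b i \<in> A" if "i < ?m" for i using bC[OF that] C by auto
    show "\<exists>c. a - (\<Sum>i<?m. cscale (c i) (b i)) \<in> A'" if "a \<in> A" for a using key[OF that] by (rule exI[of _ "\<lambda>i. G i a"])
    show "functional (G i)" if "i < ?m" for i
      unfolding functional_def G_def
      by (auto simp: nf_add nf_scale pv.representation_add pv.representation_scale E)
    show "G i a = 0" if "i < ?m" "a \<in> A'" for i a
    proof -
      have a: "a \<in> A" using that A' by auto
      have s: "nf a \<in> pv.span C" using nf_mem[OF A'(1,3)] that nf(1) C(5) by auto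
      have "pv.representation C' (nf a) = pv.representation C (nf a)"
        using pv.representation_extend[OF C(4) s C(1)] .
      moreover have "pv.representation C (nf a) (b i) = 0"
        using pv.representation_ne_zero[of C "nf a" "b i"] bC[OF that(1)] by auto
      ultimately show ?thesis using GF[OF a] by (simp add: F_def)
    qed
    show "a \<in> A'" if "a \<in> A" "\<forall>i<?m. G i a = 0" for a
      using key[OF that(1)] that(2) by simp
  qed
qed

text \<open>The functionals are imposed one at a time. Each lowers the dimension by at most one,
  since an element on which it is non-zero generates the quotient.\<close>

lemma qdim_le_functionals:
  assumes A: "pv.subspace A" and A': "pv.subspace A'" "J \<subseteq> A'" "A' \<subseteq> A"
    and F: "\<And>i. i < m \<Longrightarrow> functional (F i)" "\<And>i a. i < m \<Longrightarrow> a \<in> A' \<Longrightarrow> F i a = 0"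
    "\<And>a. a \<in> A \<Longrightarrow> (\<And>i. i < m \<Longrightarrow> F i a = 0) \<Longrightarrow> a \<in> A'"
  shows "qdim A \<le> qdim A' + m"
proof -
  define S where "S k = {a \<in> A. \<forall>i<k. F i a = 0}" for k
  have sub: "pv.subspace (S k)" if "k \<le> m" for k
    unfolding pv.subspace_def S_def
    using pv.subspace_0[OF A] pv.subspace_add[OF A] pv.subspace_scale[OF A] F(1) that
      functional_0 by (auto simp: functional_def)
  have J: "J \<subseteq> S k" if "k \<le> m" for k unfolding S_def using A' F(2) that by auto
  have step: "qdim (S k) \<le> qdim (S (Suc k)) + Suc 0" if k: "k < m" for k
  proof -
    have "\<exists>b. \<forall>a\<in>S k. \<exists>c. a - cscale c b \<in> S (Suc k)"
    proof (cases "\<exists>b \<in> S k. F k b \<noteq> 0")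
      case True
      then obtain b where b: "b \<in> S k" "F k b \<noteq> 0" by blast
      have "a - cscale (F k a / F k b) b \<in> S (Suc k)" if a: "a \<in> S k" for a
      proof -
        let ?x = "a - cscale (F k a / F k b) b"
        have x: "?x \<in> S k" using k by (intro pv.subspace_diff pv.subspace_scale sub a b) auto
        have "F k (?x + cscale (F k a / F k b) b) = F k ?x + F k a"
          using F(1)[OF k] b(2) unfolding functional_def by (metis nonzero_eq_divide_eq)
        then have "F k ?x = 0" by simp
        then show ?thesis using x by (auto simp: S_def less_Suc_eq)
      qed
      then show ?thesis by blast
    next
      case False
      then have "a - cscale 0 0 \<in> S (Suc k)" if "a \<in> S k" for a using that by (auto simp: S_def less_Suc_eq)
      then show ?thesis by blast
    qed
    then obtain b where b: "\<forall>a\<in>S k. \<exists>c. a - cscale c b \<in> S (Suc k)" by blast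
    show ?thesis
    proof (rule qdim_le_generators[where b = "\<lambda>_. b"])
      fix a assume "a \<in> S k"
      then obtain c where "a - cscale c b \<in> S (Suc k)" using b by blast
      then show "\<exists>c. a - (\<Sum>i<Suc 0. cscale (c i) b) \<in> S (Suc k)" by (intro exI[of _ "\<lambda>_. c"]) simp
    qed (use sub J k in auto)
  qed
  have "qdim (S 0) \<le> qdim (S k) + k" if "k \<le> m" for k
    using that
  proof (induction k)
    case (Suc k)
    then show ?case using step[of k] by linarith
  qed simp
  from this[of m] have "qdim (S 0) \<le> qdim (S m) + m" by simp
  moreover have "S 0 = A" by (auto simp: S_def)
  moreover have "S m = A'" using F(2,3) A'(3) by (auto simp: S_def)
  ultimately show ?thesis by simp
qed

text \<open>The map from \<open>A\<close> to \<open>Y / B'\<close> given by multiplication by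
  \<open>z\<close> is onto with kernel \<open>K\<close>. Pulling back functionals gives one
  inequality, pushing forward generators the other.\<close>

lemma rank_nullity:
  fixes z :: poly3
  assumes A: "pv.subspace A" "J \<subseteq> A" and B: "pv.subspace B'" "J \<subseteq> B'"
  defines "K \<equiv> {a \<in> A. z * a \<in> B'}" and "Y \<equiv> {z * a + b | a b. a \<in> A \<and> b \<in> B'}"
  shows "qdim A + qdim B' = qdim K + qdim Y" "pv.subspace K" "pv.subspace Y" "J \<subseteq> K" "J \<subseteq> Y"
proof -
  show K: "pv.subspace K"
    unfolding K_def pv.subspace_def
    using pv.subspace_0[OF A(1)] pv.subspace_add[OF A(1)] pv.subspace_scale[OF A(1)]
       pv.subspace_0[OF B(1)] pv.subspace_add[OF B(1)] pv.subspace_scale[OF B(1)]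
    by (auto simp: distrib_left mult_cscale)
  show Y: "pv.subspace Y"
    unfolding pv.subspace_def
  proof (intro conjI ballI allI)
    show "0 \<in> Y" unfolding Y_def using pv.subspace_0[OF A(1)] pv.subspace_0[OF B(1)]
      by (intro CollectI exI[of _ 0]) simp
    fix x assume "x \<in> Y"
    then obtain a b where x: "x = z * a + b" "a \<in> A" "b \<in> B'" by (auto simp: Y_def)
    show "cscale c x \<in> Y" for c
      unfolding Y_def using x pv.subspace_scale[OF A(1), of a c] pv.subspace_scale[OF B(1), of b c]
      by (intro CollectI exI[of _ "cscale c a"] exI[of _ "cscale c b"]) (auto simp: mult_cscale pv.scale_right_distrib)
    fix y assume "y \<in> Y"
    then obtain a' b' where y: "y = z * a' + b'" "a' \<in> A" "b' \<in> B'" by (auto simp: Y_def)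
    show "x + y \<in> Y"
      unfolding Y_def using x y pv.subspace_add[OF A(1), of a a'] pv.subspace_add[OF B(1), of b b']
      by (intro CollectI exI[of _ "a + a'"] exI[of _ "b + b'"]) (auto simp: algebra_simps)
  qed
  show JK: "J \<subseteq> K" using A(2) B(2) is_ideal_mult[OF J] by (auto simp: K_def)
  have BI: "B' \<subseteq> Y"
  proof
    fix b assume "b \<in> B'"
    then show "b \<in> Y" unfolding Y_def using pv.subspace_0[OF A(1)]
      by (intro CollectI exI[of _ 0] exI[of _ b]) simp
  qed
  then show JI: "J \<subseteq> Y" using B by auto
  have KA: "K \<subseteq> A" by (auto simp: K_def)
  have "qdim A \<le> qdim K + (qdim Y - qdim B')"
  proof -
    obtain b F where F: "coordinates Y B' b F"
      by (rule quotient_basis[OF Y B(1) BI B(2)])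
    show ?thesis
    proof (rule qdim_le_functionals[OF A(1) K JK KA, of _ "\<lambda>i a. F i (z * a)"])
      show "functional (\<lambda>a. F i (z * a))" if "i < qdim Y - qdim B'" for i
        using coordinatesD(2)[OF F that] by (rule functional_mult)
      show "F i (z * a) = 0" if "i < qdim Y - qdim B'" "a \<in> K" for i a
        using coordinatesD(3)[OF F that(1), of "z * a"] that(2) by (simp add: K_def)
      show "a \<in> K" if a: "a \<in> A" "\<And>i. i < qdim Y - qdim B' \<Longrightarrow> F i (z * a) = 0" for a
      proof -
        have "z * a \<in> Y" unfolding Y_def using a(1) pv.subspace_0[OF B(1)]
          by (intro CollectI exI[of _ a] exI[of _ 0]) simp
        then have "z * a \<in> B'" using coordinatesD(5)[OF F] a(2) by blast
        then show ?thesis using a(1) by (simp add: K_def)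
      qed
    qed
  qed
  moreover have "qdim Y \<le> qdim B' + (qdim A - qdim K)"
  proof -
    obtain b F where b: "coordinates A K b F"
      by (rule quotient_basis[OF A(1) K KA JK])
    show ?thesis
    proof (rule qdim_le_generators[OF Y B(1,2) JI, where b = "\<lambda>i. z * b i"])
      fix x assume "x \<in> Y"
      then obtain a y where x: "x = z * a + y" "a \<in> A" "y \<in> B'" by (auto simp: Y_def)
      obtain c where c: "a - (\<Sum>i<qdim A - qdim K. cscale (c i) (b i)) \<in> K" using coordinatesD(4)[OF b x(2)] by blast
      have "x - (\<Sum>i<qdim A - qdim K. cscale (c i) (z * b i)) = z * (a - (\<Sum>i<qdim A - qdim K. cscale (c i) (b i))) + y"
        by (simp add: x(1) right_diff_distrib sum_distrib_left mult_cscale)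
      also have "\<dots> \<in> B'" using c x(3) by (intro pv.subspace_add[OF B(1)]) (auto simp: K_def)
      finally show "\<exists>c. x - (\<Sum>i<qdim A - qdim K. cscale (c i) (z * b i)) \<in> B'" by blast
    qed
  qed
  moreover have "qdim K \<le> qdim A" "qdim B' \<le> qdim Y" using qdim_mono A(1) K KA Y B(1) BI by auto
  ultimately show "qdim A + qdim B' = qdim K + qdim Y" by linarith
qed

end

section \<open>Homomorphisms into a cyclic quotient module\<close>

text \<open>Functionals act on all functions because homomorphisms occur only through
  representatives modulo \<open>J\<close>, and these are precomposed with multiplication by
  \<open>z\<close>.\<close>

definition map_functional :: "((poly3 \<Rightarrow> poly3) \<Rightarrow> complex) \<Rightarrow> bool"
  where "map_functional F \<longleftrightarrow> (\<forall>\<phi> \<psi>. F (\<lambda>x. \<phi> x + \<psi> x) = F \<phi> + F \<psi>) \<and>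
    (\<forall>c \<phi>. F (\<lambda>x. cscale c (\<phi> x)) = c * F \<phi>)"

text \<open>\<open>A / B\<close> has dimension at most \<open>n\<close>: some \<open>n\<close> functionals on \<open>A\<close> have their common zeros in \<open>B\<close>.\<close>

definition quot_dim_le :: "(poly3 \<Rightarrow> poly3) set \<Rightarrow> (poly3 \<Rightarrow> poly3) set \<Rightarrow> nat \<Rightarrow> bool"
  where "quot_dim_le A B n \<longleftrightarrow>
    (\<exists>F. (\<forall>i<n. map_functional (F i)) \<and> (\<forall>\<phi>\<in>A. (\<forall>i<n. F i \<phi> = 0) \<longrightarrow> \<phi> \<in> B))"

lemma quot_dim_le_subset: "A \<subseteq> B \<Longrightarrow> quot_dim_le A B 0"
  by (auto simp: quot_dim_le_def)

lemma quot_dim_le_trans: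
  assumes "quot_dim_le A B n" "quot_dim_le B C m"
  shows "quot_dim_le A C (n + m)"
proof -
  obtain F where F: "\<forall>i<n. map_functional (F i)" "\<forall>\<phi>\<in>A. (\<forall>i<n. F i \<phi> = 0) \<longrightarrow> \<phi> \<in> B"
    using assms(1) unfolding quot_dim_le_def by blast
  obtain G where G: "\<forall>i<m. map_functional (G i)" "\<forall>\<phi>\<in>B. (\<forall>i<m. G i \<phi> = 0) \<longrightarrow> \<phi> \<in> C"
    using assms(2) unfolding quot_dim_le_def by blast
  define H where "H i = (if i < n then F i else G (i - n))" for i
  have "map_functional (H i)" if "i < n + m" for i
    using F(1) G(1) that by (auto simp: H_def)
  moreover have "\<phi> \<in> C" if "\<phi> \<in> A" "\<forall>i<n + m. H i \<phi> = 0" for \<phi>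
  proof -
    have "F i \<phi> = 0" if "i < n" for i using \<open>\<forall>i<n + m. H i \<phi> = 0\<close>[rule_format, of i] that by (simp add: H_def)
    then have "\<phi> \<in> B" using F(2) \<open>\<phi> \<in> A\<close> by blast
    moreover have "G i \<phi> = 0" if "i < m" for i
      using \<open>\<forall>i<n + m. H i \<phi> = 0\<close>[rule_format, of "n + i"] that by (simp add: H_def)
    ultimately show ?thesis using G(2) by blast
  qed
  ultimately show ?thesis unfolding quot_dim_le_def by blast
qed

lemma quot_dim_le_mono:
  assumes "quot_dim_le A B n" "n \<le> m"
  shows "quot_dim_le A B m"
proof -
  have "quot_dim_le B B (m - n)"
    unfolding quot_dim_le_def by (rule exI[of _ "\<lambda>_ _. 0"]) (simp add: map_functional_def)
  from quot_dim_le_trans[OF assms(1) this] show ?thesis using assms(2) by simp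
qed

lemma map_functional_eval: "functional F \<Longrightarrow> map_functional (\<lambda>\<phi>. F (\<phi> f))"
  by (simp add: map_functional_def functional_def)

text \<open>Precomposition with multiplication by \<open>z\<close> is linear in \<phi>, so
  functionals can be transported along it. This is how the bound for \<open>homs (g * z)\<close>
  enters the induction step.\<close>

lemma quot_dim_le_pullback:
  assumes "quot_dim_le A B n" "\<And>\<phi>. \<phi> \<in> A' \<Longrightarrow> (\<lambda>f. \<phi> (z * f)) \<in> A"
    "\<And>\<phi>. \<phi> \<in> A' \<Longrightarrow> (\<lambda>f. \<phi> (z * f)) \<in> B \<Longrightarrow> \<phi> \<in> B'"
  shows "quot_dim_le A' B' n"
proof -
  obtain F where F: "\<forall>i<n. map_functional (F i)" "\<forall>\<phi>\<in>A. (\<forall>i<n. F i \<phi> = 0) \<longrightarrow> \<phi> \<in> B"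
    using assms(1) unfolding quot_dim_le_def by blast
  have "map_functional (\<lambda>\<phi>. F i (\<lambda>f. \<phi> (z * f)))" if "i < n" for i
    using F(1) that by (simp add: map_functional_def)
  then show ?thesis
    unfolding quot_dim_le_def using F(2) assms(2,3)
    by (intro exI[of _ "\<lambda>i \<phi>. F i (\<lambda>f. \<phi> (z * f))"]) blast
qed

context finite_colength
begin

text \<open>Each of the \<open>m\<close> values needs as many functionals as the dimension of
  \<open>A / A'\<close>. The index \<open>k\<close> encodes a pair: the quotient of \<open>k\<close>
  by this dimension selects the argument, the remainder the functional.\<close>

lemma quot_dim_le_eval:
  assumes A: "pv.subspace A" and A': "pv.subspace A'" "A' \<subseteq> A" "J \<subseteq> A'"
    and C: "\<And>\<phi> i. \<phi> \<in> C \<Longrightarrow> i < m \<Longrightarrow> \<phi> (b i) \<in> A"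
  shows "quot_dim_le C {\<phi> \<in> C. \<forall>i<m. \<phi> (b i) \<in> A'} (m * (qdim A - qdim A'))"
proof -
  let ?e = "qdim A - qdim A'"
  obtain x F where F: "coordinates A A' x F" by (rule quotient_basis[OF A A'])
  have idx: "k mod ?e < ?e" if "k < m * ?e" for k
    using that by (cases "?e = 0") simp_all
  have "map_functional (\<lambda>\<phi>. F (k mod ?e) (\<phi> (b (k div ?e))))" if "k < m * ?e" for k
    by (rule map_functional_eval[OF coordinatesD(2)[OF F idx[OF that]]])
  moreover have "\<phi> (b i) \<in> A'"
    if \<phi>: "\<phi> \<in> C" "\<forall>k<m * ?e. F (k mod ?e) (\<phi> (b (k div ?e))) = 0" and i: "i < m" for \<phi> i
  proof (rule coordinatesD(5)[OF F C[OF \<phi>(1) i]])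
    fix j assume j: "j < ?e"
    have "i * ?e + j < (i + 1) * ?e" using j by simp
    also have "\<dots> \<le> m * ?e" using i by (intro mult_right_mono) auto
    finally have "i * ?e + j < m * ?e" .
    from \<phi>(2)[rule_format, OF this] j show "F j (\<phi> (b i)) = 0" by simp
  qed
  ultimately show ?thesis
    unfolding quot_dim_le_def by (intro exI[of _ "\<lambda>k \<phi>. F (k mod ?e) (\<phi> (b (k div ?e)))"]) blast
qed

section \<open>Colon ideals and homomorphisms into cyclic submodules\<close>

definition V :: "poly3 \<Rightarrow> poly3 set" where "V g = {g * a + b | a b. a \<in> UNIV \<and> b \<in> J}"
definition K :: "poly3 \<Rightarrow> poly3 set" where "K g = {a \<in> UNIV. g * a \<in> J}"

text \<open>\<open>Hom (K g, V g / J)\<close> is \<open>homs g\<close> modulo \<open>zero_homs g\<close>: homomorphisms are represented by functions that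
  are linear only modulo \<open>J\<close>. The case \<open>g = 1\<close> is the tangent space.\<close>

definition homs :: "poly3 \<Rightarrow> (poly3 \<Rightarrow> poly3) set"
  where "homs g = {\<phi>. \<forall>f\<in>K g. \<phi> f \<in> V g \<and> (\<forall>f'\<in>K g. \<phi> (f + f') - \<phi> f - \<phi> f' \<in> J) \<and>
    (\<forall>r. \<phi> (r * f) - r * \<phi> f \<in> J)}"

definition zero_homs :: "poly3 \<Rightarrow> (poly3 \<Rightarrow> poly3) set"
  where "zero_homs g = {\<phi>. \<forall>f\<in>K g. \<phi> f \<in> J}"

lemma V_iff: "v \<in> V g \<longleftrightarrow> (\<exists>a. v - g * a \<in> J)"
  unfolding V_def
  by (auto, metis add_diff_cancel_left' , metis add.commute diff_add_cancel)

lemma K_iff: "f \<in> K g \<longleftrightarrow> g * f \<in> J"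
  by (simp add: K_def)

lemma ideal_V: "is_ideal (V g)"
  unfolding is_ideal_def
proof (intro conjI ballI allI)
  show "0 \<in> V g" unfolding V_iff using is_ideal_0[OF J] by (intro exI[of _ 0]) simp
  fix x assume "x \<in> V g"
  then obtain a where a: "x - g * a \<in> J" by (auto simp: V_iff)
  show "r * x \<in> V g" for r
    unfolding V_iff using is_ideal_mult[OF J a, of r]
    by (intro exI[of _ "r * a"]) (simp add: algebra_simps)
  fix y assume "y \<in> V g"
  then obtain b where b: "y - g * b \<in> J" by (auto simp: V_iff)
  show "x + y \<in> V g"
    unfolding V_iff using is_ideal_add[OF J a b] by (intro exI[of _ "a + b"]) (simp add: algebra_simps)
qed

lemma ideal_K: "is_ideal (K g)"
  using is_ideal_0[OF J] is_ideal_add[OF J] is_ideal_mult[OF J]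
  unfolding is_ideal_def by (simp add: K_iff distrib_left mult.left_commute[of g])

lemma J_K: "J \<subseteq> K g" using is_ideal_mult[OF J] by (auto simp: K_iff)

lemma J_V: "J \<subseteq> V g" by (auto simp: V_iff intro!: exI[of _ 0])

lemma V_self: "g * a \<in> V g" unfolding V_iff using is_ideal_0[OF J] by (intro exI[of _ a]) simp

lemma V_mult: "V (g * z) \<subseteq> V g"
  by (auto simp: V_iff mult.assoc)

lemma K_mult: "K g \<subseteq> K (g * z)"
proof
  fix f assume "f \<in> K g"
  then have "g * f * z \<in> J" by (intro is_ideal_mult_right[OF J, where a = "g * f"]) (simp add: K_iff)
  then show "f \<in> K (g * z)" by (simp add: K_iff ac_simps)
qed

lemma K_mult_iff: "f \<in> K (g * z) \<longleftrightarrow> z * f \<in> K g"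
  by (simp add: K_iff mult.assoc)

text \<open>Rank-nullity for multiplication by \<open>g\<close> on \<open>R / J\<close>: the image
  is \<open>V g / J\<close> and the kernel \<open>K g / J\<close>. In particular
  \<open>V g / J\<close> has the dimension of \<open>R / K g\<close>.\<close>

lemma qdim_K_V: "qdim (K g) + qdim (V g) = qdim UNIV"
  using rank_nullity(1)[OF pv.subspace_UNIV subset_UNIV subspace_ideal[OF J] subset_refl, where z = g] qdim_J
  by (simp add: K_def V_def)

lemma
  assumes "\<phi> \<in> homs g" "f \<in> K g"
  shows homs_V: "\<phi> f \<in> V g"
    and homs_add: "f' \<in> K g \<Longrightarrow> \<phi> (f + f') - \<phi> f - \<phi> f' \<in> J"
    and homs_mult: "\<phi> (r * f) - r * \<phi> f \<in> J"
  using assms unfolding homs_def by auto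

lemma homs_add_mem:
  assumes "\<phi> \<in> homs g" "f \<in> K g" "f' \<in> K g" "is_ideal A" "J \<subseteq> A" "\<phi> f \<in> A" "\<phi> f' \<in> A"
  shows "\<phi> (f + f') \<in> A"
proof -
  have "(\<phi> (f + f') - \<phi> f - \<phi> f') + (\<phi> f + \<phi> f') \<in> A"
    using homs_add[OF assms(1-3)] assms(4-) by (intro is_ideal_add[OF assms(4)]) auto
  then show ?thesis by simp
qed

lemma homs_mult_mem:
  assumes "\<phi> \<in> homs g" "f \<in> K g" "is_ideal A" "J \<subseteq> A"
  shows "\<phi> (r * f) \<in> A \<longleftrightarrow> r * \<phi> f \<in> A"
proof -
  have "\<phi> (r * f) - r * \<phi> f \<in> A" using homs_mult[OF assms(1,2)] assms(4) by auto
  then show ?thesis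
    using is_ideal_add[OF assms(3), of "\<phi> (r * f) - r * \<phi> f" "r * \<phi> f"]
      is_ideal_diff[OF assms(3), of "\<phi> (r * f)" "\<phi> (r * f) - r * \<phi> f"] by auto
qed

lemma homs_sum_mem:
  assumes "\<phi> \<in> homs g" "is_ideal A" "J \<subseteq> A" "\<And>i. i < (m::nat) \<Longrightarrow> b i \<in> K g" "\<And>i. i < m \<Longrightarrow> \<phi> (b i) \<in> A"
  shows "\<phi> (\<Sum>i<m. cscale (c i) (b i)) \<in> A \<and> (\<Sum>i<m. cscale (c i) (b i)) \<in> K g"
  using assms(4,5)
proof (induction m)
  case 0
  \<comment> \<open>The value at zero is controlled only modulo \<open>J\<close>, through the scalar
    law with factor zero.\<close>
  have "\<phi> (0 * 0) \<in> A"
    unfolding homs_mult_mem[OF assms(1) is_ideal_0[OF ideal_K] assms(2,3)] using is_ideal_0[OF assms(2)] by simp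
  then show ?case using is_ideal_0[OF ideal_K] by simp
next
  case (Suc m)
  have b: "b m \<in> K g" "\<phi> (b m) \<in> A" using Suc.prems by auto
  have "\<phi> (cscale (c m) (b m)) \<in> A" unfolding cscale_def
    using homs_mult_mem[OF assms(1) b(1) assms(2,3)] is_ideal_mult[OF assms(2) b(2)] by simp
  moreover have "cscale (c m) (b m) \<in> K g" unfolding cscale_def by (rule is_ideal_mult[OF ideal_K b(1)])
  moreover have "\<phi> (\<Sum>i<m. cscale (c i) (b i)) \<in> A \<and> (\<Sum>i<m. cscale (c i) (b i)) \<in> K g"
    using Suc.IH Suc.prems by simp
  ultimately show ?case
    using homs_add_mem[OF assms(1) _ _ assms(2,3)] is_ideal_add[OF ideal_K] by simp
qed

lemma ideal_quotient: "is_ideal A \<Longrightarrow> is_ideal A' \<Longrightarrow> is_ideal {v \<in> A. y * v \<in> A'}"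
  unfolding is_ideal_def by (simp add: distrib_left mult.left_commute[of y])

text \<open>The hypothesis \<open>nil\<close> says that \<open>y\<close> is nilpotent on
  \<open>K (g * z) / K g\<close>, \<open>f0\<close> that \<open>K g\<close> becomes principal modulo
  \<open>(y, z)\<close>, and \<open>gen\<close> that \<open>e\<close> elements span
  \<open>R / (K g + (y, z))\<close>. The three summands count the values of \<phi> on
  \<open>z K (g * z)\<close> modulo \<open>V (g * z)\<close>, these values inside
  \<open>V (g * z)\<close>, and the maps that vanish on \<open>z K (g * z)\<close>.\<close>

lemma tangent_bound_step:
  fixes g z y f0 :: poly3 and s :: "nat \<Rightarrow> poly3" and e N t :: nat
  assumes nil: "\<And>f. f \<in> K (g * z) \<Longrightarrow> y ^ N * f \<in> K g"
    and f0: "f0 \<in> K g" "\<And>f. f \<in> K g \<Longrightarrow> \<exists>q u w. f = q * f0 + y * u + z * w"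
    and gen: "\<And>f. \<exists>c u w. f - (\<Sum>i<e. cscale (c i) (s i)) - y * u - z * w \<in> K g"
    and IH: "quot_dim_le (homs (g * z)) (zero_homs (g * z)) t"
  defines "n \<equiv> qdim (V g) - qdim (V (g * z))"
  shows "quot_dim_le (homs g) (zero_homs g) (n * e + t + n * (e + 1))"
proof -
  have n_K: "qdim (K (g * z)) - qdim (K g) = n"
    using qdim_K_V[of g] qdim_K_V[of "g * z"] qdim_mono[OF subspace_ideal[OF ideal_V] subspace_ideal[OF ideal_V] V_mult[of g z]]
      qdim_mono[OF subspace_ideal[OF ideal_K] subspace_ideal[OF ideal_K] K_mult[of g z]]
    by (simp add: n_def)
  text \<open>Modulo \<open>V (g * z)\<close>, the map \<open>f \<mapsto> \<phi> (z f)\<close> factors through \<open>K (g * z) / K g\<close>. Filtering this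
    quotient by the kernels of powers of \<open>y\<close>, each layer is mapped into the kernel \<open>V'\<close> of \<open>y\<close> on
    \<open>V g / V (g * z)\<close>.\<close>
  define V' where "V' = {v \<in> V g. y * v \<in> V (g * z)}"
  have V': "is_ideal V'" unfolding V'_def by (rule ideal_quotient[OF ideal_V ideal_V])
  have VV': "V (g * z) \<subseteq> V'" unfolding V'_def using V_mult is_ideal_mult[OF ideal_V] by auto
  \<comment> \<open>Kernel and cokernel of \<open>y\<close> on \<open>V g / V (g * z)\<close> have
    equal dimension, and the cokernel is spanned by the classes of \<open>g * s i\<close>.\<close>
  have e1: "qdim V' - qdim (V (g * z)) \<le> e"
  proof -
    let ?Y = "{y * a + b | a b. a \<in> V g \<and> b \<in> V (g * z)}"
    note rn = rank_nullity[OF subspace_ideal[OF ideal_V[of g]] J_V subspace_ideal[OF ideal_V[of "g * z"]] J_V, where z = y]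
    have "qdim (V g) \<le> qdim ?Y + e"
    proof (rule qdim_le_generators[OF subspace_ideal[OF ideal_V] rn(3,5) J_V, where b = "\<lambda>i. g * s i"])
      fix v assume "v \<in> V g"
      then obtain f where f: "v - g * f \<in> J" by (auto simp: V_iff)
      obtain c u w where c: "f - (\<Sum>i<e. cscale (c i) (s i)) - y * u - z * w \<in> K g" using gen by blast
      have "v - (\<Sum>i<e. cscale (c i) (g * s i)) = y * (g * u) +
        ((v - g * f) + g * z * w + g * (f - (\<Sum>i<e. cscale (c i) (s i)) - y * u - z * w))"
        unfolding mult_cscale[symmetric] sum_distrib_left[symmetric] by (simp add: algebra_simps)
      moreover have "(v - g * f) + g * z * w + g * (f - (\<Sum>i<e. cscale (c i) (s i)) - y * u - z * w) \<in> V (g * z)"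
        using f c J_V[of "g * z"] V_self[of "g * z" w] unfolding K_iff
        by (intro is_ideal_add[OF ideal_V]) auto
      ultimately show "\<exists>c. v - (\<Sum>i<e. cscale (c i) (g * s i)) \<in> ?Y"
        using V_self[of g u] by blast
    qed
    then show ?thesis using rn(1) unfolding V'_def by linarith
  qed
  define M where "M i = {f \<in> K (g * z). y ^ i * f \<in> K g}" for i
  define C where "C i = {\<phi> \<in> homs g. \<forall>f\<in>M i. \<phi> (z * f) \<in> V (g * z)}" for i
  have M: "is_ideal (M i)" for i unfolding M_def by (rule ideal_quotient[OF ideal_K ideal_K])
  have M_Suc: "M i \<subseteq> M (Suc i)" for i unfolding M_def using is_ideal_mult[OF ideal_K] by (auto simp: mult.assoc)
  have JM: "J \<subseteq> M i" for i unfolding M_def using J_K is_ideal_mult[OF ideal_K] by blast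
  have M0: "M 0 = K g" unfolding M_def using K_mult by auto
  have MN: "M N = K (g * z)" unfolding M_def using nil by auto
  have M_K: "z * f \<in> K g" if "f \<in> M i" for f i using that unfolding M_def by (simp add: K_mult_iff)
  have C_step: "quot_dim_le (C i) (C (Suc i)) ((qdim (M (Suc i)) - qdim (M i)) * e)" for i
  proof -
    obtain b F where b: "coordinates (M (Suc i)) (M i) b F"
      by (rule quotient_basis[OF subspace_ideal[OF M] subspace_ideal[OF M] M_Suc JM])
    let ?m = "qdim (M (Suc i)) - qdim (M i)"
    have "quot_dim_le (C i) {\<phi> \<in> C i. \<forall>j<?m. \<phi> (z * b j) \<in> V (g * z)} (?m * (qdim V' - qdim (V (g * z))))"
    proof (rule quot_dim_le_eval[OF subspace_ideal[OF V'] subspace_ideal[OF ideal_V] VV' J_V])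
      fix \<phi> j assume \<phi>: "\<phi> \<in> C i" and j: "j < ?m"
      have bj: "b j \<in> M (Suc i)" by (rule coordinatesD(1)[OF b j])
      have H: "\<phi> \<in> homs g" using \<phi> by (simp add: C_def)
      have eq: "y ^ i * (y * b j) = y ^ Suc i * b j" by (simp add: ac_simps)
      have "y * b j \<in> M i"
        using bj is_ideal_mult[OF ideal_K, of "b j" "g * z" y] unfolding M_def mem_Collect_eq eq by blast
      then have "\<phi> (z * (y * b j)) \<in> V (g * z)" using \<phi> by (auto simp: C_def)
      then have "\<phi> (y * (z * b j)) \<in> V (g * z)" by (simp add: mult.left_commute)
      then have "y * \<phi> (z * b j) \<in> V (g * z)"
        unfolding homs_mult_mem[OF H M_K[OF bj] ideal_V J_V] .
      then show "\<phi> (z * b j) \<in> V'" using homs_V[OF H M_K[OF bj]] by (simp add: V'_def)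
    qed
    moreover have "{\<phi> \<in> C i. \<forall>j<?m. \<phi> (z * b j) \<in> V (g * z)} \<subseteq> C (Suc i)"
    proof
      fix \<phi> assume "\<phi> \<in> {\<phi> \<in> C i. \<forall>j<?m. \<phi> (z * b j) \<in> V (g * z)}"
      then have \<phi>: "\<phi> \<in> C i" and bj: "\<And>j. j < ?m \<Longrightarrow> \<phi> (z * b j) \<in> V (g * z)" by auto
      have H: "\<phi> \<in> homs g" using \<phi> by (simp add: C_def)
      have "\<phi> (z * f) \<in> V (g * z)" if f: "f \<in> M (Suc i)" for f
      proof -
        obtain c where c: "f - (\<Sum>j<?m. cscale (c j) (b j)) \<in> M i" using coordinatesD(4)[OF b f] by blast
        have 1: "\<phi> (z * (f - (\<Sum>j<?m. cscale (c j) (b j)))) \<in> V (g * z)" using c \<phi> by (auto simp: C_def)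
        have 2: "\<phi> (\<Sum>j<?m. cscale (c j) (z * b j)) \<in> V (g * z) \<and> (\<Sum>j<?m. cscale (c j) (z * b j)) \<in> K g"
          by (rule homs_sum_mem[OF H ideal_V J_V M_K[OF coordinatesD(1)[OF b]] bj])
        have eq: "z * f = z * (f - (\<Sum>j<?m. cscale (c j) (b j))) + (\<Sum>j<?m. cscale (c j) (z * b j))"
          by (simp add: right_diff_distrib sum_distrib_left mult_cscale)
        show ?thesis
          by (subst eq, rule homs_add_mem[OF H M_K[OF c] _ ideal_V J_V 1]) (use 2 in auto)
      qed
      then show "\<phi> \<in> C (Suc i)" using H by (simp add: C_def)
    qed
    ultimately have "quot_dim_le (C i) (C (Suc i)) (?m * (qdim V' - qdim (V (g * z))) + 0)"
      using quot_dim_le_trans quot_dim_le_subset by blast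
    then show ?thesis by (rule quot_dim_le_mono) (use e1 in simp)
  qed
  have C_all: "qdim (M 0) \<le> qdim (M i) \<and> quot_dim_le (C 0) (C i) ((qdim (M i) - qdim (M 0)) * e)" for i
  proof (induction i)
    case 0
    then show ?case using quot_dim_le_subset[of "C 0" "C 0"] by simp
  next
    case (Suc i)
    have mono: "qdim (M i) \<le> qdim (M (Suc i))" by (rule qdim_mono[OF subspace_ideal[OF M] subspace_ideal[OF M] M_Suc])
    from quot_dim_le_trans[OF conjunct2[OF Suc] C_step[of i]]
    have "quot_dim_le (C 0) (C (Suc i)) ((qdim (M i) - qdim (M 0)) * e + (qdim (M (Suc i)) - qdim (M i)) * e)" .
    also have "(qdim (M i) - qdim (M 0)) * e + (qdim (M (Suc i)) - qdim (M i)) * e = (qdim (M (Suc i)) - qdim (M 0)) * e"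
      using mono Suc by (simp add: distrib_right[symmetric])
    finally show ?case using mono Suc by simp
  qed
  have "homs g \<subseteq> C 0"
  proof
    fix \<phi> assume H: "\<phi> \<in> homs g"
    have "\<phi> (z * f) \<in> V (g * z)" if f: "f \<in> K g" for f
    proof -
      obtain a where a: "\<phi> f - g * a \<in> J" using homs_V[OF H f] by (auto simp: V_iff)
      have "z * \<phi> f - g * z * a = z * (\<phi> f - g * a)" by (simp add: algebra_simps)
      also have "\<dots> \<in> J" by (rule is_ideal_mult[OF J a])
      finally have "z * \<phi> f \<in> V (g * z)" by (auto simp: V_iff)
      then show ?thesis using homs_mult_mem[OF H f ideal_V J_V] by blast
    qed
    then show "\<phi> \<in> C 0" using H M0 by (simp add: C_def)
  qed
  then have step1: "quot_dim_le (homs g) (C N) (n * e)"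
    using quot_dim_le_trans[OF quot_dim_le_subset conjunct2[OF C_all[of N]]] unfolding M0 MN n_K by simp
  define C' where "C' = {\<phi> \<in> homs g. \<forall>f\<in>K (g * z). \<phi> (z * f) \<in> J}"
  have step2: "quot_dim_le (C N) C' t"
  proof (rule quot_dim_le_pullback[OF IH, where z = z])
    fix \<phi> assume "\<phi> \<in> C N"
    then have H: "\<phi> \<in> homs g" and V: "\<And>f. f \<in> K (g * z) \<Longrightarrow> \<phi> (z * f) \<in> V (g * z)"
      by (auto simp: C_def MN)
    show "(\<lambda>f. \<phi> (z * f)) \<in> homs (g * z)"
      unfolding homs_def
    proof (intro CollectI ballI conjI allI)
      fix f assume f: "f \<in> K (g * z)"
      have zf: "z * f \<in> K g" using f by (simp add: K_mult_iff)
      show "\<phi> (z * f) \<in> V (g * z)" by (rule V[OF f])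
      show "\<phi> (z * (f + f')) - \<phi> (z * f) - \<phi> (z * f') \<in> J" if "f' \<in> K (g * z)" for f'
        using homs_add[OF H zf, of "z * f'"] that by (simp add: K_mult_iff distrib_left)
      show "\<phi> (z * (r * f)) - r * \<phi> (z * f) \<in> J" for r
        using homs_mult[OF H zf, of r] by (simp add: mult.left_commute)
    qed
    show "\<phi> \<in> C'" if "(\<lambda>f. \<phi> (z * f)) \<in> zero_homs (g * z)"
      using that H by (simp add: C'_def zero_homs_def)
  qed
  text \<open>If \<open>\<phi>\<close> vanishes on \<open>z K (g * z)\<close>, then \<open>z\<close> kills its values. Filtering these by the kernels of
    powers of \<open>y\<close>, each layer of \<open>\<phi>\<close> is determined on \<open>f0\<close> and on \<open>e\<close> elements of \<open>K g \<inter> (y, z)\<close>.\<close>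
  define M' where "M' i = {v \<in> {v \<in> V g. z * v \<in> J}. y ^ i * v \<in> J}" for i
  define E where "E i = {\<phi> \<in> C'. \<forall>f\<in>K g. \<phi> f \<in> M' i}" for i
  have M': "is_ideal (M' i)" for i unfolding M'_def by (rule ideal_quotient[OF ideal_quotient[OF ideal_V J] J])
  have JM': "J \<subseteq> M' i" for i unfolding M'_def using J_V is_ideal_mult[OF J] by auto
  have M'_Suc: "M' i \<subseteq> M' (Suc i)" for i unfolding M'_def using is_ideal_mult[OF J] by (auto simp: mult.assoc)
  have M'0: "M' 0 = J" unfolding M'_def using J_V is_ideal_mult[OF J] by auto
  \<comment> \<open>Modulo \<open>J\<close> an element of \<open>V g\<close> killed by
    \<open>z\<close> is \<open>g * a\<close> with \<open>a\<close> in \<open>K (g * z)\<close>, so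
    \<open>nil\<close> applies to \<open>a\<close>.\<close>
  have M'N: "M' N = {v \<in> V g. z * v \<in> J}"
  proof -
    have "y ^ N * v \<in> J" if v: "v \<in> V g" "z * v \<in> J" for v
    proof -
      obtain a where a: "v - g * a \<in> J" using v(1) by (auto simp: V_iff)
      have "g * z * a = z * v - z * (v - g * a)" by (simp add: algebra_simps)
      also have "\<dots> \<in> J" by (intro is_ideal_diff[OF J] v is_ideal_mult[OF J a])
      finally have "y ^ N * a \<in> K g" using nil by (simp add: K_iff)
      then have "y ^ N * (v - g * a) + g * (y ^ N * a) \<in> J"
        by (intro is_ideal_add[OF J] is_ideal_mult[OF J a]) (simp add: K_iff)
      then show ?thesis by (simp add: algebra_simps)
    qed
    then show ?thesis by (auto simp: M'_def)
  qed
  \<comment> \<open>Kernel and cokernel of \<open>z\<close> on \<open>V g / J\<close> have equal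
    dimension; the cokernel is \<open>V g / V (g * z)\<close>.\<close>
  have n_M': "qdim (M' N) - qdim (M' 0) = n"
  proof -
    have "{z * a + b | a b. a \<in> V g \<and> b \<in> J} = V (g * z)"
    proof (intro equalityI subsetI)
      fix x assume "x \<in> {z * a + b | a b. a \<in> V g \<and> b \<in> J}"
      then obtain a b where x: "x = z * a + b" "a \<in> V g" "b \<in> J" by blast
      obtain a' where a': "a - g * a' \<in> J" using x(2) by (auto simp: V_iff)
      have "x - g * z * a' = z * (a - g * a') + b" by (simp add: x(1) algebra_simps)
      also have "\<dots> \<in> J" by (intro is_ideal_add[OF J] is_ideal_mult[OF J a'] x)
      finally show "x \<in> V (g * z)" by (auto simp: V_iff)
    next
      fix x assume "x \<in> V (g * z)"
      then obtain a where a: "x - g * z * a \<in> J" by (auto simp: V_iff)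
      have "x = z * (g * a) + (x - g * z * a)" by (simp add: algebra_simps)
      then show "x \<in> {z * a + b | a b. a \<in> V g \<and> b \<in> J}" using a V_self[of g a] by blast
    qed
    then show ?thesis
      using rank_nullity(1)[OF subspace_ideal[OF ideal_V[of g]] J_V subspace_ideal[OF J] subset_refl, where z = z] qdim_J
        qdim_mono[OF subspace_ideal[OF ideal_V] subspace_ideal[OF ideal_V] V_mult[of g z]]
      unfolding M'N M'0 n_def by simp
  qed
  have EN: "C' \<subseteq> E N"
  proof
    fix \<phi> assume \<phi>: "\<phi> \<in> C'"
    then have H: "\<phi> \<in> homs g" by (simp add: C'_def)
    have "\<phi> f \<in> M' N" if f: "f \<in> K g" for f
    proof -
      have "f \<in> K (g * z)" using f K_mult by auto
      then have "\<phi> (z * f) \<in> J" using \<phi> by (simp add: C'_def)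
      then show ?thesis unfolding M'N using homs_V[OF H f] homs_mult_mem[OF H f J subset_refl] by simp
    qed
    then show "\<phi> \<in> E N" using \<phi> by (simp add: E_def)
  qed
  \<comment> \<open>\<open>U / U'\<close> is the kernel of \<open>y\<close> on
    \<open>R / (zR + K g)\<close>, hence no larger than the cokernel, which \<open>gen\<close>
    bounds by \<open>e\<close>. A basis element \<open>u i\<close> yields a relation: an element
    \<open>y * u i - z * w i\<close> of \<open>K g\<close>. Together with \<open>f0\<close> these
    generate \<open>K g\<close> up to \<open>y K g\<close> and \<open>z K (g * z)\<close>.\<close>
  define U' where "U' = {z * a + b | a b. a \<in> UNIV \<and> b \<in> K g}"
  define U where "U = {u \<in> UNIV. y * u \<in> U'}"
  note rnU' = rank_nullity[OF pv.subspace_UNIV subset_UNIV subspace_ideal[OF ideal_K[of g]] J_K, where z = z, folded U'_def]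
  note rnU = rank_nullity[OF pv.subspace_UNIV subset_UNIV rnU'(3,5), where z = y, folded U_def]
  have UU': "U' \<subseteq> U"
  proof
    fix x assume "x \<in> U'"
    then obtain a b where x: "x = z * a + b" "b \<in> K g" by (auto simp: U'_def)
    have "y * x = z * (y * a) + y * b" by (simp add: x algebra_simps)
    then show "x \<in> U" unfolding U_def U'_def using is_ideal_mult[OF ideal_K x(2)] by blast
  qed
  have e2: "qdim U - qdim U' \<le> e"
  proof -
    have "qdim UNIV \<le> qdim {y * a + b | a b. a \<in> UNIV \<and> b \<in> U'} + e"
    proof (rule qdim_le_generators[OF pv.subspace_UNIV rnU(3,5) subset_UNIV, where b = s])
      fix f :: poly3
      obtain c u w where c: "f - (\<Sum>i<e. cscale (c i) (s i)) - y * u - z * w \<in> K g" using gen by blast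
      have "f - (\<Sum>i<e. cscale (c i) (s i)) = y * u + (z * w + (f - (\<Sum>i<e. cscale (c i) (s i)) - y * u - z * w))"
        by simp
      then show "\<exists>c. f - (\<Sum>i<e. cscale (c i) (s i)) \<in> {y * a + b | a b. a \<in> UNIV \<and> b \<in> U'}"
        unfolding U'_def using c by blast
    qed
    then show ?thesis using rnU(1) by linarith
  qed
  obtain u F where u: "coordinates U U' u F" by (rule quotient_basis[OF rnU(2) rnU'(3) UU' rnU'(5)])
  have "\<forall>i<qdim U - qdim U'. \<exists>w. y * u i - z * w \<in> K g"
  proof (intro allI impI)
    fix i assume "i < qdim U - qdim U'"
    then have "y * u i \<in> U'" using coordinatesD(1)[OF u] by (auto simp: U_def)
    then obtain a b where ab: "y * u i = z * a + b" "b \<in> K g" by (auto simp: U'_def)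
    then have "y * u i - z * a \<in> K g" by simp
    then show "\<exists>w. y * u i - z * w \<in> K g" by blast
  qed
  then obtain w where w: "\<And>i. i < qdim U - qdim U' \<Longrightarrow> y * u i - z * w i \<in> K g" by metis
  \<comment> \<open>Past the relations the default value is \<open>f0\<close>. Since there are at
    most \<open>e\<close> relations, the first \<open>e + 1\<close> members include all of them and
    \<open>f0\<close>.\<close>
  define h where "h i = (if i < qdim U - qdim U' then y * u i - z * w i else f0)" for i
  have hK: "h i \<in> K g" for i using w f0(1) by (simp add: h_def)
  have E_step: "quot_dim_le (E (Suc i)) (E i) ((e + 1) * (qdim (M' (Suc i)) - qdim (M' i)))" for i
  proof -
    have "quot_dim_le (E (Suc i)) {\<phi> \<in> E (Suc i). \<forall>j<e + 1. \<phi> (h j) \<in> M' i} ((e + 1) * (qdim (M' (Suc i)) - qdim (M' i)))"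
      by (rule quot_dim_le_eval[OF subspace_ideal[OF M'] subspace_ideal[OF M'] M'_Suc JM']) (auto simp: E_def hK)
    moreover have "{\<phi> \<in> E (Suc i). \<forall>j<e + 1. \<phi> (h j) \<in> M' i} \<subseteq> E i"
    proof
      fix \<phi> assume "\<phi> \<in> {\<phi> \<in> E (Suc i). \<forall>j<e + 1. \<phi> (h j) \<in> M' i}"
      then have \<phi>: "\<phi> \<in> C'" and \<phi>S: "\<And>f. f \<in> K g \<Longrightarrow> \<phi> f \<in> M' (Suc i)"
        and hM: "\<And>j. j < e + 1 \<Longrightarrow> \<phi> (h j) \<in> M' i" by (auto simp: E_def)
      have H: "\<phi> \<in> homs g" using \<phi> by (simp add: C'_def)
      have "\<phi> f0 \<in> M' i" using hM[of "qdim U - qdim U'"] e2 by (simp add: h_def)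
      then have qf0: "\<phi> (q * f0) \<in> M' i" for q
        unfolding homs_mult_mem[OF H f0(1) M' JM'] by (rule is_ideal_mult[OF M'])
      have yk: "\<phi> (y * k) \<in> M' i" if k: "k \<in> K g" for k
      proof -
        have eq: "y ^ i * (y * \<phi> k) = y ^ Suc i * \<phi> k" "z * (y * \<phi> k) = y * (z * \<phi> k)"
          by (simp_all add: ac_simps)
        have "y * \<phi> k \<in> M' i"
          using \<phi>S[OF k] is_ideal_mult[OF ideal_V, of "\<phi> k" g y] is_ideal_mult[OF J, of "z * \<phi> k" y]
          unfolding M'_def mem_Collect_eq eq by blast
        then show ?thesis unfolding homs_mult_mem[OF H k M' JM'] .
      qed
      have zr: "\<phi> (z * r) \<in> M' i" if "z * r \<in> K g" for r
      proof -
        have "\<phi> (z * r) \<in> J" using \<phi> that unfolding C'_def K_mult_iff[symmetric] by blast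
        then show ?thesis using JM' by blast
      qed
      have "\<phi> f \<in> M' i" if f: "f \<in> K g" for f
      proof -
        obtain q v x where f_eq: "f = q * f0 + y * v + z * x" using f0(2)[OF f] by blast
        define p where "p = y * v + z * x"
        have pK: "p \<in> K g"
          using is_ideal_diff[OF ideal_K f is_ideal_mult[OF ideal_K f0(1), of q]] by (simp add: f_eq p_def)
        have "y * v = z * (- x) + p" by (simp add: p_def)
        then have "v \<in> U" unfolding U_def U'_def using pK by blast
        then obtain c where "v - (\<Sum>i<qdim U - qdim U'. cscale (c i) (u i)) \<in> U'" using coordinatesD(4)[OF u] by blast
        then obtain r k where rk: "v - (\<Sum>i<qdim U - qdim U'. cscale (c i) (u i)) = z * r + k" "k \<in> K g"
          by (auto simp: U'_def)
        define S where "S = (\<Sum>i<qdim U - qdim U'. cscale (c i) (h i))"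
        have S: "\<phi> S \<in> M' i \<and> S \<in> K g" unfolding S_def
          by (rule homs_sum_mem[OF H M' JM' hK]) (use hM e2 in auto)
        have S_eq: "S = y * (\<Sum>i<qdim U - qdim U'. cscale (c i) (u i)) - z * (\<Sum>i<qdim U - qdim U'. cscale (c i) (w i))"
          unfolding S_def sum_distrib_left sum_subtractf[symmetric]
          by (rule sum.cong) (auto simp: h_def mult_cscale pv.scale_right_diff_distrib)
        \<comment> \<open>What remains of \<open>p\<close> after the relations is
          \<open>y * k + z * l\<close>. On \<open>y * k\<close> the value of \<phi> drops to the
          lower layer, and \<open>z * l\<close> in \<open>K g\<close> means that \<open>l\<close>
          lies in \<open>K (g * z)\<close>, where \<phi> vanishes after multiplication by
          \<open>z\<close>.\<close>
        define l where "l = y * r + (\<Sum>i<qdim U - qdim U'. cscale (c i) (w i)) + x"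
        have p_eq: "p = S + (y * k + z * l)"
        proof -
          have "v = z * r + k + (\<Sum>i<qdim U - qdim U'. cscale (c i) (u i))" using rk(1) by (simp add: algebra_simps)
          then show ?thesis unfolding p_def S_eq l_def by (simp add: algebra_simps)
        qed
        have ykK: "y * k \<in> K g" by (rule is_ideal_mult[OF ideal_K rk(2)])
        have "z * l = p - S - y * k" by (simp add: p_eq)
        also have "\<dots> \<in> K g" using pK S ykK by (intro is_ideal_diff[OF ideal_K]) auto
        finally have zlK: "z * l \<in> K g" .
        have 1: "\<phi> (y * k + z * l) \<in> M' i" by (rule homs_add_mem[OF H ykK zlK M' JM' yk[OF rk(2)] zr[OF zlK]])
        have 2: "\<phi> p \<in> M' i" unfolding p_eq
          by (rule homs_add_mem[OF H _ is_ideal_add[OF ideal_K ykK zlK] M' JM' _ 1]) (use S in auto)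
        have "f = q * f0 + p" by (simp add: f_eq p_def add.assoc)
        then show ?thesis
          using homs_add_mem[OF H is_ideal_mult[OF ideal_K f0(1)] pK M' JM' qf0 2] by simp
      qed
      then show "\<phi> \<in> E i" using \<phi> by (simp add: E_def)
    qed
    ultimately show ?thesis using quot_dim_le_trans[OF _ quot_dim_le_subset] by fastforce
  qed
  have E_all: "qdim (M' 0) \<le> qdim (M' i) \<and> quot_dim_le (E i) (E 0) ((e + 1) * (qdim (M' i) - qdim (M' 0)))" for i
  proof (induction i)
    case 0
    then show ?case using quot_dim_le_subset[of "E 0" "E 0"] by simp
  next
    case (Suc i)
    have mono: "qdim (M' i) \<le> qdim (M' (Suc i))" by (rule qdim_mono[OF subspace_ideal[OF M'] subspace_ideal[OF M'] M'_Suc])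
    from quot_dim_le_trans[OF E_step[of i] conjunct2[OF Suc]]
    have "quot_dim_le (E (Suc i)) (E 0) ((e + 1) * (qdim (M' (Suc i)) - qdim (M' i)) + (e + 1) * (qdim (M' i) - qdim (M' 0)))" .
    also have "(e + 1) * (qdim (M' (Suc i)) - qdim (M' i)) + (e + 1) * (qdim (M' i) - qdim (M' 0)) 
        = (e + 1) * (qdim (M' (Suc i)) - qdim (M' 0))"
      using mono Suc by (simp only: distrib_left[symmetric]) simp
    finally show ?case using mono Suc by simp
  qed
  have "E 0 \<subseteq> zero_homs g" by (auto simp: E_def M'0 zero_homs_def)
  then have step3: "quot_dim_le C' (zero_homs g) (n * (e + 1))"
    using quot_dim_le_trans[OF quot_dim_le_trans[OF quot_dim_le_subset[OF EN] conjunct2[OF E_all[of N]]] quot_dim_le_subset]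
    unfolding n_M' by (simp add: mult.commute)
  show ?thesis by (rule quot_dim_le_trans[OF quot_dim_le_trans[OF step1 step2] step3])
qed

end

section \<open>Evaluation and orders of vanishing\<close>

abbreviation lookup :: "('a \<Rightarrow>\<^sub>0 'b::zero) \<Rightarrow> 'a \<Rightarrow> 'b" where "lookup \<equiv> Poly_Mapping.lookup"
abbreviation keys :: "('a \<Rightarrow>\<^sub>0 'b::zero) \<Rightarrow> 'a set" where "keys \<equiv> Poly_Mapping.keys"

text \<open>A variable ring of values lets one evaluation map serve both for points, with values in
  the complex numbers, and for parametrised lines, with values in
  \<open>complex poly\<close>.\<close>

definition scalar_hom :: "(complex \<Rightarrow> 'a::comm_ring_1) \<Rightarrow> bool"
  where "scalar_hom h \<longleftrightarrow> h 0 = 0 \<and> h 1 = 1 \<and> (\<forall>a b. h (a + b) = h a + h b) \<and> (\<forall>a b. h (a * b) = h a * h b)"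

lemma scalar_hom_id: "scalar_hom (\<lambda>c. c)"
  by (simp add: scalar_hom_def)

lemma scalar_hom_poly: "scalar_hom (\<lambda>c. [:c:])"
  by (simp add: scalar_hom_def one_pCons)

definition ev_mon :: "'a::comm_ring_1 \<Rightarrow> 'a \<Rightarrow> 'a \<Rightarrow> (indet \<Rightarrow>\<^sub>0 nat) \<Rightarrow> 'a"
  where "ev_mon x y z e = x ^ lookup e Vx * y ^ lookup e Vy * z ^ lookup e Vz"

definition ev :: "(complex \<Rightarrow> 'a::comm_ring_1) \<Rightarrow> 'a \<Rightarrow> 'a \<Rightarrow> 'a \<Rightarrow> poly3 \<Rightarrow> 'a"
  where "ev h x y z f = (\<Sum>e\<in>keys f. h (lookup f e) * ev_mon x y z e)"

lemma poly_mapping_sum_single: "(\<Sum>e\<in>keys f. Poly_Mapping.single e (lookup f e)) = f"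
proof (rule poly_mapping_eqI)
  fix k
  have "lookup (\<Sum>e\<in>keys f. Poly_Mapping.single e (lookup f e)) k = (\<Sum>e\<in>keys f. if e = k then lookup f e else 0)"
    by (simp add: lookup_sum lookup_single when_def)
  then show "lookup (\<Sum>e\<in>keys f. Poly_Mapping.single e (lookup f e)) k = lookup f k"
    by (simp add: in_keys_iff)
qed

lemma ev_superset:
  assumes "h 0 = 0" "finite S" "keys f \<subseteq> S"
  shows "ev h x y z f = (\<Sum>e\<in>S. h (lookup f e) * ev_mon x y z e)"
  unfolding ev_def
  by (rule sum.mono_neutral_left) (use assms in \<open>auto simp: in_keys_iff\<close>)

lemma ev_add:
  assumes "scalar_hom h"
  shows "ev h x y z (f + g) = ev h x y z f + ev h x y z g"
proof -
  let ?S = "keys f \<union> keys g \<union> keys (f + g)"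
  have h: "h 0 = 0" "h (c + d) = h c + h d" for c d using assms by (simp_all add: scalar_hom_def)
  have eq: "ev h x y z k = (\<Sum>e\<in>?S. h (lookup k e) * ev_mon x y z e)" if "keys k \<subseteq> ?S" for k
    using that h(1) by (intro ev_superset) auto
  show ?thesis
    by (subst (1 2 3) eq) (auto simp: lookup_add h distrib_right sum.distrib)
qed

lemma ev_0: "ev h x y z 0 = 0" by (simp add: ev_def)

lemma ev_sum:
  assumes "scalar_hom h"
  shows "ev h x y z (\<Sum>i\<in>A. f i) = (\<Sum>i\<in>A. ev h x y z (f i))"
  by (induction A rule: infinite_finite_induct) (simp_all add: ev_0 ev_add[OF assms])

lemma ev_single: "scalar_hom h \<Longrightarrow> ev h x y z (Poly_Mapping.single e c) = h c * ev_mon x y z e"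
  by (simp add: ev_def scalar_hom_def)

lemma ev_mon_add: "ev_mon x y z (d + e) = ev_mon x y z d * ev_mon x y z e"
  by (simp add: ev_mon_def lookup_add power_add ac_simps)

lemma ev_mult:
  assumes "scalar_hom h"
  shows "ev h x y z (f * g) = ev h x y z f * ev h x y z g"
proof -
  have "ev h x y z (f * g) = ev h x y z ((\<Sum>d\<in>keys f. Poly_Mapping.single d (lookup f d)) * 
      (\<Sum>e\<in>keys g. Poly_Mapping.single e (lookup g e)))"
    by (simp add: poly_mapping_sum_single)
  also have "\<dots> = (\<Sum>d\<in>keys f. \<Sum>e\<in>keys g. (h (lookup f d) * ev_mon x y z d) * (h (lookup g e) * ev_mon x y z e))"
    using assms
    by (simp add: sum_product ev_sum[OF assms] mult_single ev_single[OF assms] ev_mon_add)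
       (simp add: scalar_hom_def ac_simps)
  finally show ?thesis by (simp add: sum_product ev_def)
qed

lemma ev_const: "scalar_hom h \<Longrightarrow> ev h x y z (const c) = h c"
  by (simp add: const_def ev_single) (simp add: ev_mon_def)

lemma ev_1: "scalar_hom h \<Longrightarrow> ev h x y z 1 = 1"
  using ev_const[of h x y z 1] by (simp add: scalar_hom_def)

lemma ev_var: "scalar_hom h \<Longrightarrow> ev h x y z (var v) = (case v of Vx \<Rightarrow> x | Vy \<Rightarrow> y | Vz \<Rightarrow> z)"
  by (cases v) (auto simp: var_def monomial_def ev_single scalar_hom_def ev_mon_def lookup_single)

lemma ev_uminus: "scalar_hom h \<Longrightarrow> ev h x y z (- f) = - ev h x y z f"
  using ev_add[of h x y z f "- f"] by (simp add: ev_0 eq_neg_iff_add_eq_0 add.commute)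

lemma ev_diff: "scalar_hom h \<Longrightarrow> ev h x y z (f - g) = ev h x y z f - ev h x y z g"
  using ev_add[of h x y z f "- g"] by (simp add: ev_uminus)

lemma ev_power: "scalar_hom h \<Longrightarrow> ev h x y z (f ^ n) = ev h x y z f ^ n"
  by (induction n) (simp_all add: ev_1 ev_mult)

lemma var_power: "var v ^ n = monomial (Poly_Mapping.single v n)"
  by (induction n) (simp_all add: var_def monomial_def mult_single single_add[symmetric])

lemma exponent_eq: "e = Poly_Mapping.single Vx (lookup e Vx) + Poly_Mapping.single Vy (lookup e Vy)
    + Poly_Mapping.single Vz (lookup e Vz)"
proof (rule poly_mapping_eqI)
  fix v show "lookup e v = lookup (Poly_Mapping.single Vx (lookup e Vx) + Poly_Mapping.single Vy (lookup e Vy)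
    + Poly_Mapping.single Vz (lookup e Vz)) v"
    by (cases v) (simp_all add: lookup_add lookup_single)
qed

lemma single_eq: "Poly_Mapping.single e c = 
    const c * (var Vx ^ lookup e Vx * var Vy ^ lookup e Vy * var Vz ^ lookup e Vz)"
  by (subst exponent_eq[of e]) (simp add: var_power monomial_def const_def mult_single add.assoc)

lemma poly3_induct [case_names const var add mult]:
  fixes P :: "poly3 \<Rightarrow> bool"
  assumes c: "\<And>c. P (const c)" and v: "\<And>v. P (var v)"
    and a: "\<And>f g. P f \<Longrightarrow> P g \<Longrightarrow> P (f + g)" and m: "\<And>f g. P f \<Longrightarrow> P g \<Longrightarrow> P (f * g)"
  shows "P f"
proof -
  have pow: "P (f ^ n)" if "P f" for f n
    using c[of 1] by (induction n) (auto intro: m that)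
  have "P (\<Sum>e\<in>S. Poly_Mapping.single e (lookup f e))" if "finite S" for S
    using that
  proof induction
    case empty
    then show ?case using c[of 0] by simp
  next
    case (insert e S)
    have "P (Poly_Mapping.single e (lookup f e))"
      by (subst single_eq) (intro m c pow v)
    then show ?case using insert a by simp
  qed
  from this[of "keys f"] show ?thesis by (simp add: poly_mapping_sum_single)
qed

section \<open>Points, lines and order of vanishing\<close>

definition pt :: "complex \<Rightarrow> complex \<Rightarrow> complex \<Rightarrow> poly3 \<Rightarrow> complex"
  where "pt = ev (\<lambda>c. c)"

definition line :: "complex \<Rightarrow> complex \<Rightarrow> complex \<Rightarrow> complex \<Rightarrow> complex \<Rightarrow> poly3 \<Rightarrow> complex poly"
  where "line a b c t r = ev (\<lambda>c. [:c:]) [:a, 1:] [:b, t:] [:c, r:]"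

lemmas pt_simps = ev_add[OF scalar_hom_id, folded pt_def] ev_mult[OF scalar_hom_id, folded pt_def] 
  ev_0[of "\<lambda>c. c", folded pt_def] ev_1[OF scalar_hom_id, folded pt_def] ev_const[OF scalar_hom_id, folded pt_def]
  ev_var[OF scalar_hom_id, folded pt_def] ev_diff[OF scalar_hom_id, folded pt_def] ev_uminus[OF scalar_hom_id, folded pt_def]
  ev_power[OF scalar_hom_id, folded pt_def]

lemma line_simps:
  "line a b c t r (f + g) = line a b c t r f + line a b c t r g"
  "line a b c t r (f * g) = line a b c t r f * line a b c t r g"
  "line a b c t r (f - g) = line a b c t r f - line a b c t r g"
  "line a b c t r (- f) = - line a b c t r f"
  "line a b c t r (f ^ n) = line a b c t r f ^ n"
  "line a b c t r 0 = 0" "line a b c t r 1 = 1"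
  "line a b c t r (const d) = [:d:]"
  "line a b c t r (var Vx) = [:a, 1:]" "line a b c t r (var Vy) = [:b, t:]" "line a b c t r (var Vz) = [:c, r:]"
  by (simp_all add: line_def ev_add[OF scalar_hom_poly] ev_mult[OF scalar_hom_poly] ev_0 ev_1[OF scalar_hom_poly]
    ev_const[OF scalar_hom_poly] ev_var[OF scalar_hom_poly] ev_diff[OF scalar_hom_poly] ev_uminus[OF scalar_hom_poly] ev_power[OF scalar_hom_poly])

lemma poly_line: "poly (line a b c t r f) s = pt (a + s) (b + s * t) (c + s * r) f"
proof (induction f rule: poly3_induct)
  case (var v)
  then show ?case by (cases v) (simp_all add: line_simps pt_simps)
qed (simp_all add: line_simps pt_simps)

lemma coeff_0_line: "coeff (line a b c t r f) 0 = pt a b c f"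
  using poly_line[of a b c t r f 0] by (simp add: poly_0_coeff_0)

text \<open>The coefficients are polynomial in the direction. Continuity suffices to perturb a
  direction without losing a non-zero coefficient, and to reach exceptional directions as
  limits.\<close>

lemma isCont_coeff_line:
  assumes "isCont t u" "isCont r u"
  shows "isCont (\<lambda>\<tau>. coeff (line a b c (t \<tau>) (r \<tau>) f) j) u"
proof (induction f arbitrary: j rule: poly3_induct)
  case (var v)
  then show ?case
    using assms by (cases v; cases j; cases "j - 1") (auto simp: line_simps coeff_pCons)
next
  case (const d)
  then show ?case by (simp add: line_simps)
next
  case (add f g)
  then show ?case by (simp add: line_simps)
next
  case (mult f g)
  then show ?case by (auto simp: line_simps coeff_mult intro!: continuous_intros)
qed

text \<open>Polynomials vanishing to order \<open>n\<close> at \<open>(a, b, c)\<close>, tested on lines. The directions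
  \<open>(1, t, r)\<close> suffice, being dense.\<close>

definition vanishing :: "complex \<Rightarrow> complex \<Rightarrow> complex \<Rightarrow> nat \<Rightarrow> poly3 set"
  where "vanishing a b c n = {f. \<forall>t r. \<forall>j<n. coeff (line a b c t r f) j = 0}"

lemma vanishingD: "f \<in> vanishing a b c n \<Longrightarrow> j < n \<Longrightarrow> coeff (line a b c t r f) j = 0"
  by (auto simp: vanishing_def)

lemma vanishing_pt: "f \<in> vanishing a b c n \<Longrightarrow> 0 < n \<Longrightarrow> pt a b c f = 0"
  using vanishingD[of f a b c n 0 0 0] by (simp add: coeff_0_line)

lemma ideal_vanishing: "is_ideal (vanishing a b c n)"
  unfolding is_ideal_def
proof (intro conjI ballI allI)
  show "0 \<in> vanishing a b c n" by (simp add: vanishing_def line_simps)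
  fix f assume f: "f \<in> vanishing a b c n"
  show "f + g \<in> vanishing a b c n" if "g \<in> vanishing a b c n" for g
    using f that by (simp add: vanishing_def line_simps)
  show "g * f \<in> vanishing a b c n" for g
    using f by (auto simp: vanishing_def line_simps coeff_mult intro!: sum.neutral)
qed

lemma eventually_not_in_finite: "finite S \<Longrightarrow> eventually (\<lambda>\<tau>::complex. \<tau> \<notin> S) (at u)"
  using eventually_at_topological[of "\<lambda>\<tau>. \<tau> \<notin> S" u] finite_imp_closed[of "S - {u}"]
  by (auto intro!: exI[of _ "- (S - {u})"] open_Compl)

text \<open>If \<open>z\<close> is non-zero at the point, the coefficients of \<open>f\<close>
  vanish one after the other. If it is zero there, then \<open>z\<close> restricts to a multiple of
  the parameter, which can be cancelled in every direction where the multiple is non-zero; the other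
  directions are limits of these.\<close>

lemma vanishing_cancel_linear:
  assumes f: "z * f \<in> vanishing a b c (Suc n)"
    and z: "\<And>t r. line a b c t r z = [:z0, (r - r0) + \<beta> * (t - t0):]"
  shows "f \<in> vanishing a b c n"
  unfolding vanishing_def
proof (intro CollectI allI impI)
  fix t r j assume j: "j < n"
  have cf: "z0 * coeff (line a b c t r f) i + ((r - r0) + \<beta> * (t - t0)) * 
      (case i of 0 \<Rightarrow> 0 | Suc k \<Rightarrow> coeff (line a b c t r f) k) = 0" if "i \<le> n" for t r i
  proof -
    have "coeff (line a b c t r (z * f)) i = 0" using vanishingD[OF f, of i t r] that by simp
    then show ?thesis by (simp add: line_simps z coeff_pCons split: nat.splits)
  qed
  show "coeff (line a b c t r f) j = 0"
  proof (cases "z0 = 0")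
    case False
    have "i \<le> n \<longrightarrow> coeff (line a b c t r f) i = 0" for i
    proof (induction i)
      case 0
      then show ?case using cf[of 0 t r] False by simp
    next
      case (Suc i)
      then show ?case using cf[of "Suc i" t r] False by simp
    qed
    then show ?thesis using j by simp
  next
    case z0: True
    have ne: "coeff (line a b c t r f) j = 0" if "(r - r0) + \<beta> * (t - t0) \<noteq> 0" for r
      using cf[of "Suc j" t r] j that z0 by simp
    show ?thesis
    proof (cases "(r - r0) + \<beta> * (t - t0) = 0")
      case True
      have "isCont (\<lambda>\<tau>. coeff (line a b c t (r + \<tau>) f) j) 0"
        by (rule isCont_coeff_line) (auto intro!: continuous_intros)
      then have lim: "((\<lambda>\<tau>. coeff (line a b c t (r + \<tau>) f) j) \<longlongrightarrow> coeff (line a b c t r f) j) (at 0)"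
        by (simp add: isCont_def)
      have "coeff (line a b c t (r + \<tau>) f) j = 0" if "\<tau> \<noteq> 0" for \<tau>
      proof (rule ne)
        have "(r + \<tau> - r0) + \<beta> * (t - t0) = \<tau> + ((r - r0) + \<beta> * (t - t0))" by simp
        also have "\<dots> = \<tau>" by (simp only: True add_0_right)
        finally show "(r + \<tau> - r0) + \<beta> * (t - t0) \<noteq> 0" using that by metis
      qed
      then have "eventually (\<lambda>\<tau>. coeff (line a b c t (r + \<tau>) f) j = 0) (at 0)"
        by (simp add: eventually_at_filter)
      then have "((\<lambda>\<tau>. coeff (line a b c t (r + \<tau>) f) j) \<longlongrightarrow> 0) (at 0)"
        by (rule tendsto_eventually)
      then show ?thesis using tendsto_unique[OF _ lim] by simp
    qed (rule ne)
  qed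
qed

definition deg :: "(indet \<Rightarrow>\<^sub>0 nat) \<Rightarrow> nat"
  where "deg e = lookup e Vx + lookup e Vy + lookup e Vz"

lemma deg_add: "deg (d + e) = deg d + deg e"
  by (simp add: deg_def lookup_add)

lemma line_degree_le:
  assumes "\<And>e. e \<in> keys f \<Longrightarrow> deg e < n" "n \<le> j"
  shows "coeff (line a b c t r f) j = 0"
proof -
  have "coeff ([:d:] * ev_mon [:a, 1:] [:b, t:] [:c, r:] e) j = 0" if "e \<in> keys f" for d e
  proof (rule coeff_eq_0)
    have "degree (ev_mon [:a, 1:] [:b, t:] [:c, r:] e) \<le> degree [:a, 1:] * lookup e Vx + 
        degree [:b, t:] * lookup e Vy + degree [:c, r:] * lookup e Vz"
      unfolding ev_mon_def
      by (intro degree_mult_le[THEN order_trans] add_mono degree_power_le)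
    also have "\<dots> \<le> deg e" unfolding deg_def by (intro add_mono) simp_all
    also have "\<dots> < j" using assms(1)[OF that] assms(2) by simp
    finally have "degree (ev_mon [:a, 1:] [:b, t:] [:c, r:] e) < j" .
    moreover have "degree ([:d:] * ev_mon [:a, 1:] [:b, t:] [:c, r:] e) \<le> degree (ev_mon [:a, 1:] [:b, t:] [:c, r:] e)"
      using degree_mult_le[of "[:d:]" "ev_mon [:a, 1:] [:b, t:] [:c, r:] e"] by simp
    ultimately show "degree ([:d:] * ev_mon [:a, 1:] [:b, t:] [:c, r:] e) < j" by simp
  qed
  then show ?thesis unfolding line_def ev_def coeff_sum by (intro sum.neutral) blast
qed

text \<open>Kronecker substitution: \<open>(x, x ^ n, x ^ (n * n))\<close> separates the monomials of degree less than \<open>n\<close>.\<close>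

lemma eq_0_if_pt_eq_0:
  assumes "\<And>x y z. x \<noteq> a \<Longrightarrow> pt x y z f = 0"
  shows "f = 0"
proof -
  define n where "n = Suc (\<Sum>e\<in>keys f. deg e)"
  have n: "deg e < n" if "e \<in> keys f" for e
    using member_le_sum[OF that, of deg] by (simp add: n_def)
  \<comment> \<open>All exponents are below \<open>n\<close>, so they are the base-\<open>n\<close>
    digits of \<open>k e\<close>, and remainders and quotients by \<open>n\<close> recover
    them.\<close>
  define k where "k e = lookup e Vx + n * (lookup e Vy + n * lookup e Vz)" for e
  have inj: "e = e'" if "e \<in> keys f" "e' \<in> keys f" "k e = k e'" for e e'
  proof -
    have lt: "lookup e v < n" "lookup e' v < n" for v
      using n[OF that(1)] n[OF that(2)] by (cases v; simp add: deg_def)+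
    have n0: "0 < n" by (simp add: n_def)
    have "k e mod n = k e' mod n" "k e div n = k e' div n" using that(3) by simp_all
    then have 1: "lookup e Vx = lookup e' Vx" "lookup e Vy + n * lookup e Vz = lookup e' Vy + n * lookup e' Vz"
      using lt n0 by (simp_all add: k_def)
    from 1(2) have "(lookup e Vy + n * lookup e Vz) mod n = (lookup e' Vy + n * lookup e' Vz) mod n"
      "(lookup e Vy + n * lookup e Vz) div n = (lookup e' Vy + n * lookup e' Vz) div n" by simp_all
    then have 2: "lookup e Vy = lookup e' Vy" "lookup e Vz = lookup e' Vz" using lt n0 by simp_all
    show ?thesis
    proof (rule poly_mapping_eqI)
      fix v show "lookup e v = lookup e' v" using 1(1) 2 by (cases v) simp_all
    qed
  qed
  define q where "q = (\<Sum>e\<in>keys f. monom (lookup f e) (k e))"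
  have "poly q x = 0" if "x \<noteq> a" for x
  proof -
    have "poly q x = pt x (x ^ n) (x ^ (n * n)) f"
      unfolding q_def pt_def ev_def poly_sum
      by (rule sum.cong) (simp_all add: poly_monom k_def ev_mon_def power_add power_mult distrib_left mult.assoc)
    then show ?thesis using assms[OF that] by simp
  qed
  then have "UNIV - {a} \<subseteq> {x. poly q x = 0}" by auto
  then have "infinite {x. poly q x = 0}"
    using infinite_super[of "UNIV - {a}"] by (simp add: infinite_UNIV_char_0)
  then have "q = 0" using poly_roots_finite by blast
  have "lookup f e = 0" if e: "e \<in> keys f" for e
  proof -
    have "coeff q (k e) = (\<Sum>e'\<in>keys f. if e' = e then lookup f e' else 0)"
      unfolding q_def coeff_sum by (rule sum.cong) (use inj e in auto)
    also have "\<dots> = lookup f e" using e by simp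
    finally show ?thesis using \<open>q = 0\<close> by simp
  qed
  then show ?thesis by (metis in_keys_iff keys_eq_empty equals0I)
qed

text \<open>On each line through the point the restriction has degree below \<open>n\<close> and
  vanishes to order \<open>n\<close>, hence is zero. Lines in the directions
  \<open>(1, t, r)\<close> reach every point with \<open>x \<noteq> a\<close>.\<close>

lemma vanishing_low_degree:
  assumes "f \<in> vanishing a b c n" "\<And>e. e \<in> keys f \<Longrightarrow> deg e < n"
  shows "f = 0"
proof (rule eq_0_if_pt_eq_0[where a = a])
  fix x y z assume x: "x \<noteq> a"
  have "line a b c ((y - b) / (x - a)) ((z - c) / (x - a)) f = 0"
  proof (rule poly_eqI)
    fix j show "coeff (line a b c ((y - b) / (x - a)) ((z - c) / (x - a)) f) j = coeff 0 j"
      using vanishingD[OF assms(1), where j = j] line_degree_le[OF assms(2), where j = j] by (cases "j < n") auto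
  qed
  then show "pt x y z f = 0"
    using poly_line[of a b c "(y - b) / (x - a)" "(z - c) / (x - a)" f "x - a"] x by simp
qed

section \<open>Polynomials in one element, and reduction modulo the equations of a line\<close>

definition cpoly :: "complex poly \<Rightarrow> poly3 \<Rightarrow> poly3"
  where "cpoly p w = poly (map_poly const p) w"

lemma cpoly_simps:
  shows cpoly_0: "cpoly 0 w = 0"
    and cpoly_pCons: "cpoly (pCons a p) w = const a + w * cpoly p w"
  by (simp_all add: cpoly_def map_poly_pCons)

lemma cpoly_add: "cpoly (p + q) w = cpoly p w + cpoly q w"
  by (induction p q rule: poly_induct2) (simp_all add: cpoly_simps const_add algebra_simps)

lemma cpoly_smult: "cpoly (Polynomial.smult a p) w = const a * cpoly p w"
  by (induction p) (simp_all add: cpoly_simps const_mult algebra_simps)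

lemma cpoly_mult: "cpoly (p * q) w = cpoly p w * cpoly q w"
  by (induction p) (simp_all add: cpoly_simps cpoly_add cpoly_smult algebra_simps)

lemma cpoly_1: "cpoly 1 w = 1"
  by (simp add: one_pCons cpoly_simps)

lemma cpoly_X_power: "cpoly ([:0, 1:] ^ n) w = w ^ n"
  by (induction n) (simp_all add: cpoly_1 cpoly_mult cpoly_simps)

lemma cpoly_altdef: 
  assumes "\<And>i. i \<ge> n \<Longrightarrow> coeff p i = 0"
  shows "cpoly p w = (\<Sum>i<n. cscale (coeff p i) (w ^ i))"
  using assms
proof (induction n arbitrary: p)
  case 0
  then have "p = 0" by (intro poly_eqI) simp
  then show ?case by (simp add: cpoly_0)
next
  case (Suc n)
  obtain a q where p: "p = pCons a q" by (cases p)
  have "cpoly q w = (\<Sum>i<n. cscale (coeff q i) (w ^ i))"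
    using Suc.prems[of "Suc _"] by (intro Suc.IH) (simp add: p)
  then show ?case
    by (simp add: p cpoly_pCons sum.lessThan_Suc_shift sum_distrib_left mult_cscale del: sum.lessThan_Suc)
       (simp add: cscale_def)
qed

lemma pt_cpoly: "pt a b c (cpoly p w) = poly p (pt a b c w)"
  by (induction p) (simp_all add: cpoly_simps pt_simps)

lemma line_cpoly: 
  assumes "line a b c t r w = [:0, 1:]"
  shows "line a b c t r (cpoly p w) = p"
  by (induction p) (simp_all add: cpoly_simps line_simps assms)

lemma ideal_cong_mult:
  assumes A: "is_ideal A" and "f - f' \<in> A" "g - g' \<in> A"
  shows "f * g - f' * g' \<in> A"
proof -
  have "f * g - f' * g' = g * (f - f') + f' * (g - g')" by (simp add: algebra_simps)
  then show ?thesis using is_ideal_add[OF A is_ideal_mult[OF A assms(2)] is_ideal_mult[OF A assms(3)]] by metis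
qed

text \<open>Modulo the two equations of the line each variable is a polynomial in
  \<open>x - a\<close>, namely its own restriction, and both sides are compatible with sums and
  products.\<close>

lemma line_cong:
  assumes A: "is_ideal A" and y: "var Vy - const b - const t * (var Vx - const a) \<in> A"
    and z: "var Vz - const c - const r * (var Vx - const a) \<in> A"
  shows "f - cpoly (line a b c t r f) (var Vx - const a) \<in> A"
proof (induction f rule: poly3_induct)
  case (const d)
  then show ?case using is_ideal_0[OF A] by (simp add: line_simps cpoly_simps)
next
  case (var v)
  show ?case
  proof (cases v)
    case Vx
    then show ?thesis using is_ideal_0[OF A] by (simp add: line_simps cpoly_simps)
  next
    case Vy
    then show ?thesis using y by (simp add: line_simps cpoly_simps algebra_simps)
  next
    case Vz
    then show ?thesis using z by (simp add: line_simps cpoly_simps algebra_simps)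
  qed
next
  case (add f g)
  from is_ideal_add[OF A this] show ?case by (simp add: line_simps cpoly_add algebra_simps)
next
  case (mult f g)
  from ideal_cong_mult[OF A this] show ?case by (simp add: line_simps cpoly_mult)
qed

lemma ideal_sum_principal:
  assumes "is_ideal A"
  shows "is_ideal {a + w * r | a r. a \<in> A}"
  unfolding is_ideal_def
proof (intro conjI ballI allI)
  show "0 \<in> {a + w * r | a r. a \<in> A}" using is_ideal_0[OF assms] by (intro CollectI exI[of _ 0]) simp
  fix x assume "x \<in> {a + w * r | a r. a \<in> A}"
  then obtain a r where x: "x = a + w * r" "a \<in> A" by blast
  show "q * x \<in> {a + w * r | a r. a \<in> A}" for q
    using x is_ideal_mult[OF assms x(2), of q]
    by (intro CollectI exI[of _ "q * a"] exI[of _ "q * r"]) (simp add: algebra_simps)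
  fix y assume "y \<in> {a + w * r | a r. a \<in> A}"
  then obtain b s where y: "y = b + w * s" "b \<in> A" by blast
  show "x + y \<in> {a + w * r | a r. a \<in> A}"
    using x y is_ideal_add[OF assms x(2) y(2)]
    by (intro CollectI exI[of _ "a + b"] exI[of _ "r + s"]) (simp add: algebra_simps)
qed

lemma ideal_const_unit:
  assumes "is_ideal A" "const c \<in> A" "c \<noteq> 0"
  shows "f \<in> A"
  using is_ideal_mult[OF assms(1,2), of "f * const (inverse c)"] assms(3)
  by (simp add: mult.assoc const_mult[symmetric])

section \<open>Zeros of ideals of finite colength\<close>

lemma sum_principal_subset: "A \<subseteq> {a + w * r | a r. a \<in> (A :: poly3 set)}"
proof
  fix x assume "x \<in> A"
  then show "x \<in> {a + w * r | a r. a \<in> A}" by (intro CollectI exI[of _ x] exI[of _ 0]) simp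
qed

lemma coeff_X_power: "coeff ([:0, 1:] ^ n :: complex poly) i = (if i = n then 1 else 0)"
  using coeff_monom[of "1::complex" n i] by (auto simp: monom_altdef)

context finite_colength
begin

text \<open>The spaces spanned by \<open>J\<close> and the powers of \<open>w\<close> below
  \<open>k\<close> increase with \<open>k\<close> but have bounded dimension modulo
  \<open>J\<close>. Where the chain stops, \<open>w ^ k\<close> is congruent to a combination of
  lower powers.\<close>

lemma exists_annihilating_poly: "\<exists>P. P \<noteq> 0 \<and> cpoly P w \<in> J"
proof -
  define A where "A k = {f. \<exists>P. (\<forall>j\<ge>k. coeff P j = 0) \<and> f - cpoly P w \<in> J}" for k :: nat
  have sub: "pv.subspace (A k)" for k
    unfolding pv.subspace_def
  proof (intro conjI ballI allI)
    show "0 \<in> A k" unfolding A_def using is_ideal_0[OF J] by (intro CollectI exI[of _ 0]) (simp add: cpoly_0)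
    fix x assume "x \<in> A k"
    then obtain P where P: "\<forall>j\<ge>k. coeff P j = 0" "x - cpoly P w \<in> J" by (auto simp: A_def)
    show "cscale c x \<in> A k" for c
      unfolding A_def using P(1) is_ideal_mult[OF J P(2), of "const c"]
      by (intro CollectI exI[of _ "Polynomial.smult c P"]) (simp add: cpoly_smult cscale_def right_diff_distrib)
    fix y assume "y \<in> A k"
    then obtain Q where Q: "\<forall>j\<ge>k. coeff Q j = 0" "y - cpoly Q w \<in> J" by (auto simp: A_def)
    show "x + y \<in> A k"
      unfolding A_def using P(1) Q(1) is_ideal_add[OF J P(2) Q(2)]
      by (intro CollectI exI[of _ "P + Q"]) (simp add: cpoly_add add_diff_add)
  qed
  have JA: "J \<subseteq> A k" for k
  proof
    fix x assume "x \<in> J"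
    then show "x \<in> A k" unfolding A_def by (intro CollectI exI[of _ 0]) (simp add: cpoly_0)
  qed
  have mono: "A k \<subseteq> A (Suc k)" for k
    unfolding A_def by (auto intro: Suc_leD)
  have "\<exists>k. qdim (A (Suc k)) \<le> qdim (A k)"
  proof (rule ccontr)
    assume "\<not> ?thesis"
    then have less: "qdim (A k) < qdim (A (Suc k))" for k by (simp add: not_le)
    have "k \<le> qdim (A k)" for k
      by (induction k) (use less in \<open>auto simp: Suc_le_eq intro: le_less_trans\<close>)
    moreover have "qdim (A (Suc (qdim UNIV))) \<le> qdim UNIV" by (rule qdim_mono) (use sub in auto)
    ultimately show False using le_trans not_less_eq_eq by blast
  qed
  then obtain k where "qdim (A (Suc k)) \<le> qdim (A k)" by blast
  then have eq: "A (Suc k) = A k" by (intro qdim_eq[OF sub sub mono JA])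
  have "w ^ k \<in> A (Suc k)"
    unfolding A_def using is_ideal_0[OF J]
    by (intro CollectI exI[of _ "[:0, 1:] ^ k"])
      (auto simp: cpoly_X_power coeff_X_power)
  then obtain P where P: "\<forall>j\<ge>k. coeff P j = 0" "w ^ k - cpoly P w \<in> J" unfolding eq by (auto simp: A_def)
  let ?Q = "[:0, 1:] ^ k - P"
  have "coeff ([:0, 1:] ^ k :: complex poly) k = 1" by (simp add: coeff_X_power)
  then have "coeff ?Q k = 1" using P(1) by simp
  then have "?Q \<noteq> 0" by auto
  moreover have "cpoly ?Q w \<in> J"
    using P(2) cpoly_add[of ?Q P w] by (simp add: cpoly_X_power)
  ultimately show ?thesis by blast
qed

text \<open>If adjoining \<open>w - c\<close> for a root \<open>c\<close> of \<open>P\<close> gives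
  the unit ideal, then \<open>w - c\<close> is invertible modulo \<open>A\<close>, so it can be
  cancelled from \<open>P(w)\<close> and the degree falls. A non-zero constant cannot be reached, as
  \<open>A\<close> is proper.\<close>

lemma exists_proper_extension:
  assumes A: "is_ideal A" "1 \<notin> A" and P: "P \<noteq> 0" "cpoly P w \<in> A"
  shows "\<exists>c. 1 \<notin> {a + (w - const c) * r | a r. a \<in> A}"
  using P
proof (induction "degree P" arbitrary: P rule: less_induct)
  case less
  show ?case
  proof (cases "degree P = 0")
    case True
    then obtain d where d: "P = [:d:]" by (rule degree_eq_zeroE)
    then have "const d \<in> A" "d \<noteq> 0" using less.prems by (simp_all add: cpoly_simps)
    then show ?thesis using ideal_const_unit[OF A(1)] A(2) by blast
  next
    case False
    then have "\<not> constant (poly P)" by (simp add: constant_degree)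
    then obtain c where "poly P c = 0" using fundamental_theorem_of_algebra by blast
    then obtain Q where Q: "P = [:- c, 1:] * Q" by (auto simp: poly_eq_0_iff_dvd)
    have Q0: "Q \<noteq> 0" using less.prems Q by auto
    have deg: "degree Q < degree P" unfolding Q by (subst degree_mult_eq) (use Q0 in auto)
    have PQ: "cpoly P w = (w - const c) * cpoly Q w"
      unfolding Q cpoly_mult by (simp add: cpoly_simps const_uminus)
    show ?thesis
    proof (cases "1 \<in> {a + (w - const c) * r | a r. a \<in> A}")
      case True
      then obtain a r where ar: "1 = a + (w - const c) * r" "a \<in> A" by blast
      have "cpoly Q w = 1 * cpoly Q w" by simp
      also have "\<dots> = cpoly Q w * a + r * cpoly P w"
        unfolding PQ by (subst ar(1)) (simp add: algebra_simps)
      also have "\<dots> \<in> A" by (intro is_ideal_add[OF A(1)] is_ideal_mult[OF A(1)] ar less.prems)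
      finally show ?thesis using less.hyps[OF deg Q0] by blast
    qed blast
  qed
qed

text \<open>The weak Nullstellensatz: adjoining \<open>x - a\<close>, \<open>y - b\<close> and
  \<open>z - c\<close> in turn while staying proper makes every polynomial congruent to its value at
  \<open>(a, b, c)\<close>, so elements of \<open>A\<close> must have value zero.\<close>

lemma ideal_has_zero:
  assumes A: "is_ideal A" "J \<subseteq> A" "1 \<notin> A"
  shows "\<exists>a b c. \<forall>f\<in>A. pt a b c f = 0"
proof -
  have ext: "\<exists>A' c. is_ideal A' \<and> A \<subseteq> A' \<and> 1 \<notin> A' \<and> w - const c \<in> A'"
    if A: "is_ideal A" "J \<subseteq> A" "1 \<notin> A" for w A
  proof -
    obtain P where P: "P \<noteq> 0" "cpoly P w \<in> J" using exists_annihilating_poly by blast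
    then have "cpoly P w \<in> A" using A(2) by auto
    then obtain c where c: "1 \<notin> {a + (w - const c) * r | a r. a \<in> A}"
      using exists_proper_extension[OF A(1,3) P(1)] by blast
    have "A \<subseteq> {a + (w - const c) * r | a r. a \<in> A}" by (rule sum_principal_subset)
    moreover have "w - const c \<in> {a + (w - const c) * r | a r. a \<in> A}"
      using is_ideal_0[OF A(1)] by (intro CollectI exI[of _ 0] exI[of _ 1]) simp
    ultimately show ?thesis using ideal_sum_principal[OF A(1)] c by blast
  qed
  obtain A1 a where A1: "is_ideal A1" "A \<subseteq> A1" "1 \<notin> A1" "var Vx - const a \<in> A1"
    using ext[OF A] by blast
  obtain A2 b where A2: "is_ideal A2" "A1 \<subseteq> A2" "1 \<notin> A2" "var Vy - const b \<in> A2"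
    using ext[of A1 "var Vy"] A1 A by blast
  obtain A3 c where A3: "is_ideal A3" "A2 \<subseteq> A3" "1 \<notin> A3" "var Vz - const c \<in> A3"
    using ext[of A2 "var Vz"] A2 A1 A by blast
  have cong: "f - const (pt a b c f) \<in> A3" for f
  proof (induction f rule: poly3_induct)
    case (const d)
    then show ?case using is_ideal_0[OF A3(1)] by (simp add: pt_simps)
  next
    case (var v)
    then show ?case using A1(4) A2(2,4) A3(2,4) by (cases v) (auto simp: pt_simps)
  next
    case (add f g)
    from is_ideal_add[OF A3(1) this] show ?case by (simp add: pt_simps const_add add_diff_add)
  next
    case (mult f g)
    from ideal_cong_mult[OF A3(1) this] show ?case by (simp add: pt_simps const_mult)
  qed
  have "pt a b c f = 0" if "f \<in> A" for f
  proof (rule ccontr)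
    assume "pt a b c f \<noteq> 0"
    moreover have "const (pt a b c f) \<in> A3"
      using is_ideal_diff[OF A3(1), of f, OF _ cong[of f]] that A1(2) A2(2) A3(2) by auto
    ultimately show False using ideal_const_unit[OF A3(1)] A3(3) by blast
  qed
  then show ?thesis by blast
qed

text \<open>The roots of an annihilating polynomial of \<open>w\<close> are split off: a root zero
  contributes a factor \<open>w\<close>, while for \<open>c \<noteq> 0\<close> the element
  \<open>w - c\<close> has no zero in common with \<open>A\<close>, hence is a unit modulo
  \<open>A\<close>.\<close>

lemma nullstellensatz:
  assumes A: "is_ideal A" "J \<subseteq> A" and w: "\<And>a b c. (\<And>f. f \<in> A \<Longrightarrow> pt a b c f = 0) \<Longrightarrow> pt a b c w = 0"
  shows "\<exists>N. w ^ N \<in> A"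
proof -
  have "\<exists>N. w ^ N \<in> A" if "P \<noteq> 0" "w ^ M * cpoly P w \<in> A" for P M
    using that
  proof (induction "degree P" arbitrary: P M rule: less_induct)
    case less
    show ?case
    proof (cases "degree P = 0")
      case True
      then obtain d where d: "P = [:d:]" by (rule degree_eq_zeroE)
      then have "const (inverse d) * (w ^ M * const d) \<in> A" "d \<noteq> 0"
        using less.prems is_ideal_mult[OF A(1)] by (auto simp: cpoly_simps)
      moreover have "const (inverse d) * (w ^ M * const d) = w ^ M * const (inverse d * d)"
        by (simp add: const_mult ac_simps)
      ultimately show ?thesis by auto
    next
      case False
      then have "\<not> constant (poly P)" by (simp add: constant_degree)
      then obtain c where "poly P c = 0" using fundamental_theorem_of_algebra by blast
      then obtain Q where Q: "P = [:- c, 1:] * Q" by (auto simp: poly_eq_0_iff_dvd)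
      have Q0: "Q \<noteq> 0" using less.prems Q by auto
      have deg: "degree Q < degree P" unfolding Q by (subst degree_mult_eq) (use Q0 in auto)
      have PQ: "cpoly P w = (w - const c) * cpoly Q w"
        unfolding Q cpoly_mult by (simp add: cpoly_simps const_uminus)
      show ?thesis
      proof (cases "c = 0")
        case True
        then have "w ^ Suc M * cpoly Q w \<in> A" using less.prems(2) by (simp add: PQ ac_simps)
        then show ?thesis using less.hyps[OF deg Q0] by blast
      next
        case False
        let ?A' = "{a + (w - const c) * r | a r. a \<in> A}"
        have AA': "A \<subseteq> ?A'" by (rule sum_principal_subset)
        have "w - const c \<in> ?A'"
          using is_ideal_0[OF A(1)] by (intro CollectI exI[of _ 0] exI[of _ 1]) simp
        have "1 \<in> ?A'"
        proof (rule ccontr)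
          assume "1 \<notin> ?A'"
          then obtain x y z where pt: "\<forall>f\<in>?A'. pt x y z f = 0"
            using ideal_has_zero[OF ideal_sum_principal[OF A(1)]] AA' A(2) by blast
          then have "pt x y z w = 0" using w AA' by blast
          moreover have "pt x y z (w - const c) = 0" using pt \<open>w - const c \<in> ?A'\<close> by blast
          ultimately show False using False by (simp add: pt_simps)
        qed
        then obtain a r where ar: "1 = a + (w - const c) * r" "a \<in> A" by blast
        have "w ^ M * cpoly Q w = 1 * (w ^ M * cpoly Q w)" by simp
        also have "\<dots> = (w ^ M * cpoly Q w) * a + r * (w ^ M * cpoly P w)"
          unfolding PQ by (subst ar(1)) (simp add: algebra_simps)
        also have "\<dots> \<in> A" by (intro is_ideal_add[OF A(1)] is_ideal_mult[OF A(1)] ar less.prems)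
        finally show ?thesis using less.hyps[OF deg Q0] by blast
      qed
    qed
  qed
  moreover obtain P where "P \<noteq> 0" "cpoly P w \<in> J" using exists_annihilating_poly by blast
  ultimately show ?thesis using A(2) by (metis mult_1 power_0 subsetD)
qed

lemma finite_zeros:
  assumes "J \<subseteq> A"
  shows "finite {(a, b, c). \<forall>f\<in>A. pt a b c f = 0}"
proof -
  obtain P where P: "P \<noteq> 0" "cpoly P (var Vx) \<in> J" using exists_annihilating_poly by blast
  obtain Q where Q: "Q \<noteq> 0" "cpoly Q (var Vy) \<in> J" using exists_annihilating_poly by blast
  obtain R where R: "R \<noteq> 0" "cpoly R (var Vz) \<in> J" using exists_annihilating_poly by blast
  have "{(a, b, c). \<forall>f\<in>A. pt a b c f = 0} \<subseteq> {a. poly P a = 0} \<times> {a. poly Q a = 0} \<times> {a. poly R a = 0}"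
  proof
    fix p assume "p \<in> {(a, b, c). \<forall>f\<in>A. pt a b c f = 0}"
    then obtain a b c where p: "p = (a, b, c)" and "\<forall>f\<in>A. pt a b c f = 0" by (cases p) auto
    then have "pt a b c (cpoly P (var Vx)) = 0" "pt a b c (cpoly Q (var Vy)) = 0" "pt a b c (cpoly R (var Vz)) = 0"
      using P Q R assms by auto
    then show "p \<in> {a. poly P a = 0} \<times> {a. poly Q a = 0} \<times> {a. poly R a = 0}"
      by (simp add: p pt_cpoly pt_simps)
  qed
  then show ?thesis
    using poly_roots_finite[OF P(1)] poly_roots_finite[OF Q(1)] poly_roots_finite[OF R(1)]
    by (meson finite_SigmaI finite_subset)
qed

text \<open>The monomials in question are independent modulo \<open>A\<close>: a combination of them
  lying in \<open>A\<close> has degree below its order of vanishing and is zero. They are adjoined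
  one at a time.\<close>

lemma qdim_ge_vanishing:
  assumes A: "is_ideal A" "J \<subseteq> A" "A \<subseteq> vanishing a b c m" and E: "finite E" "\<And>e. e \<in> E \<Longrightarrow> deg e < m"
  shows "qdim A + card E \<le> qdim UNIV"
proof -
  define S where "S E = {f. \<exists>h. keys h \<subseteq> E \<and> f - h \<in> A}" for E
  have sub: "pv.subspace (S E)" for E
    unfolding pv.subspace_def
  proof (intro conjI ballI allI)
    show "0 \<in> S E" unfolding S_def using is_ideal_0[OF A(1)] by (intro CollectI exI[of _ 0]) simp
    fix x assume "x \<in> S E"
    then obtain h where h: "keys h \<subseteq> E" "x - h \<in> A" by (auto simp: S_def)
    show "cscale d x \<in> S E" for d
    proof -
      have "keys (const d * h) \<subseteq> E"
        using keys_mult[of "const d" h] h(1) by (auto simp: const_def split: if_splits)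
      then show ?thesis unfolding S_def cscale_def using is_ideal_mult[OF A(1) h(2), of "const d"]
        by (intro CollectI exI[of _ "const d * h"]) (simp add: right_diff_distrib)
    qed
    fix y assume "y \<in> S E"
    then obtain k where k: "keys k \<subseteq> E" "y - k \<in> A" by (auto simp: S_def)
    show "x + y \<in> S E"
      unfolding S_def using keys_add[of h k] h k is_ideal_add[OF A(1) h(2) k(2)]
      by (intro CollectI exI[of _ "h + k"]) (auto simp: add_diff_add)
  qed
  have AS: "A \<subseteq> S E" for E
  proof
    fix x assume "x \<in> A"
    then show "x \<in> S E" unfolding S_def by (intro CollectI exI[of _ 0]) simp
  qed
  have "qdim A + card E \<le> qdim (S E)"
    using E
  proof (induction E)
    case empty
    then show ?case using qdim_mono[OF sub subspace_ideal[OF A(1)] AS] by simp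
  next
    case (insert e E)
    have ss: "S E \<subseteq> S (insert e E)" by (auto simp: S_def)
    have "monomial e \<in> S (insert e E)"
      unfolding S_def monomial_def using is_ideal_0[OF A(1)]
      by (intro CollectI exI[of _ "Poly_Mapping.single e 1"]) simp
    moreover have "monomial e \<notin> S E"
    proof
      assume "monomial e \<in> S E"
      then obtain h where h: "keys h \<subseteq> E" "monomial e - h \<in> A" by (auto simp: S_def)
      have "monomial e - h = 0"
      proof (rule vanishing_low_degree)
        show "monomial e - h \<in> vanishing a b c m" using h(2) A(3) by auto
        fix d assume "d \<in> keys (monomial e - h)"
        then have "d \<in> insert e E"
          using h(1) by (auto simp: in_keys_iff lookup_minus monomial_def lookup_single when_def split: if_splits)
        then show "deg d < m" using insert.prems by auto
      qed
      then have "h = monomial e" by simp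
      then have "lookup h e = 1" by (simp add: monomial_def)
      then have "e \<in> keys h" by (simp add: in_keys_iff)
      then show False using h(1) insert.hyps by auto
    qed
    ultimately have "qdim (S E) < qdim (S (insert e E))"
      using qdim_eq[OF sub sub ss] A(2) AS by (metis leI order_trans)
    then show ?case using insert by simp
  qed
  also have "\<dots> \<le> qdim UNIV" by (rule qdim_mono) (use sub in auto)
  finally show ?thesis .
qed

text \<open>A line on which some element of the ideal vanishes to order exactly \<open>n\<close>, inside a plane
  that meets no other zero of the ideal.\<close>

lemma adapted_line:
  assumes A: "is_ideal A" "J \<subseteq> A" "A \<subseteq> vanishing a b c n" and f: "f \<in> A" "f \<notin> vanishing a b c (Suc n)"
  obtains t r \<beta> where "coeff (line a b c t r f) n \<noteq> 0"
    "\<forall>a' b' c'. (\<forall>f\<in>A. pt a' b' c' f = 0) \<longrightarrow>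
        pt a' b' c' (var Vz - const c - const r * (var Vx - const a) 
          + const \<beta> * (var Vy - const b - const t * (var Vx - const a))) = 0 \<longrightarrow> a' = a \<and> b' = b \<and> c' = c"
proof -
  obtain t1 r j where j: "j < Suc n" "coeff (line a b c t1 r f) j \<noteq> 0"
    using f(2) by (auto simp: vanishing_def)
  have "j = n" using j vanishingD[of f a b c n j t1 r] f(1) A(3) by (cases "j < n") auto
  define Z where "Z = {(a, b, c). \<forall>f\<in>A. pt a b c f = 0}"
  have Z: "finite Z" unfolding Z_def by (rule finite_zeros[OF A(2)])
  have "isCont (\<lambda>\<tau>. coeff (line a b c \<tau> r f) n) t1"
    by (rule isCont_coeff_line) (auto intro!: continuous_intros)
  then have "eventually (\<lambda>\<tau>. coeff (line a b c \<tau> r f) n \<noteq> 0) (at t1)"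
    using j \<open>j = n\<close> by (simp add: isCont_def tendsto_imp_eventually_ne)
  \<comment> \<open>Excluding finitely many slopes ensures that a zero of \<open>A\<close> on the
    plane through the point where \<open>y - b = t (x - a)\<close> has first coordinate
    \<open>a\<close>.\<close>
  moreover have "eventually (\<lambda>\<tau>. \<tau> \<notin> (\<lambda>(a', b', c'). (b' - b) / (a' - a)) ` Z) (at t1)"
    by (rule eventually_not_in_finite) (use Z in simp)
  ultimately have "eventually (\<lambda>\<tau>. coeff (line a b c \<tau> r f) n \<noteq> 0 \<and> \<tau> \<notin> (\<lambda>(a', b', c'). (b' - b) / (a' - a)) ` Z) (at t1)"
    by (rule eventually_conj)
  then obtain t where t: "coeff (line a b c t r f) n \<noteq> 0" "t \<notin> (\<lambda>(a', b', c'). (b' - b) / (a' - a)) ` Z"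
    using eventually_happens'[OF at_neq_bot] by blast
  \<comment> \<open>Each zero off that plane rules out a single \<beta>. For the remaining values, a
    zero on the tilted plane lies on the plane determined by \<open>t\<close>, and thus is the given
    point.\<close>
  have "eventually (\<lambda>\<beta>. \<beta> \<notin> (\<lambda>(a', b', c'). - (c' - c - r * (a' - a)) / (b' - b - t * (a' - a))) ` Z) (at (0::complex))"
    by (rule eventually_not_in_finite) (use Z in simp)
  then obtain \<beta> where \<beta>: "\<beta> \<notin> (\<lambda>(a', b', c'). - (c' - c - r * (a' - a)) / (b' - b - t * (a' - a))) ` Z"
    using eventually_happens'[OF at_neq_bot] by blast
  show thesis
  proof (rule that[OF t(1)], intro allI impI)
    fix a' b' c'
    assume z: "\<forall>f\<in>A. pt a' b' c' f = 0"
      and "pt a' b' c' (var Vz - const c - const r * (var Vx - const a) 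
          + const \<beta> * (var Vy - const b - const t * (var Vx - const a))) = 0"
    then have eq: "(c' - c - r * (a' - a)) + \<beta> * (b' - b - t * (a' - a)) = 0" by (simp add: pt_simps)
    have inZ: "(a', b', c') \<in> Z" using z by (simp add: Z_def)
    have y0: "b' - b - t * (a' - a) = 0"
    proof (rule ccontr)
      assume ne: "b' - b - t * (a' - a) \<noteq> 0"
      have "\<beta> * (b' - b - t * (a' - a)) = - (c' - c - r * (a' - a))" using eq by (simp add: add_eq_0_iff2)
      then have "\<beta> = - (c' - c - r * (a' - a)) / (b' - b - t * (a' - a))"
        using ne by (simp add: nonzero_eq_divide_eq)
      then show False using \<beta> inZ by (auto intro: rev_image_eqI)
    qed
    have aa: "a' = a"
    proof (rule ccontr)
      assume "a' \<noteq> a"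
      then have "t = (b' - b) / (a' - a)" using y0 by (simp add: nonzero_eq_divide_eq)
      then show False using t(2) inZ by (auto intro: rev_image_eqI)
    qed
    then show "a' = a \<and> b' = b \<and> c' = c" using y0 eq by simp
  qed
qed

end

section \<open>The bound on the tangent dimension\<close>

lemma card_deg_eq: "finite {e. deg e = n}" "card {e. deg e = n} = (n + 2) choose 2"
proof -
  define h where "h = (\<lambda>(m, k). Poly_Mapping.single Vx (n - m) + Poly_Mapping.single Vy (m - k)
    + Poly_Mapping.single Vz (k :: nat))"
  have look: "lookup (h (m, k)) Vx = n - m" "lookup (h (m, k)) Vy = m - k" "lookup (h (m, k)) Vz = k" for m k
    by (simp_all add: h_def lookup_add lookup_single)
  have img: "{e. deg e = n} = h ` (SIGMA m:{..n}. {..m})"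
  proof (intro equalityI subsetI)
    fix e assume e: "e \<in> {e. deg e = n}"
    let ?p = "(lookup e Vy + lookup e Vz, lookup e Vz)"
    have "e = h ?p"
      by (subst exponent_eq) (use e in \<open>auto simp: h_def deg_def\<close>)
    moreover have "?p \<in> (SIGMA m:{..n}. {..m})" using e by (auto simp: deg_def)
    ultimately show "e \<in> h ` (SIGMA m:{..n}. {..m})" by blast
  next
    fix e assume "e \<in> h ` (SIGMA m:{..n}. {..m})"
    then show "e \<in> {e. deg e = n}" by (auto simp: deg_def look)
  qed
  have inj: "inj_on h (SIGMA m:{..n}. {..m})"
  proof (rule inj_onI)
    fix p q assume pq: "p \<in> (SIGMA m:{..n}. {..m})" "q \<in> (SIGMA m:{..n}. {..m})" "h p = h q"
    obtain m k m' k' where eq: "p = (m, k)" "q = (m', k')" by (cases p, cases q)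
    have "lookup (h p) v = lookup (h q) v" for v using pq(3) by simp
    from this[of Vx] this[of Vz] show "p = q" using pq(1,2) by (auto simp: eq look)
  qed
  show "finite {e. deg e = n}" unfolding img by simp
  have "(\<Sum>m\<le>n. Suc m) = (n + 2) choose 2"
    by (induction n) (simp_all add: eval_nat_numeral)
  then show "card {e. deg e = n} = (n + 2) choose 2"
    unfolding img by (simp add: card_image[OF inj])
qed

lemma card_deg_less: "finite {e. deg e < n}" "card {e. deg e < n} = (n + 2) choose 3"
proof -
  have "finite {e. deg e < n} \<and> card {e. deg e < n} = (n + 2) choose 3"
  proof (induction n)
    case (Suc n)
    have eq: "{e. deg e < Suc n} = {e. deg e < n} \<union> {e. deg e = n}" by auto
    have "card {e. deg e < Suc n} = card {e. deg e < n} + card {e. deg e = n}"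
      unfolding eq by (rule card_Un_disjoint) (use Suc card_deg_eq(1) in auto)
    then show ?case using Suc card_deg_eq[of n] unfolding eq by (simp add: eval_nat_numeral)
  qed simp
  then show "finite {e. deg e < n}" "card {e. deg e < n} = (n + 2) choose 3" by auto
qed

lemma ideal_two_generated: "is_ideal {y * u + z * w | u w. True}"
proof -
  have "{y * u + z * w | u w. True} = {a + z * r | a r. a \<in> {b + y * q | b q. b \<in> {0}}}" by auto
  then show ?thesis
    using ideal_sum_principal[OF ideal_sum_principal[of "{0}" y], of z] by (simp add: is_ideal_def)
qed

context finite_colength
begin

lemma qdim_UNIV_ge_vanishing:
  assumes "is_ideal A" "J \<subseteq> A" "A \<subseteq> vanishing a b c m"
  shows "qdim A + ((m + 2) choose 3) \<le> qdim UNIV"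
  using qdim_ge_vanishing[OF assms card_deg_less(1)[of m]] by (simp add: card_deg_less)

text \<open>The restrictions to the line form an ideal of a univariate polynomial ring. An element
  of least degree generates it, and substituting \<open>x - a\<close> lifts quotients back to three
  variables.\<close>

lemma exists_line_generator:
  assumes "f \<in> A" "line a b c t r f \<noteq> 0" and A: "is_ideal A"
  shows "\<exists>f0\<in>A. \<forall>f\<in>A. \<exists>q. line a b c t r (f - q * f0) = 0"
proof -
  let ?P = "\<lambda>f. f \<in> A \<and> line a b c t r f \<noteq> 0"
  obtain f0 where f0: "?P f0" and min: "\<And>f. ?P f \<Longrightarrow> degree (line a b c t r f0) \<le> degree (line a b c t r f)"
    using exists_least_iff[of "\<lambda>d. \<exists>f. ?P f \<and> degree (line a b c t r f) = d"] assms(1,2)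
    by (metis leI)
  have lin: "line a b c t r (var Vx - const a) = [:0, 1:]" by (simp add: line_simps)
  have "\<exists>q. line a b c t r (f - q * f0) = 0" if f: "f \<in> A" for f
  proof -
    let ?l = "line a b c t r"
    define q where "q = cpoly (?l f div ?l f0) (var Vx - const a)"
    have q: "?l (f - q * f0) = ?l f mod ?l f0"
      by (simp add: q_def line_simps line_cpoly[OF lin] minus_div_mult_eq_mod)
    have "f - q * f0 \<in> A" using f f0 by (intro is_ideal_diff[OF A] is_ideal_mult[OF A]) auto
    then have "?l (f - q * f0) = 0"
      using min[of "f - q * f0"] degree_mod_less[of "?l f0" "?l f"] f0 unfolding q not_less[symmetric] by blast
    then show ?thesis by blast
  qed
  then show ?thesis using f0 by blast
qed

theorem tangent_bound:
  assumes "K g \<subseteq> vanishing a b c n" "\<And>a b c. \<not> K g \<subseteq> vanishing a b c (Suc n)"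
  shows "\<exists>t. quot_dim_le (homs g) (zero_homs g) t \<and> t + 2 * ((n + 2) choose 4) \<le> (2 * n + 1) * qdim (V g)"
  using assms
proof (induction "qdim (V g)" arbitrary: g n a b c rule: less_induct)
  case less
  show ?case
  proof (cases n)
    case 0
    have "1 \<in> K g"
    proof (rule ccontr)
      assume "1 \<notin> K g"
      then obtain a b c where "\<forall>f\<in>K g. pt a b c f = 0"
        using ideal_has_zero[OF ideal_K J_K] by blast
      then have "K g \<subseteq> vanishing a b c (Suc 0)" by (auto simp: vanishing_def coeff_0_line)
      then show False using less.prems(2) 0 by blast
    qed
    then have g: "g \<in> J" by (simp add: K_iff)
    have "homs g \<subseteq> zero_homs g"
    proof
      fix \<phi> assume "\<phi> \<in> homs g"
      then have "\<phi> f \<in> J" if "f \<in> K g" for f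
      proof -
        have "\<phi> f \<in> V g" by (rule homs_V) fact+
        then obtain r where "\<phi> f - g * r \<in> J" by (auto simp: V_iff)
        then show ?thesis
          using is_ideal_add[OF J _ is_ideal_mult_right[OF J g, of r]] by fastforce
      qed
      then show "\<phi> \<in> zero_homs g" by (simp add: zero_homs_def)
    qed
    then have "quot_dim_le (homs g) (zero_homs g) 0" by (rule quot_dim_le_subset)
    then show ?thesis by (intro exI[of _ 0]) (simp add: 0 eval_nat_numeral)
  next
    case (Suc n')
    obtain f where f: "f \<in> K g" "f \<notin> vanishing a b c (Suc n)" using less.prems(2)[of a b c] by blast
    obtain t r \<beta> where cf: "coeff (line a b c t r f) n \<noteq> 0"
      and zeros: "\<forall>a' b' c'. (\<forall>f\<in>K g. pt a' b' c' f = 0) \<longrightarrow>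
        pt a' b' c' (var Vz - const c - const r * (var Vx - const a) 
          + const \<beta> * (var Vy - const b - const t * (var Vx - const a))) = 0 \<longrightarrow> a' = a \<and> b' = b \<and> c' = c"
      by (rule adapted_line[OF ideal_K J_K less.prems(1) f])
    define x where "x = var Vx - const a"
    define y where "y = var Vy - const b - const t * x"
    \<comment> \<open>The planes \<open>y = 0\<close> and \<open>z = 0\<close> meet in the chosen
      line; the summand with \<beta> tilts the second about this line, away from the other
      zeros.\<close>
    define z where "z = var Vz - const c - const r * x + const \<beta> * y"
    have only_zero: "a' = a \<and> b' = b \<and> c' = c"
      if "\<And>f. f \<in> K g \<Longrightarrow> pt a' b' c' f = 0" "pt a' b' c' z = 0" for a' b' c'
      using zeros[rule_format, of a' b' c'] that by (simp add: x_def y_def z_def)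
    let ?l = "line a b c t r"
    have pt_p: "pt a b c x = 0" "pt a b c y = 0" "pt a b c z = 0"
      by (simp_all add: x_def y_def z_def pt_simps)
    have line_z: "line a' b' c' t' r' z = 
        [:c' - c - r * (a' - a) + \<beta> * (b' - b - t * (a' - a)), (r' - r) + \<beta> * (t' - t):]" for a' b' c' t' r'
      by (simp add: x_def y_def z_def line_simps)
    have cong: "h - cpoly (?l h) x \<in> A" if "is_ideal A" "y \<in> A" "z \<in> A" for A h
    proof -
      have "z - const \<beta> * y \<in> A" by (intro is_ideal_diff[OF that(1)] is_ideal_mult[OF that(1)] that)
      then show ?thesis
        using line_cong[OF that(1), of b t a c r h] that(2) by (simp add: x_def y_def z_def)
    qed
    define YZ where "YZ = {y * u + z * w | u w. True}"
    have YZ: "is_ideal YZ" "y \<in> YZ" "z \<in> YZ"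
    proof -
      show "is_ideal YZ" unfolding YZ_def by (rule ideal_two_generated)
      show "y \<in> YZ" unfolding YZ_def by (intro CollectI exI[of _ 1] exI[of _ 0]) simp
      show "z \<in> YZ" unfolding YZ_def by (intro CollectI exI[of _ 0] exI[of _ 1]) simp
    qed
    define A1 where "A1 = {k + z * w | k w. k \<in> K g}"
    have A1: "is_ideal A1" "K g \<subseteq> A1" "z \<in> A1"
    proof -
      show "is_ideal A1" "K g \<subseteq> A1"
        unfolding A1_def by (rule ideal_sum_principal[OF ideal_K], rule sum_principal_subset)
      show "z \<in> A1" unfolding A1_def
        using is_ideal_0[OF ideal_K] by (intro CollectI exI[of _ 0] exI[of _ 1]) simp
    qed
    have zero_A1: "a' = a \<and> b' = b \<and> c' = c" if "\<And>f. f \<in> A1 \<Longrightarrow> pt a' b' c' f = 0" for a' b' c'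
      by (rule only_zero) (use that A1 in auto)
    \<comment> \<open>The plane \<open>z = 0\<close> contains no zero of \<open>K g\<close> except
      \<open>(a, b, c)\<close>, where \<open>y\<close> vanishes.\<close>
    obtain N where "y ^ N \<in> A1"
      using nullstellensatz[OF A1(1), of y] A1(2) J_K zero_A1 pt_p(2) by (metis order_trans)
    then obtain k w where kw: "y ^ N = k + z * w" "k \<in> K g" by (auto simp: A1_def)
    have nil: "y ^ N * h \<in> K g" if "h \<in> K (g * z)" for h
    proof -
      have "y ^ N * h = k * h + w * (z * h)" by (simp add: kw(1) algebra_simps)
      also have "\<dots> \<in> K g"
        using that by (intro is_ideal_add[OF ideal_K is_ideal_mult_right[OF ideal_K kw(2)] is_ideal_mult[OF ideal_K]])
          (simp add: K_mult_iff)
      finally show ?thesis .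
    qed
    define A2 where "A2 = {k + y * u | k u. k \<in> A1}"
    have A2: "is_ideal A2" "A1 \<subseteq> A2" "y \<in> A2"
    proof -
      show "is_ideal A2" "A1 \<subseteq> A2"
        unfolding A2_def by (rule ideal_sum_principal[OF A1(1)], rule sum_principal_subset)
      show "y \<in> A2" unfolding A2_def
        using is_ideal_0[OF A1(1)] by (intro CollectI exI[of _ 0] exI[of _ 1]) simp
    qed
    have zA2: "z \<in> A2" using A1 A2 by auto
    \<comment> \<open>Modulo \<open>A2\<close> the element \<open>f\<close> is \<open>x ^ n\<close>
      times \<open>q(x)\<close> with \<open>q\<close> non-zero at zero, and \<open>q(x)\<close> is a
      unit modulo \<open>A2\<close>. Hence the powers of \<open>x\<close> below \<open>n\<close>
      span \<open>R / A2\<close>, and \<open>e\<close> can be taken to be \<open>n\<close>.\<close>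
    have "x ^ n \<in> A2"
    proof -
      have "[:0, 1:] ^ n dvd ?l f"
        using monom_1_dvd_iff'[of n "?l f"] vanishingD[of f a b c n _ t r] f(1) less.prems(1)
        by (auto simp: monom_altdef)
      then obtain q where q: "?l f = [:0, 1:] ^ n * q" by auto
      have "coeff q 0 \<noteq> 0"
        using cf unfolding q by (auto simp: coeff_mult coeff_X_power sum.delta if_distrib[of "\<lambda>x. x * _"] cong: if_cong)
      have "f - (f - cpoly (?l f) x) \<in> A2"
        using f(1) A1(2) A2(2) by (intro is_ideal_diff[OF A2(1)] cong[OF A2(1,3) zA2]) auto
      then have xq: "x ^ n * cpoly q x \<in> A2" by (simp add: q cpoly_mult cpoly_X_power)
      define A3 where "A3 = {k + cpoly q x * u | k u. k \<in> A2}"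
      have A3: "is_ideal A3" "A2 \<subseteq> A3" "cpoly q x \<in> A3"
      proof -
        show "is_ideal A3" "A2 \<subseteq> A3"
          unfolding A3_def by (rule ideal_sum_principal[OF A2(1)], rule sum_principal_subset)
        show "cpoly q x \<in> A3" unfolding A3_def
          using is_ideal_0[OF A2(1)] by (intro CollectI exI[of _ 0] exI[of _ 1]) simp
      qed
      have "1 \<in> A3"
      proof (rule ccontr)
        assume "1 \<notin> A3"
        then obtain a' b' c' where pt0: "\<forall>f\<in>A3. pt a' b' c' f = 0"
          using ideal_has_zero[OF A3(1)] A3(2) A2(2) A1(2) J_K by (meson order_trans)
        then have "a' = a \<and> b' = b \<and> c' = c" using A3(2) A2(2) by (intro zero_A1) auto
        then have "pt a b c (cpoly q x) = 0" using pt0 A3(3) by blast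
        then show False using \<open>coeff q 0 \<noteq> 0\<close> by (simp add: pt_cpoly pt_p poly_0_coeff_0)
      qed
      then obtain k u where ku: "1 = k + cpoly q x * u" "k \<in> A2" by (auto simp: A3_def)
      have "x ^ n = x ^ n * (k + cpoly q x * u)" using ku(1) by simp
      also have "\<dots> = x ^ n * k + u * (x ^ n * cpoly q x)" by (simp add: algebra_simps)
      also have "\<dots> \<in> A2" by (intro xq is_ideal_add[OF A2(1)] is_ideal_mult[OF A2(1)] ku(2))
      finally show ?thesis .
    qed
    have gen: "\<exists>d u w. h - (\<Sum>i<n. cscale (d i) (x ^ i)) - y * u - z * w \<in> K g" for h
    proof -
      define R where "R = ?l h mod [:0, 1:] ^ n"
      define Q where "Q = ?l h div [:0, 1:] ^ n"
      have "?l h = R + [:0, 1:] ^ n * Q" by (simp add: R_def Q_def)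
      then have l: "cpoly (?l h) x = cpoly R x + x ^ n * cpoly Q x"
        by (simp add: cpoly_add cpoly_mult cpoly_X_power)
      have "[:0, 1:] ^ n \<noteq> (0 :: complex poly)" by simp
      from degree_mod_less[OF this, of "?l h"] have "R = 0 \<or> degree R < n"
        by (simp add: R_def degree_power_eq)
      then have "coeff R i = 0" if "i \<ge> n" for i using that by (auto intro: coeff_eq_0)
      then have R: "cpoly R x = (\<Sum>i<n. cscale (coeff R i) (x ^ i))" by (rule cpoly_altdef)
      have "(h - cpoly (?l h) x) + x ^ n * cpoly Q x \<in> A2"
        by (intro is_ideal_add[OF A2(1)] cong[OF A2(1,3) zA2] is_ideal_mult_right[OF A2(1)] \<open>x ^ n \<in> A2\<close>)
      then have "h - (\<Sum>i<n. cscale (coeff R i) (x ^ i)) \<in> A2" by (simp add: l R)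
      then obtain k u w where "h - (\<Sum>i<n. cscale (coeff R i) (x ^ i)) = k + z * w + y * u" "k \<in> K g"
        by (auto simp: A2_def A1_def)
      then have "h - (\<Sum>i<n. cscale (coeff R i) (x ^ i)) - y * u - z * w \<in> K g" by simp
      then show ?thesis by (intro exI)
    qed
    have "?l f \<noteq> 0" using cf by auto
    then obtain f0 where f0: "f0 \<in> K g" "\<forall>h\<in>K g. \<exists>q. ?l (h - q * f0) = 0"
      using exists_line_generator[OF f(1) _ ideal_K] by blast
    have f0_gen: "\<exists>q u w. h = q * f0 + y * u + z * w" if h: "h \<in> K g" for h
    proof -
      obtain q where q: "?l (h - q * f0) = 0" using f0(2) h by blast
      have "(h - q * f0) - cpoly (?l (h - q * f0)) x \<in> YZ" by (rule cong[OF YZ])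
      then have "h - q * f0 \<in> YZ" by (simp add: q cpoly_0)
      then obtain u w where "h - q * f0 = y * u + z * w" by (auto simp: YZ_def)
      then have "h = q * f0 + y * u + z * w" by (simp add: algebra_simps)
      then show ?thesis by blast
    qed
    have V_le: "qdim (V (g * z)) \<le> qdim (V g)"
      by (rule qdim_mono[OF subspace_ideal[OF ideal_V] subspace_ideal[OF ideal_V] V_mult])
    \<comment> \<open>Equality would make \<open>z\<close> a unit modulo \<open>K g\<close>,
      although \<open>z\<close> vanishes at a zero of \<open>K g\<close>.\<close>
    have V_less: "qdim (V (g * z)) < qdim (V g)"
    proof (rule ccontr)
      assume "\<not> ?thesis"
      then have "V g = V (g * z)"
        by (intro qdim_eq[OF subspace_ideal[OF ideal_V] subspace_ideal[OF ideal_V] V_mult J_V]) simp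
      then have "g \<in> V (g * z)" using V_self[of g 1] by simp
      then obtain w where "g - g * z * w \<in> J" by (auto simp: V_iff)
      then have "1 - z * w \<in> K g" by (simp add: K_iff algebra_simps)
      then have "pt a b c (1 - z * w) = 0"
        using vanishing_pt[of "1 - z * w" a b c n] less.prems(1) Suc by auto
      then show False by (simp add: pt_simps pt_p)
    qed
    have not_Suc: "\<not> K (g * z) \<subseteq> vanishing a b c (Suc n)" for a b c
      using less.prems(2)[of a b c] K_mult[of g z] by blast
    \<comment> \<open>If \<open>K (g * z)\<close> has order \<open>n\<close> somewhere, possibly at
      another point, the induction hypothesis applies with the same \<open>n\<close>. Otherwise the
      maximal order is \<open>n - 1\<close>, since cancelling \<open>z\<close> costs at most one at
      \<open>(a, b, c)\<close>.\<close>
    have "\<exists>t. quot_dim_le (homs (g * z)) (zero_homs (g * z)) t \<and> t + 2 * ((n + 2) choose 4) \<le> (2 * n + 1) * qdim (V (g * z))"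
    proof (cases "\<exists>a b c. K (g * z) \<subseteq> vanishing a b c n")
      case True
      then obtain a b c where "K (g * z) \<subseteq> vanishing a b c n" by blast
      from less.hyps[OF V_less this not_Suc] show ?thesis .
    next
      case False
      have "K (g * z) \<subseteq> vanishing a b c n'"
      proof
        fix h assume "h \<in> K (g * z)"
        then have "z * h \<in> vanishing a b c (Suc n')" using less.prems(1) Suc by (auto simp: K_mult_iff)
        then show "h \<in> vanishing a b c n'" by (rule vanishing_cancel_linear) (rule line_z)
      qed
      note sub = this
      from less.hyps[OF V_less this] False Suc obtain t'
        where t': "quot_dim_le (homs (g * z)) (zero_homs (g * z)) t'" "t' + 2 * ((n' + 2) choose 4) \<le> (2 * n' + 1) * qdim (V (g * z))"
        by blast
      \<comment> \<open>Raising the factor \<open>2 * n' + 1\<close> to \<open>2 * n + 1\<close>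
        adds twice the colength of \<open>K (g * z)\<close>, which pays for the increase of the
        binomial term.\<close>
      have "(n' + 2) choose 3 \<le> qdim (V (g * z))"
        using qdim_UNIV_ge_vanishing[OF ideal_K J_K sub] qdim_K_V[of "g * z"] by linarith
      moreover have "(n + 2) choose 4 = ((n' + 2) choose 4) + ((n' + 2) choose 3)"
        by (simp add: Suc eval_nat_numeral)
      moreover have "(2 * n + 1) * qdim (V (g * z)) = (2 * n' + 1) * qdim (V (g * z)) + 2 * qdim (V (g * z))"
        by (simp add: Suc algebra_simps)
      ultimately show ?thesis using t' by (intro exI[of _ t']) linarith
    qed
    then obtain t' where t': "quot_dim_le (homs (g * z)) (zero_homs (g * z)) t'"
      "t' + 2 * ((n + 2) choose 4) \<le> (2 * n + 1) * qdim (V (g * z))" by blast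
    let ?N = "qdim (V g) - qdim (V (g * z))"
    have "quot_dim_le (homs g) (zero_homs g) (?N * n + t' + ?N * (n + 1))"
      by (rule tangent_bound_step[OF nil f0(1) f0_gen gen t'(1)])
    moreover have "?N * n + t' + ?N * (n + 1) + 2 * ((n + 2) choose 4) \<le> (2 * n + 1) * qdim (V g)"
    proof -
      have "?N * n + t' + ?N * (n + 1) + 2 * ((n + 2) choose 4) \<le> (2 * n + 1) * ?N + (2 * n + 1) * qdim (V (g * z))"
      proof -
        have "N * n + N * (n + 1) = (2 * n + 1) * N" for N by (simp add: algebra_simps)
        from this[of ?N] show ?thesis using t'(2) by linarith
      qed
      also have "\<dots> = (2 * n + 1) * qdim (V g)" using V_le by (simp only: distrib_left[symmetric]) simp
      finally show ?thesis .
    qed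
    ultimately show ?thesis by blast
  qed
qed

text \<open>If some order could always be exceeded, an order larger than the colength would occur,
  contradicting the colength needed for that order.\<close>

lemma exists_multiplicity:
  "\<exists>n a b c. J \<subseteq> vanishing a b c n \<and> (\<forall>a b c. \<not> J \<subseteq> vanishing a b c (Suc n))"
proof (rule ccontr)
  assume neg: "\<not> ?thesis"
  have "\<exists>a b c. J \<subseteq> vanishing a b c n" for n
  proof (induction n)
    case 0
    then show ?case by (auto simp: vanishing_def)
  next
    case (Suc n)
    then show ?case using neg by blast
  qed
  then obtain a b c where "J \<subseteq> vanishing a b c (Suc (qdim UNIV))" by blast
  from qdim_UNIV_ge_vanishing[OF J subset_refl this] have "(qdim UNIV + 3) choose 3 \<le> qdim UNIV" by (simp add: numeral_3_eq_3)
  moreover have "n < (n + 3) choose 3" for n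
    by (induction n) (simp_all add: eval_nat_numeral)
  ultimately show False using not_le by blast
qed

end

section \<open>Coordinates on quotient spaces\<close>

lemma lookup_cscale: "lookup (cscale c f) e = c * lookup f e"
  unfolding cscale_def const_def mult_map_scale_conv_mult[symmetric]
  by (simp add: map.rep_eq when_def)

lemma monomial_eq_iff: "monomial d = monomial e \<longleftrightarrow> d = e"
proof
  assume "monomial d = monomial e"
  then have "keys (monomial d) = keys (monomial e)" by simp
  then show "d = e" by (simp add: monomial_def)
qed simp

lemma independent_monomials: "pv.independent (monomial ` E)"
proof
  assume "pv.dependent (monomial ` E)"
  then obtain S u v where S: "finite S" "S \<subseteq> monomial ` E" "(\<Sum>w\<in>S. cscale (u w) w) = 0" "v \<in> S" "u v \<noteq> 0"
    unfolding pv.dependent_explicit by blast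
  then obtain e where e: "v = monomial e" by auto
  have "lookup (\<Sum>w\<in>S. cscale (u w) w) e = (\<Sum>w\<in>S. if w = v then u v else 0)"
    unfolding lookup_sum
  proof (rule sum.cong)
    fix w assume "w \<in> S"
    then obtain d where "w = monomial d" using S(2) by auto
    then show "lookup (cscale (u w) w) e = (if w = v then u v else 0)"
      by (simp add: e monomial_eq_iff lookup_cscale) (simp add: monomial_def lookup_single when_def)
  qed simp
  also have "\<dots> = u v" using S(1,4) by simp
  finally show False using S(3,5) by simp
qed

text \<open>The polynomial ring merely plays the role of a large class-based vector space.\<close>

locale coordinate_map = vectorspace complex_field V
  for V :: "(complex, 'v, 'm) module_scheme" +
  fixes T :: "'v \<Rightarrow> poly3"
  assumes T_add: "v \<in> carrier V \<Longrightarrow> w \<in> carrier V \<Longrightarrow> T (v \<oplus>\<^bsub>V\<^esub> w) = T v + T w"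
    and T_smult: "v \<in> carrier V \<Longrightarrow> T (c \<odot>\<^bsub>V\<^esub> v) = cscale c (T v)"
begin

lemma T_zero: "T \<zero>\<^bsub>V\<^esub> = 0"
  using T_add[of "\<zero>\<^bsub>V\<^esub>" "\<zero>\<^bsub>V\<^esub>"] by simp

lemma T_lincomb:
  assumes "finite A" "A \<subseteq> carrier V"
  shows "T (lincomb a A) = (\<Sum>v\<in>A. cscale (a v) (T v))"
  using assms
proof (induction A)
  case empty
  then show ?case by (simp add: lincomb_def T_zero)
next
  case (insert v A)
  have "lincomb a (insert v A) = (a v \<odot>\<^bsub>V\<^esub> v) \<oplus>\<^bsub>V\<^esub> lincomb a A"
    using lincomb_insert[of A a v] insert by simp
  moreover have "lincomb a A \<in> carrier V" "a v \<odot>\<^bsub>V\<^esub> v \<in> carrier V"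
    using insert.prems by (auto intro!: lincomb_closed smult_closed)
  ultimately show ?case using insert by (simp add: T_add T_smult)
qed

lemma lin_indpt_if_independent:
  assumes S: "S \<subseteq> carrier V" and inj: "inj_on T S" and ind: "pv.independent (T ` S)"
  shows "lin_indpt S"
proof
  assume "lin_dep S"
  then obtain A a v where A: "finite A" "A \<subseteq> S" "lincomb a A = \<zero>\<^bsub>V\<^esub>" "v \<in> A" "a v \<noteq> 0"
    unfolding lin_dep_def by auto
  have injA: "inj_on T A" using inj A(2) by (rule inj_on_subset)
  have "(\<Sum>x\<in>T ` A. cscale (a (the_inv_into A T x)) x) = (\<Sum>v\<in>A. cscale (a v) (T v))"
    by (simp add: sum.reindex[OF injA] the_inv_into_f_f[OF injA])
  also have "\<dots> = 0" using T_lincomb[of A a] A S T_zero by auto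
  finally have "a (the_inv_into A T (T v)) = 0"
    using pv.independentD[OF ind, of "T ` A" "\<lambda>x. a (the_inv_into A T x)" "T v"] A by auto
  then show False using A by (simp add: the_inv_into_f_f[OF injA])
qed

context
  assumes T_inj: "\<And>v. v \<in> carrier V \<Longrightarrow> T v = 0 \<Longrightarrow> v = \<zero>\<^bsub>V\<^esub>"
begin

lemma inj_T: "inj_on T (carrier V)"
proof (rule inj_onI)
  fix v w assume vw: "v \<in> carrier V" "w \<in> carrier V" "T v = T w"
  have m: "(- 1) \<odot>\<^bsub>V\<^esub> w \<in> carrier V" using vw by (auto intro!: smult_closed)
  have "T (v \<oplus>\<^bsub>V\<^esub> (- 1) \<odot>\<^bsub>V\<^esub> w) = T v + cscale (- 1) (T w)" using vw m by (simp add: T_add T_smult)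
  also have "\<dots> = 0" using vw by (simp add: cscale_def const_uminus)
  finally have "v \<oplus>\<^bsub>V\<^esub> (- 1) \<odot>\<^bsub>V\<^esub> w = \<zero>\<^bsub>V\<^esub>" using vw m by (intro T_inj) auto
  moreover have "w \<oplus>\<^bsub>V\<^esub> (- 1) \<odot>\<^bsub>V\<^esub> w = \<zero>\<^bsub>V\<^esub>"
  proof (rule T_inj)
    have "T (w \<oplus>\<^bsub>V\<^esub> (- 1) \<odot>\<^bsub>V\<^esub> w) = T w + cscale (- 1) (T w)" using vw m by (simp add: T_add T_smult)
    then show "T (w \<oplus>\<^bsub>V\<^esub> (- 1) \<odot>\<^bsub>V\<^esub> w) = 0" by (simp add: cscale_def const_uminus)
  qed (use vw m in auto)
  ultimately show "v = w" using M.add.right_cancel[of "(- 1) \<odot>\<^bsub>V\<^esub> w" v w] vw m by simp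
qed

lemma independent_if_lin_indpt:
  assumes S: "S \<subseteq> carrier V" "finite S" and ind: "lin_indpt S"
  shows "pv.independent (T ` S)"
proof (rule pv.independent_if_scalars_zero)
  fix f x assume f: "(\<Sum>x\<in>T ` S. cscale (f x) x) = 0" and "x \<in> T ` S"
  then obtain v where v: "v \<in> S" "x = T v" by auto
  have injS: "inj_on T S" using inj_T S(1) by (rule inj_on_subset)
  have "T (lincomb (f \<circ> T) S) = 0"
    using f T_lincomb[OF S(2,1)] by (simp add: sum.reindex[OF injS])
  then have "lincomb (f \<circ> T) S = \<zero>\<^bsub>V\<^esub>" using S by (intro T_inj lincomb_closed) auto
  then show "f x = 0"
    using lin_dep_crit[OF S(2) subset_refl, of "f \<circ> T" v] v ind by auto
qed (use S in auto)

text \<open>Independent sets are carried to independent sets in the span of \<open>G\<close>, so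
  their sizes are bounded, and a maximal one is a basis.\<close>

lemma fin_dim_dim_le:
  assumes G: "finite G" and sub: "\<And>v. v \<in> carrier V \<Longrightarrow> T v \<in> pv.span G"
  shows "fin_dim" "dim \<le> card G"
proof -
  have bound: "finite S \<and> card S \<le> card G" if S: "S \<subseteq> carrier V \<and> lin_indpt S" for S
  proof -
    have fin: "card A \<le> card G" if A: "A \<subseteq> S" "finite A" for A
    proof -
      have "lin_indpt A" using subset_li_is_li[of S A] S A by auto
      then have "pv.independent (T ` A)" using independent_if_lin_indpt[of A] A S by auto
      moreover have "T ` A \<subseteq> pv.span G" using sub A S by auto
      ultimately have "card (T ` A) \<le> card G" using pv.independent_span_bound[OF G] by blast
      moreover have "inj_on T A" using inj_T A S by (auto intro: inj_on_subset)
      ultimately show ?thesis by (simp add: card_image)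
    qed
    have "finite S"
    proof (rule ccontr)
      assume "infinite S"
      then obtain A where "A \<subseteq> S" "finite A" "card A = Suc (card G)"
        using infinite_arbitrarily_large by blast
      then show False using fin[of A] by simp
    qed
    then show ?thesis using fin[of S] by simp
  qed
  have "lin_indpt {}" unfolding lin_dep_def by auto
  then obtain S where S: "finite S" "maximal S (\<lambda>S. S \<subseteq> carrier V \<and> lin_indpt S)"
    using maximal_exists[of "\<lambda>S. S \<subseteq> carrier V \<and> lin_indpt S" "card G" "{}"] bound by auto
  have b: "basis S" by (rule max_li_is_basis[OF S(2)])
  show "fin_dim" using b S(1) unfolding fin_dim_def basis_def by blast
  show "dim \<le> card G" using dim_basis[OF S(1) b] bound[of S] b unfolding basis_def by auto
qed

lemma image_basis:
  assumes "fin_dim"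
  obtains B where "finite B" "card B = dim" "pv.independent B" "B \<subseteq> T ` carrier V"
    "\<forall>v\<in>carrier V. T v \<in> pv.span B"
proof -
  obtain S where S: "finite S" "basis S" using finite_basis_exists[OF assms] by blast
  have S': "lin_indpt S" "span S = carrier V" "S \<subseteq> carrier V" using S(2) by (auto simp: basis_def)
  show thesis
  proof (rule that[of "T ` S"])
    show "finite (T ` S)" using S by simp
    have "inj_on T S" using inj_T S'(3) by (rule inj_on_subset)
    then show "card (T ` S) = dim" using dim_basis[OF S] by (simp add: card_image)
    show "pv.independent (T ` S)" by (rule independent_if_lin_indpt[OF S'(3) S(1) S'(1)])
    show "T ` S \<subseteq> T ` carrier V" using S'(3) by auto
    show "\<forall>v\<in>carrier V. T v \<in> pv.span (T ` S)"
    proof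
      fix v assume "v \<in> carrier V"
      obtain a where "v = lincomb a S" using finite_span[OF S(1) S'(3)] S'(2) \<open>v \<in> carrier V\<close> by auto
      then have "T v = (\<Sum>v\<in>S. cscale (a v) (T v))" using T_lincomb[OF S(1) S'(3)] by simp
      also have "\<dots> \<in> pv.span (T ` S)"
        by (intro pv.span_sum pv.span_scale) (auto intro: pv.span_base)
      finally show "T v \<in> pv.span (T ` S)" .
    qed
  qed
qed

end

end

section \<open>Cosets, and bases of the quotient space\<close>

definition coset :: "poly3 set \<Rightarrow> poly3 \<Rightarrow> poly3 set"
  where "coset J f = {h. h - f \<in> J}"

definition rep :: "poly3 set \<Rightarrow> poly3" where "rep C = (SOME f. f \<in> C)"

context
  fixes J assumes J: "is_ideal J"
begin

lemma coset_eq_iff: "coset J f = coset J g \<longleftrightarrow> f - g \<in> J"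
proof
  assume "coset J f = coset J g"
  moreover have "f \<in> coset J f" using is_ideal_0[OF J] by (simp add: coset_def)
  ultimately show "f - g \<in> J" by (auto simp: coset_def)
next
  assume fg: "f - g \<in> J"
  show "coset J f = coset J g"
    unfolding coset_def
    using is_ideal_add[OF J _ fg] is_ideal_diff[OF J _ fg] by (fastforce simp: algebra_simps)
qed

lemma rep_coset: "rep (coset J f) - f \<in> J"
proof -
  have "f \<in> coset J f" using is_ideal_0[OF J] by (simp add: coset_def)
  then have "rep (coset J f) \<in> coset J f" unfolding rep_def by (rule someI)
  then show ?thesis by (simp add: coset_def)
qed

lemma coset_0: "coset J 0 = J" by (simp add: coset_def)

lemma r_coset_eq: "J +>\<^bsub>polyring\<^esub> f = coset J f"
  unfolding a_r_coset_def' coset_def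
proof (intro equalityI subsetI)
  fix h assume "h \<in> {h. h - f \<in> J}"
  then show "h \<in> (\<Union>j\<in>J. {j \<oplus>\<^bsub>polyring\<^esub> f})" by (auto intro!: bexI[of _ "h - f"])
qed auto

lemma quotient_simps:
  "carrier (polyring Quot J) = range (coset J)"
  "zero (polyring Quot J) = coset J 0"
  "coset J f \<oplus>\<^bsub>polyring Quot J\<^esub> coset J g = coset J (f + g)"
  "coset J f \<otimes>\<^bsub>polyring Quot J\<^esub> coset J g = coset J (f * g)"
proof -
  interpret ideal J polyring using J is_ideal_iff by blast
  show "carrier (polyring Quot J) = range (coset J)"
    by (auto simp: FactRing_def A_RCOSETS_def' r_coset_eq)
  show "zero (polyring Quot J) = coset J 0" by (simp add: FactRing_def coset_0)
  show "coset J f \<oplus>\<^bsub>polyring Quot J\<^esub> coset J g = coset J (f + g)"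
    using a_rcos_sum[of f g] by (simp add: FactRing_def r_coset_eq)
  show "coset J f \<otimes>\<^bsub>polyring Quot J\<^esub> coset J g = coset J (f * g)"
    using rcoset_mult_add[of f g] by (simp add: FactRing_def r_coset_eq)
qed

lemma quotient_space_simps:
  "carrier (quotient_space J) = range (coset J)"
  "zero (quotient_space J) = coset J 0"
  "coset J f \<oplus>\<^bsub>quotient_space J\<^esub> coset J g = coset J (f + g)"
  "c \<odot>\<^bsub>quotient_space J\<^esub> coset J f = coset J (cscale c f)"
  by (simp_all add: quotient_space_def restrict_scalars_def quotient_module_simps quotient_simps r_coset_eq cscale_def)

lemma coordinate_map_quotient:
  assumes "\<And>f g. \<pi> (f + g) = \<pi> f + \<pi> g" "\<And>c f. \<pi> (cscale c f) = cscale c (\<pi> f)" "\<And>f. f \<in> J \<Longrightarrow> \<pi> f = 0"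
  shows "coordinate_map (quotient_space J) (\<lambda>C. \<pi> (rep C))" "\<pi> (rep (coset J f)) = \<pi> f"
proof -
  interpret vectorspace complex_field "quotient_space J"
    by (rule vectorspace_quotient_space) (use J is_ideal_iff in blast)
  show rep: "\<pi> (rep (coset J f)) = \<pi> f" for f
    using assms(1)[of "rep (coset J f) - f" f] assms(3)[OF rep_coset] by simp
  show "coordinate_map (quotient_space J) (\<lambda>C. \<pi> (rep C))"
  proof
    fix v w assume "v \<in> carrier (quotient_space J)" "w \<in> carrier (quotient_space J)"
    then show "\<pi> (rep (v \<oplus>\<^bsub>quotient_space J\<^esub> w)) = \<pi> (rep v) + \<pi> (rep w)"
      by (auto simp: quotient_space_simps rep assms)
  next
    fix v c assume "v \<in> carrier (quotient_space J)"
    then show "\<pi> (rep (c \<odot>\<^bsub>quotient_space J\<^esub> v)) = cscale c (\<pi> (rep v))"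
      by (auto simp: quotient_space_simps rep assms)
  qed
qed

end

text \<open>A basis of \<open>J\<close> is extended to the whole space; the projection kills the
  former and fixes the added vectors. No finiteness is involved, so this is available before a
  finite complement has been found.\<close>

lemma exists_projection:
  assumes "pv.subspace J"
  shows "\<exists>\<pi>. (\<forall>f g. \<pi> (f + g) = \<pi> f + \<pi> g) \<and> (\<forall>c f. \<pi> (cscale c f) = cscale c (\<pi> f)) \<and>
    (\<forall>f. f \<in> J \<longrightarrow> \<pi> f = 0) \<and> (\<forall>f. f - \<pi> f \<in> J)"
proof -
  obtain C where C: "C \<subseteq> J" "pv.independent C" "J \<subseteq> pv.span C" by (rule pv.maximal_independent_subset)
  have spanC: "pv.span C = J" using C pv.span_minimal[OF C(1) assms] by auto
  define E where "E = pv.extend_basis C"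
  have E: "C \<subseteq> E" "pv.independent E" "pv.span E = UNIV"
    using pv.extend_basis_superset[OF C(2)] pv.independent_extend_basis[OF C(2)] pv.span_extend_basis[OF C(2)]
    by (auto simp: E_def)
  interpret vp: vector_space_pair cscale cscale ..
  define \<pi> where "\<pi> = vp.construct E (\<lambda>e. if e \<in> C then 0 else e)"
  have lin: "Vector_Spaces.linear cscale cscale \<pi>" unfolding \<pi>_def by (rule vp.linear_construct[OF E(2)])
  have E_img: "\<pi> e = (if e \<in> C then 0 else e)" if "e \<in> E" for e
    unfolding \<pi>_def by (rule vp.construct_basis[OF E(2) that])
  note lin_simps = vp.linear_add[OF lin] vp.linear_scale[OF lin] vp.linear_0[OF lin]
  have "\<pi> f = 0" if "f \<in> pv.span C" for f
    using that by (induction rule: pv.span_induct_alt) (use E_img E(1) in \<open>auto simp: lin_simps\<close>)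
  moreover have "f - \<pi> f \<in> J" for f
  proof -
    have "f \<in> pv.span E" using E by simp
    then show ?thesis
    proof (induction rule: pv.span_induct_alt)
      case base
      then show ?case using pv.subspace_0[OF assms] by (simp add: lin_simps)
    next
      case (step c x y)
      have "x - \<pi> x \<in> J" using E_img[OF step(1)] C(1) pv.subspace_0[OF assms] by auto
      then have "cscale c (x - \<pi> x) + (y - \<pi> y) \<in> J"
        using pv.subspace_add[OF assms] pv.subspace_scale[OF assms] step by blast
      then show ?case by (simp add: lin_simps pv.scale_right_diff_distrib add_diff_add)
    qed
  qed
  ultimately show ?thesis using spanC by (intro exI[of _ \<pi>]) (auto simp: lin_simps)
qed

text \<open>A projection along \<open>J\<close> induces an injective map on \<open>R / J\<close>;
  the image of a basis is a basis of a complement of \<open>J\<close>.\<close>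

lemma hilbert_points_finite_colength:
  assumes "J \<in> hilbert_points l"
  obtains B where "finite_colength J B" "card B = l"
proof -
  have J: "is_ideal J" using assms by (auto simp: hilbert_points_def is_ideal_iff)
  obtain \<pi> where \<pi>: "\<And>f g. \<pi> (f + g) = \<pi> f + \<pi> g" "\<And>c f. \<pi> (cscale c f) = cscale c (\<pi> f)"
    "\<And>f. f \<in> J \<Longrightarrow> \<pi> f = 0" "\<And>f. f - \<pi> f \<in> J"
    using exists_projection[OF subspace_ideal[OF J]] by blast
  interpret coordinate_map "quotient_space J" "\<lambda>C. \<pi> (rep C)"
    by (rule coordinate_map_quotient[OF J \<pi>(1-3)])
  note rep = coordinate_map_quotient(2)[OF J \<pi>(1-3)]
  have inj: "v = \<zero>\<^bsub>quotient_space J\<^esub>" if v: "v \<in> carrier (quotient_space J)" "\<pi> (rep v) = 0" for v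
  proof -
    obtain f where f: "v = coset J f" using v(1) by (auto simp: quotient_space_simps[OF J])
    then have "f \<in> J" using v(2) rep \<pi>(4)[of f] by simp
    then show ?thesis unfolding f quotient_space_simps[OF J] coset_eq_iff[OF J] by simp
  qed
  have fd: "fin_dim" "dim = l" using assms by (auto simp: hilbert_points_def)
  obtain B where B: "finite B" "card B = dim" "pv.independent B" "B \<subseteq> (\<lambda>C. \<pi> (rep C)) ` carrier (quotient_space J)"
    "\<forall>v\<in>carrier (quotient_space J). \<pi> (rep v) \<in> pv.span B"
    by (rule image_basis[OF inj fd(1)])
  have idem: "\<pi> (\<pi> f) = \<pi> f" for f
    using \<pi>(3)[OF \<pi>(4)[of f]] \<pi>(1)[of "f - \<pi> f" "\<pi> f"] by simp
  have fixed: "\<pi> f = f" if "f \<in> pv.span B" for f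
    using that
  proof (induction rule: pv.span_induct_alt)
    case base
    then show ?case using \<pi>(3)[OF is_ideal_0[OF J]] .
  next
    case (step c x y)
    then obtain g where "x = \<pi> g" using B(4) by blast
    then show ?case using step by (simp add: \<pi>(1,2) idem)
  qed
  have "finite_colength J B"
  proof
    show "f = 0" if "f \<in> J" "f \<in> pv.span B" for f using \<pi>(3)[OF that(1)] fixed[OF that(2)] by simp
    show "\<exists>w\<in>pv.span B. f - w \<in> J" for f
      using bspec[OF B(5), of "coset J f"] rep[of f] \<pi>(4)[of f] by (auto simp: quotient_space_simps[OF J])
  qed fact+
  then show thesis using that B(2) fd(2) by simp
qed

lemma finite_colength_hilbert_points:
  assumes "finite_colength J B"
  shows "J \<in> hilbert_points (card B)"
proof -
  interpret fc: finite_colength J B by fact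
  note J = fc.J
  have nf0: "fc.nf f = 0" if "f \<in> J" for f
    by (rule fc.nf_unique[OF pv.span_zero]) (simp add: that)
  interpret coordinate_map "quotient_space J" "\<lambda>C. fc.nf (rep C)"
    by (rule coordinate_map_quotient[OF J fc.nf_add fc.nf_scale nf0])
  note rep = coordinate_map_quotient(2)[OF J fc.nf_add fc.nf_scale nf0]
  have inj: "v = \<zero>\<^bsub>quotient_space J\<^esub>" if v: "v \<in> carrier (quotient_space J)" "fc.nf (rep v) = 0" for v
  proof -
    obtain f where f: "v = coset J f" using v(1) by (auto simp: quotient_space_simps[OF J])
    then have "f \<in> J" using v(2) rep fc.nf(2)[of f] by simp
    then show ?thesis unfolding f quotient_space_simps[OF J] coset_eq_iff[OF J] by simp
  qed
  have fd: "fin_dim" "dim \<le> card B"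
    by (rule fin_dim_dim_le[OF inj fc.finB fc.nf(1)], assumption+)+
  have nfB: "fc.nf b = b" if "b \<in> B" for b
    by (rule fc.nf_unique[OF pv.span_base[OF that]]) (simp add: is_ideal_0[OF J])
  have img: "(\<lambda>C. fc.nf (rep C)) ` coset J ` B = B"
    by (simp add: image_image rep nfB)
  have injB: "inj_on (coset J) B"
    by (rule inj_on_inverseI[of _ "\<lambda>C. fc.nf (rep C)"]) (simp add: rep nfB)
  have "lin_indpt (coset J ` B)"
  proof (rule lin_indpt_if_independent)
    show "coset J ` B \<subseteq> carrier (quotient_space J)" unfolding quotient_space_simps[OF J] by blast
    show "inj_on (\<lambda>C. fc.nf (rep C)) (coset J ` B)"
      by (rule inj_on_inverseI[of _ "coset J"]) (elim imageE, simp add: rep nfB)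
    show "pv.independent ((\<lambda>C. fc.nf (rep C)) ` coset J ` B)" unfolding img by (rule fc.indB)
  qed
  note ind = this
  have "coset J ` B \<subseteq> carrier (quotient_space J)" unfolding quotient_space_simps[OF J] by blast
  from li_le_dim(2)[OF fd(1) this ind] have "card (coset J ` B) \<le> dim" .
  then have "dim = card B" using fd(2) by (simp add: card_image[OF injB])
  then show ?thesis using fd(1) J by (simp add: hilbert_points_def is_ideal_iff)
qed

section \<open>Coordinates on tangent spaces\<close>

context
  fixes J assumes J: "is_ideal J"
begin

lemma tangent_space_carrier:
  "\<psi> \<in> carrier (tangent_space J) \<longleftrightarrow>
    (\<forall>f\<in>J. \<psi> f \<in> range (coset J)) \<and>
    (\<forall>f\<in>J. \<forall>g\<in>J. \<psi> (f + g) = \<psi> f \<oplus>\<^bsub>polyring Quot J\<^esub> \<psi> g) \<and>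
    (\<forall>r. \<forall>f\<in>J. \<psi> (r * f) = coset J r \<otimes>\<^bsub>polyring Quot J\<^esub> \<psi> f) \<and> \<psi> \<in> extensional J"
  by (auto simp: tangent_space_def restrict_scalars_def hom_module_def LinearCombinations.module_hom_def
    ideal_module_def quotient_module_simps quotient_simps[OF J] r_coset_eq[OF J])

lemma tangent_space_simps:
  "\<zero>\<^bsub>tangent_space J\<^esub> = (\<lambda>f\<in>J. coset J 0)"
  "\<psi> \<oplus>\<^bsub>tangent_space J\<^esub> \<psi>' = (\<lambda>f\<in>J. \<psi> f \<oplus>\<^bsub>polyring Quot J\<^esub> \<psi>' f)"
  "c \<odot>\<^bsub>tangent_space J\<^esub> \<psi> = (\<lambda>f\<in>J. coset J (const c) \<otimes>\<^bsub>polyring Quot J\<^esub> \<psi> f)"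
  by (simp_all add: tangent_space_def restrict_scalars_def hom_module_def
    ideal_module_def quotient_module_simps quotient_simps[OF J] r_coset_eq[OF J])

lemma tangent_vector_rep:
  assumes "\<psi> \<in> carrier (tangent_space J)" "f \<in> J"
  shows "\<psi> f = coset J (rep (\<psi> f))"
proof -
  obtain g where g: "\<psi> f = coset J g" using assms unfolding tangent_space_carrier by blast
  show ?thesis unfolding g coset_eq_iff[OF J]
    using is_ideal_uminus[OF J rep_coset[OF J, of g]] by simp
qed

end

context finite_colength
begin

lemma nf_0: "f \<in> J \<Longrightarrow> nf f = 0"
  by (rule nf_unique[OF pv.span_zero]) simp

lemma nf_rep: "nf (rep (coset J f)) = nf f"
  using nf_add[of "rep (coset J f) - f" f] nf_0[OF rep_coset[OF J, of f]] by simp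

lemma nf_rep_simps:
  assumes "\<psi> \<in> carrier (tangent_space J)" "\<psi>' \<in> carrier (tangent_space J)" "f \<in> J"
  shows "nf (rep ((\<psi> \<oplus>\<^bsub>tangent_space J\<^esub> \<psi>') f)) = nf (rep (\<psi> f)) + nf (rep (\<psi>' f))"
    and "nf (rep ((c \<odot>\<^bsub>tangent_space J\<^esub> \<psi>) f)) = cscale c (nf (rep (\<psi> f)))"
proof -
  obtain g g' where g: "\<psi> f = coset J g" "\<psi>' f = coset J g'"
    using tangent_vector_rep[OF J] assms by blast
  show "nf (rep ((\<psi> \<oplus>\<^bsub>tangent_space J\<^esub> \<psi>') f)) = nf (rep (\<psi> f)) + nf (rep (\<psi>' f))"
    using assms(3) by (simp add: tangent_space_simps[OF J] g quotient_simps[OF J] nf_rep nf_add)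
  show "nf (rep ((c \<odot>\<^bsub>tangent_space J\<^esub> \<psi>) f)) = cscale c (nf (rep (\<psi> f)))"
    using assms(3) by (simp add: tangent_space_simps[OF J] g quotient_simps[OF J] nf_rep nf_scale[unfolded cscale_def] cscale_def)
qed

text \<open>Normal forms of representatives turn a coset-valued homomorphism into a member of
  \<open>homs 1\<close>. The \<open>t\<close> functionals then become coordinates, and a tangent
  vector with zero coordinates takes only the zero coset as value.\<close>

lemma tangent_dim_le:
  assumes "quot_dim_le (homs 1) (zero_homs 1) t"
  shows "vectorspace.fin_dim complex_field (tangent_space J)" "tangent_dim J \<le> t"
proof -
  obtain F where F: "\<forall>i<t. map_functional (F i)" "\<forall>\<phi>\<in>homs 1. (\<forall>i<t. F i \<phi> = 0) \<longrightarrow> \<phi> \<in> zero_homs 1"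
    using assms unfolding quot_dim_le_def by blast
  define \<Phi> where "\<Phi> \<psi> = (\<lambda>f. if f \<in> J then nf (rep (\<psi> f)) else 0)" for \<psi> :: "poly3 \<Rightarrow> poly3 set"
  text \<open>The powers of \<open>x\<close> only serve as independent vectors indexed by natural numbers.\<close>
  define m where "m i = monomial (Poly_Mapping.single Vx (i::nat))" for i
  define T where "T \<psi> = (\<Sum>i<t. cscale (F i (\<Phi> \<psi>)) (m i))" for \<psi>
  interpret vectorspace complex_field "tangent_space J"
    by (rule vectorspace_tangent_space) (use J is_ideal_iff in blast)
  interpret coordinate_map "tangent_space J" T
  proof
    fix \<psi> \<psi>' assume \<psi>: "\<psi> \<in> carrier (tangent_space J)" "\<psi>' \<in> carrier (tangent_space J)"
    have "\<Phi> (\<psi> \<oplus>\<^bsub>tangent_space J\<^esub> \<psi>') = (\<lambda>f. \<Phi> \<psi> f + \<Phi> \<psi>' f)"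
      by (rule ext) (simp add: \<Phi>_def nf_rep_simps[OF \<psi>])
    then have "F i (\<Phi> (\<psi> \<oplus>\<^bsub>tangent_space J\<^esub> \<psi>')) = F i (\<Phi> \<psi>) + F i (\<Phi> \<psi>')" if "i < t" for i
      using F(1) that by (simp add: map_functional_def)
    then show "T (\<psi> \<oplus>\<^bsub>tangent_space J\<^esub> \<psi>') = T \<psi> + T \<psi>'"
      by (simp add: T_def pv.scale_left_distrib sum.distrib)
  next
    fix \<psi> c assume \<psi>: "\<psi> \<in> carrier (tangent_space J)"
    have "\<Phi> (c \<odot>\<^bsub>tangent_space J\<^esub> \<psi>) = (\<lambda>f. cscale c (\<Phi> \<psi> f))"
      by (rule ext) (simp add: \<Phi>_def nf_rep_simps[OF \<psi> \<psi>])
    then have "F i (\<Phi> (c \<odot>\<^bsub>tangent_space J\<^esub> \<psi>)) = c * F i (\<Phi> \<psi>)" if "i < t" for i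
      using F(1) that by (simp add: map_functional_def)
    then show "T (c \<odot>\<^bsub>tangent_space J\<^esub> \<psi>) = cscale c (T \<psi>)"
      by (simp add: T_def pv.scale_sum_right)
  qed
  have inj: "\<psi> = \<zero>\<^bsub>tangent_space J\<^esub>" if \<psi>: "\<psi> \<in> carrier (tangent_space J)" "T \<psi> = 0" for \<psi>
  proof -
    have "F i (\<Phi> \<psi>) = 0" if i: "i < t" for i
    proof -
      have "lookup (T \<psi>) (Poly_Mapping.single Vx i) = (\<Sum>j<t. if j = i then F i (\<Phi> \<psi>) else 0)"
        unfolding T_def lookup_sum
      proof (rule sum.cong)
        fix j
        have "(Poly_Mapping.single Vx j = Poly_Mapping.single Vx i) = (j = i)"
          by (metis lookup_single_eq)
        then show "lookup (cscale (F j (\<Phi> \<psi>)) (m j)) (Poly_Mapping.single Vx i) = (if j = i then F i (\<Phi> \<psi>) else 0)"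
          by (simp add: lookup_cscale m_def monomial_def lookup_single when_def)
      qed simp
      then show ?thesis using \<psi>(2) i by simp
    qed
    moreover have "\<Phi> \<psi> \<in> homs 1"
      unfolding homs_def
    proof (intro CollectI ballI conjI allI)
      fix f assume "f \<in> K 1"
      then have f: "f \<in> J" by (simp add: K_iff)
      obtain p where p: "\<psi> f = coset J p" using tangent_vector_rep[OF J \<psi>(1) f] by blast
      show "\<Phi> \<psi> f \<in> V 1" using V_self[of 1 "\<Phi> \<psi> f"] by simp
      show "\<Phi> \<psi> (f + g) - \<Phi> \<psi> f - \<Phi> \<psi> g \<in> J" if "g \<in> K 1" for g
      proof -
        have g: "g \<in> J" using that by (simp add: K_iff)
        obtain q where q: "\<psi> g = coset J q" using tangent_vector_rep[OF J \<psi>(1) g] by blast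
        have "\<psi> (f + g) = coset J (p + q)"
          using \<psi>(1) f g unfolding tangent_space_carrier[OF J] by (simp add: p q quotient_simps[OF J])
        then show ?thesis
          using f g is_ideal_add[OF J f g] is_ideal_0[OF J] by (simp add: \<Phi>_def p q nf_rep nf_add)
      qed
      show "\<Phi> \<psi> (r * f) - r * \<Phi> \<psi> f \<in> J" for r
      proof -
        have rf: "\<psi> (r * f) = coset J (r * p)"
          using \<psi>(1) f unfolding tangent_space_carrier[OF J] by (simp add: p quotient_simps[OF J])
        have "r * (p - nf p) - (r * p - nf (r * p)) \<in> J"
          by (intro is_ideal_diff[OF J] is_ideal_mult[OF J] nf)
        then show ?thesis
          using f is_ideal_mult[OF J f, of r] by (simp add: \<Phi>_def rf p nf_rep right_diff_distrib)
      qed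
    qed
    ultimately have H: "\<Phi> \<psi> \<in> zero_homs 1" using F(2) by blast
    show ?thesis
      unfolding tangent_space_simps[OF J]
    proof (rule extensionalityI[of _ J])
      show "\<psi> \<in> extensional J" using \<psi>(1) unfolding tangent_space_carrier[OF J] by blast
      fix f assume f: "f \<in> J"
      then have "nf (rep (\<psi> f)) \<in> J" using H by (auto simp: zero_homs_def K_iff \<Phi>_def)
      then have "rep (\<psi> f) \<in> J" using nf_mem[OF subspace_ideal[OF J] subset_refl] by blast
      then have "\<psi> f = coset J 0"
        using tangent_vector_rep[OF J \<psi>(1) f] coset_eq_iff[OF J, of "rep (\<psi> f)" 0] by simp
      then show "\<psi> f = (\<lambda>f\<in>J. coset J 0) f" using f by simp
    qed simp
  qed
  have T_span: "T \<psi> \<in> pv.span (m ` {..<t})" for \<psi>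
    unfolding T_def by (intro pv.span_sum pv.span_scale) (auto intro: pv.span_base)
  have "finite (m ` {..<t})" by simp
  from fin_dim_dim_le[OF inj this T_span]
  have fd: "fin_dim" and d: "dim \<le> card (m ` {..<t})" by auto
  show "vectorspace.fin_dim complex_field (tangent_space J)" by (rule fd)
  have "card (m ` {..<t}) \<le> t" using card_image_le[of "{..<t}" m] by simp
  then show "tangent_dim J \<le> t" using d by (simp add: tangent_dim_def)
qed

lemma tangent_dim_bound:
  assumes "J \<subseteq> vanishing a b c n" "\<And>a b c. \<not> J \<subseteq> vanishing a b c (Suc n)"
  shows "vectorspace.fin_dim complex_field (tangent_space J)"
    and "tangent_dim J + 2 * ((n + 2) choose 4) \<le> (2 * n + 1) * card B"
proof -
  have K1: "K 1 = J" by (simp add: K_def)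
  have V1: "V 1 = UNIV" using V_self[of 1] by auto
  obtain t where "quot_dim_le (homs 1) (zero_homs 1) t" "t + 2 * ((n + 2) choose 4) \<le> (2 * n + 1) * card B"
    using tangent_bound[of 1 a b c n] assms unfolding K1 V1 qdim_UNIV by blast
  then show "vectorspace.fin_dim complex_field (tangent_space J)"
    and "tangent_dim J + 2 * ((n + 2) choose 4) \<le> (2 * n + 1) * card B"
    using tangent_dim_le[of t] by auto
qed

end

section \<open>Powers of the maximal ideal\<close>

definition max_power :: "nat \<Rightarrow> poly3 set"
  where "max_power k = {f. \<forall>e\<in>keys f. k \<le> deg e}"

lemma ideal_max_power: "is_ideal (max_power k)"
  unfolding is_ideal_def
proof (intro conjI ballI allI)
  show "0 \<in> max_power k" by (simp add: max_power_def)
  fix f assume f: "f \<in> max_power k"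
  show "f + g \<in> max_power k" if "g \<in> max_power k" for g
    using f that keys_add[of f g] by (auto simp: max_power_def)
  show "g * f \<in> max_power k" for g
    using f keys_mult[of g f] by (force simp: max_power_def deg_add)
qed

lemma monomial_mem_max_power: "monomial e \<in> max_power k \<longleftrightarrow> k \<le> deg e"
  by (simp add: max_power_def monomial_def)

lemma monomial_expansion: "f = (\<Sum>e\<in>keys f. const (lookup f e) * monomial e)"
  by (subst poly_mapping_sum_single[symmetric]) (simp add: const_def monomial_def mult_single)

lemma is_ideal_sum:
  assumes "is_ideal A" "\<And>i. i \<in> S \<Longrightarrow> f i \<in> A"
  shows "sum f S \<in> A"
  using assms(2) by (induction S rule: infinite_finite_induct)
    (auto intro: is_ideal_0[OF assms(1)] is_ideal_add[OF assms(1)])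

lemma monomial_factor:
  assumes "0 < deg e"
  obtains v d where "monomial e = monomial d * var v" "deg e = Suc (deg d)"
proof -
  obtain v where v: "0 < lookup e v"
    using assms unfolding deg_def by (metis add_is_0 gr0I)
  define d where "d = e - Poly_Mapping.single v 1"
  have e: "e = d + Poly_Mapping.single v 1"
  proof (rule poly_mapping_eqI)
    fix w show "lookup e w = lookup (d + Poly_Mapping.single v 1) w"
      using v by (cases "w = v") (simp_all add: d_def lookup_add lookup_minus lookup_single)
  qed
  have "monomial e = monomial d * var v" by (simp add: monomial_def var_def mult_single e)
  moreover have "deg e = Suc (deg d)"
    unfolding e deg_add by (cases v) (simp_all add: deg_def lookup_single)
  ultimately show thesis by (rule that)
qed

lemma var_mem_max_power: "var v \<in> max_power 1"
  unfolding var_def monomial_mem_max_power by (cases v) (simp_all add: deg_def lookup_single)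

lemma genideal_eqI:
  assumes "is_ideal A" "S \<subseteq> A" "\<And>A'. is_ideal A' \<Longrightarrow> S \<subseteq> A' \<Longrightarrow> A \<subseteq> A'"
  shows "Idl\<^bsub>polyring\<^esub> S = A"
  unfolding genideal_def is_ideal_iff using assms by auto

lemma max_ideal_eq: "max_ideal = max_power 1"
  unfolding max_ideal_def
proof (rule genideal_eqI[OF ideal_max_power])
  show "{var Vx, var Vy, var Vz} \<subseteq> max_power 1" using var_mem_max_power by auto
  fix A assume A: "is_ideal A" "{var Vx, var Vy, var Vz} \<subseteq> A"
  have v: "var v \<in> A" for v using A(2) by (cases v) auto
  show "max_power 1 \<subseteq> A"
  proof
    fix f assume f: "f \<in> max_power 1"
    have "monomial e \<in> A" if "e \<in> keys f" for e
    proof -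
      have "0 < deg e" using f that by (auto simp: max_power_def)
      then obtain v d where "monomial e = monomial d * var v" "deg e = Suc (deg d)" by (rule monomial_factor)
      then show ?thesis using is_ideal_mult[OF A(1) v] by simp
    qed
    then show "f \<in> A"
      by (subst monomial_expansion) (intro is_ideal_sum[OF A(1)] is_ideal_mult[OF A(1)])
  qed
qed

lemma max_ideal_power: "max_ideal [^]\<^bsub>ideals_set polyring\<^esub> k = max_power k"
proof (induction k)
  case 0
  then show ?case by (simp add: nat_pow_def ideals_set_def max_power_def)
next
  case (Suc k)
  have "ideal_prod polyring (max_power k) (max_power 1) = max_power (Suc k)"
  proof (intro equalityI subsetI)
    fix f assume "f \<in> ideal_prod polyring (max_power k) (max_power 1)"
    then show "f \<in> max_power (Suc k)"
    proof (induction rule: ideal_prod.induct)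
      case (prod f g)
      have "Suc k \<le> deg e" if e: "e \<in> keys (f * g)" for e
      proof -
        obtain a b where "e = a + b" "a \<in> keys f" "b \<in> keys g" using e keys_mult[of f g] by blast
        then show ?thesis using prod by (fastforce simp: max_power_def deg_add)
      qed
      then show ?case by (simp add: max_power_def)
    next
      case (sum f g)
      then show ?case using is_ideal_add[OF ideal_max_power] by simp
    qed
  next
    fix f assume f: "f \<in> max_power (Suc k)"
    have m: "c * monomial e \<in> ideal_prod polyring (max_power k) (max_power 1)" if e: "e \<in> keys f" for c e
    proof -
      have "0 < deg e" "Suc k \<le> deg e" using f e by (auto simp: max_power_def)
      from this(1) obtain v d where vd: "monomial e = monomial d * var v" "deg e = Suc (deg d)"
        by (rule monomial_factor)
      have "c * monomial d \<in> max_power k"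
        using vd \<open>Suc k \<le> deg e\<close> by (intro is_ideal_mult[OF ideal_max_power]) (simp add: monomial_mem_max_power)
      from ideal_prod.prod[OF this var_mem_max_power[of v], of polyring] show ?thesis
        by (simp add: vd(1) mult.assoc)
    qed
    have "(\<Sum>e\<in>S. const (lookup f e) * monomial e) \<in> ideal_prod polyring (max_power k) (max_power 1)"
      if "finite S" "S \<subseteq> keys f" for S
      using that
    proof (induction S)
      case empty
      have "0 \<in> max_power k" "0 \<in> max_power 1" using is_ideal_0[OF ideal_max_power] by auto
      from ideal_prod.prod[OF this, of polyring] show ?case by simp
    next
      case (insert e S)
      then show ?case using ideal_prod.sum[OF m, of e _ "const (lookup f e)"] by simp
    qed
    from this[of "keys f"] show "f \<in> ideal_prod polyring (max_power k) (max_power 1)"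
      using monomial_expansion[of f] by simp
  qed
  then show ?case using Suc by (simp add: nat_pow_def ideals_set_def max_ideal_eq)
qed

lemma finite_colength_max_power: "finite_colength (max_power k) (monomial ` {e. deg e < k})"
proof
  show "is_ideal (max_power k)" by (rule ideal_max_power)
  show "finite (monomial ` {e. deg e < k})" using card_deg_less(1) by simp
  show "pv.independent (monomial ` {e. deg e < k})" by (rule independent_monomials)
  show "f = 0" if f: "f \<in> max_power k" "f \<in> pv.span (monomial ` {e. deg e < k})" for f
  proof -
    have "\<forall>e\<in>keys f. deg e < k"
      using f(2)
    proof (induction rule: pv.span_induct_alt)
      case (step c x y)
      then obtain d where d: "x = monomial d" "deg d < k" by auto
      have "keys (cscale c x) \<subseteq> {d}"
        by (auto simp: d in_keys_iff lookup_cscale monomial_def lookup_single when_def split: if_splits)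
      then show ?case using keys_add[of "cscale c x" y] step d by auto
    qed simp
    then have "keys f = {}" using f(1) by (fastforce simp: max_power_def)
    then show ?thesis by simp
  qed
  show "\<exists>w\<in>pv.span (monomial ` {e. deg e < k}). f - w \<in> max_power k" for f
  proof
    let ?w = "\<Sum>e\<in>{e\<in>keys f. deg e < k}. cscale (lookup f e) (monomial e)"
    show "?w \<in> pv.span (monomial ` {e. deg e < k})"
      by (intro pv.span_sum pv.span_scale) (auto intro: pv.span_base)
    have "f = (\<Sum>e\<in>keys f. cscale (lookup f e) (monomial e))"
      using monomial_expansion[of f] by (simp only: cscale_def)
    also have "\<dots> = (\<Sum>e\<in>keys f - {e\<in>keys f. deg e < k}. cscale (lookup f e) (monomial e)) + ?w"
      by (rule sum.subset_diff) auto
    finally have "f - ?w = (\<Sum>e\<in>keys f - {e\<in>keys f. deg e < k}. cscale (lookup f e) (monomial e))"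
      by (rule iffD2[OF diff_eq_eq])
    moreover have "(\<Sum>e\<in>keys f - {e\<in>keys f. deg e < k}. cscale (lookup f e) (monomial e)) \<in> max_power k"
      unfolding cscale_def
      by (intro is_ideal_sum[OF ideal_max_power] is_ideal_mult[OF ideal_max_power]) (auto simp: monomial_mem_max_power)
    ultimately show "f - ?w \<in> max_power k" by (simp only:)
  qed
qed

lemma card_monomial_image: "card (monomial ` S) = card S"
  by (rule card_image) (simp add: inj_on_def monomial_eq_iff)

lemma max_power_vanishing: "max_power k \<subseteq> vanishing 0 0 0 k"
proof
  fix f assume f: "f \<in> max_power k"
  have mon: "monomial e \<in> vanishing 0 0 0 k" if "k \<le> deg e" for e
  proof -
    have "coeff (line 0 0 0 t r (monomial e)) j = 0" if "j < k" for t r j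
    proof -
      have pow: "[:0, t:] ^ n = Polynomial.smult (t ^ n) ([:0, 1:] ^ n)" for t :: complex and n
        using smult_power[of t "[:0, 1:]" n] by simp
      have "line 0 0 0 t r (monomial e) = 
          Polynomial.smult (t ^ lookup e Vy * r ^ lookup e Vz) ([:0, 1:] ^ deg e)"
        unfolding line_def monomial_def ev_single[OF scalar_hom_poly] ev_mon_def
        unfolding pow[of t] pow[of r] by (simp add: deg_def power_add one_pCons[symmetric] ac_simps)
      then show ?thesis using that \<open>k \<le> deg e\<close> by (simp add: coeff_X_power)
    qed
    then show ?thesis by (simp add: vanishing_def)
  qed
  show "f \<in> vanishing 0 0 0 k"
    by (subst monomial_expansion)
      (intro is_ideal_sum[OF ideal_vanishing] is_ideal_mult[OF ideal_vanishing] mon, use f in \<open>simp add: max_power_def\<close>)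
qed

text \<open>The terms of degree below \<open>k\<close> form a remainder that again vanishes to order
  \<open>k\<close> at the origin, hence is zero.\<close>

lemma vanishing_max_power: "vanishing 0 0 0 k \<subseteq> max_power k"
proof
  fix f assume f: "f \<in> vanishing 0 0 0 k"
  obtain w where w: "w \<in> pv.span (monomial ` {e. deg e < k})" "f - w \<in> max_power k"
    using finite_colength.cover[OF finite_colength_max_power] by blast
  have low: "\<forall>e\<in>keys w. deg e < k"
    using w(1)
  proof (induction rule: pv.span_induct_alt)
    case (step c x y)
    then obtain d where d: "x = monomial d" "deg d < k" by auto
    have "keys (cscale c x) \<subseteq> {d}"
      by (auto simp: d in_keys_iff lookup_cscale monomial_def lookup_single when_def split: if_splits)
    then show ?case using keys_add[of "cscale c x" y] step d by auto
  qed simp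
  have "f - w \<in> vanishing 0 0 0 k" using w(2) max_power_vanishing by (rule rev_subsetD)
  then have "f - (f - w) \<in> vanishing 0 0 0 k" by (rule is_ideal_diff[OF ideal_vanishing f])
  then have "w = 0" using low by (intro vanishing_low_degree[of w 0 0 0 k]) auto
  then show "f \<in> max_power k" using w(2) by simp
qed

lemma max_power_mult: "f \<in> max_power i \<Longrightarrow> g \<in> max_power j \<Longrightarrow> f * g \<in> max_power (i + j)"
proof -
  assume fg: "f \<in> max_power i" "g \<in> max_power j"
  have "i + j \<le> deg e" if e: "e \<in> keys (f * g)" for e
  proof -
    obtain a b where ab: "e = a + b" "a \<in> keys f" "b \<in> keys g" using e keys_mult[of f g] by blast
    then have "i \<le> deg a" "j \<le> deg b" using fg by (auto simp: max_power_def)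
    then show ?thesis by (simp add: ab(1) deg_add)
  qed
  then show ?thesis by (simp add: max_power_def)
qed

lemma deg_eq_0_iff: "deg e = 0 \<longleftrightarrow> e = 0"
proof
  assume e: "deg e = 0"
  show "e = 0"
  proof (rule poly_mapping_eqI)
    fix v show "lookup e v = lookup 0 v" using e by (cases v) (simp_all add: deg_def)
  qed
qed (simp add: deg_def)

lemma diff_const_mem_max_power: "r - const (lookup r 0) \<in> max_power 1"
  unfolding max_power_def
proof (intro CollectI ballI)
  fix e assume "e \<in> keys (r - const (lookup r 0))"
  then have "e \<noteq> 0" by (auto simp: in_keys_iff lookup_minus const_def)
  then show "1 \<le> deg e" using deg_eq_0_iff[of e] by linarith
qed

text \<open>The non-constant part of \<open>r\<close> pushes \<open>f\<close> into degrees above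
  \<open>k\<close>, so only the constant term contributes in degree \<open>k\<close>.\<close>

lemma lookup_mult_lowest:
  assumes "f \<in> max_power k" "deg e = k"
  shows "lookup (r * f) e = lookup r 0 * lookup f e"
proof -
  have "(r - const (lookup r 0)) * f \<in> max_power (1 + k)"
    by (rule max_power_mult[OF diff_const_mem_max_power assms(1)])
  then have "e \<notin> keys ((r - const (lookup r 0)) * f)" using assms(2) by (auto simp: max_power_def)
  then have "lookup (r * f - cscale (lookup r 0) f) e = 0"
    by (simp add: in_keys_iff left_diff_distrib cscale_def)
  then show ?thesis by (simp add: lookup_minus lookup_cscale)
qed

text \<open>Every choice of a monomial of degree \<open>k\<close> and one of degree
  \<open>k - 1\<close> gives a tangent vector, and reading off coefficients shows these to be
  independent. The finiteness assumption makes \<open>dim\<close> meaningful here; it is supplied by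
  the upper bound.\<close>

lemma tangent_dim_max_power_ge:
  assumes k: "k \<ge> 1" and fd: "vectorspace.fin_dim complex_field (tangent_space (max_power k))"
  shows "((k + 2) choose 2) * ((k + 1) choose 2) \<le> tangent_dim (max_power k)"
proof -
  interpret fc: finite_colength "max_power k" "monomial ` {e. deg e < k}" by (rule finite_colength_max_power)
  note J = ideal_max_power[of k]
  define P where "P = {e. deg e = k} \<times> {d. deg d = k - 1}"
  have P: "finite P" "card P = ((k + 2) choose 2) * ((k + 1) choose 2)"
    using card_deg_eq[of k] card_deg_eq[of "k - 1"] k by (simp_all add: P_def card_cartesian_product)
  \<comment> \<open>A numbering of the pairs lets distinct powers of \<open>x\<close> serve as
    independent labels.\<close>
  obtain g :: "(indet \<Rightarrow>\<^sub>0 nat) \<times> (indet \<Rightarrow>\<^sub>0 nat) \<Rightarrow> nat" where g: "inj_on g P"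
    using finite_imp_inj_to_nat_seg[OF P(1)] by blast
  define m where "m p = monomial (Poly_Mapping.single Vx (g p))" for p
  have "inj (Poly_Mapping.single Vx :: nat \<Rightarrow> _)" by (metis injI lookup_single_eq)
  then have m: "inj_on m P" using g by (auto simp: inj_on_def m_def monomial_eq_iff)
  define T where "T \<psi> = (\<Sum>p\<in>P. cscale (lookup (fc.nf (rep (\<psi> (monomial (fst p))))) (snd p)) (m p))"
    for \<psi> :: "poly3 \<Rightarrow> poly3 set"
  have e_mem: "monomial (fst p) \<in> max_power k" if "p \<in> P" for p
    using that by (auto simp: P_def monomial_mem_max_power)
  interpret vectorspace complex_field "tangent_space (max_power k)"
    by (rule vectorspace_tangent_space) (use J is_ideal_iff in blast)
  interpret coordinate_map "tangent_space (max_power k)" T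
  proof
    fix \<psi> \<psi>' assume \<psi>: "\<psi> \<in> carrier (tangent_space (max_power k))" "\<psi>' \<in> carrier (tangent_space (max_power k))"
    show "T (\<psi> \<oplus>\<^bsub>tangent_space (max_power k)\<^esub> \<psi>') = T \<psi> + T \<psi>'"
      unfolding T_def sum.distrib[symmetric]
      by (rule sum.cong) (simp_all add: fc.nf_rep_simps[OF \<psi> e_mem] lookup_add pv.scale_left_distrib)
  next
    fix \<psi> c assume \<psi>: "\<psi> \<in> carrier (tangent_space (max_power k))"
    show "T (c \<odot>\<^bsub>tangent_space (max_power k)\<^esub> \<psi>) = cscale c (T \<psi>)"
      unfolding T_def pv.scale_sum_right
      by (rule sum.cong) (simp_all add: fc.nf_rep_simps[OF \<psi> \<psi> e_mem] lookup_cscale)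
  qed
  \<comment> \<open>One monomial of degree \<open>k\<close> is sent to one of degree
    \<open>k - 1\<close>, all other monomials to zero. This is linear over the polynomial ring
    because every variable moves the value into \<open>max_power k\<close>.\<close>
  define \<Psi> where "\<Psi> p = (\<lambda>f\<in>max_power k. coset (max_power k) (cscale (lookup f (fst p)) (monomial (snd p))))" for p
  have carrier: "\<Psi> p \<in> carrier (tangent_space (max_power k))" if p: "p \<in> P" for p
    unfolding tangent_space_carrier[OF J]
  proof (intro conjI ballI allI)
    fix f assume f: "f \<in> max_power k"
    show "\<Psi> p f \<in> range (coset (max_power k))" using f by (simp add: \<Psi>_def)
    show "\<Psi> p (f + h) = \<Psi> p f \<oplus>\<^bsub>polyring Quot max_power k\<^esub> \<Psi> p h" if h: "h \<in> max_power k" for h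
      using f h is_ideal_add[OF J f h]
      by (simp add: \<Psi>_def quotient_simps[OF J] lookup_add pv.scale_left_distrib)
    show "\<Psi> p (r * f) = coset (max_power k) r \<otimes>\<^bsub>polyring Quot max_power k\<^esub> \<Psi> p f" for r
    proof -
      have "lookup (r * f) (fst p) = lookup r 0 * lookup f (fst p)"
        by (rule lookup_mult_lowest[OF f]) (use p in \<open>auto simp: P_def\<close>)
      then have "cscale (lookup (r * f) (fst p)) (monomial (snd p)) - r * cscale (lookup f (fst p)) (monomial (snd p)) = 
          - (const (lookup f (fst p)) * ((r - const (lookup r 0)) * monomial (snd p)))"
        by (simp add: cscale_def const_mult algebra_simps)
      also have "(r - const (lookup r 0)) * monomial (snd p) \<in> max_power (1 + (k - 1))"
        by (rule max_power_mult[OF diff_const_mem_max_power]) (use p in \<open>auto simp: P_def monomial_mem_max_power\<close>)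
      then have "- (const (lookup f (fst p)) * ((r - const (lookup r 0)) * monomial (snd p))) \<in> max_power k"
        using is_ideal_uminus[OF J is_ideal_mult[OF J]] k by simp
      finally have "coset (max_power k) (cscale (lookup (r * f) (fst p)) (monomial (snd p))) = 
          coset (max_power k) (r * cscale (lookup f (fst p)) (monomial (snd p)))"
        unfolding coset_eq_iff[OF J] .
      then show ?thesis using f is_ideal_mult[OF J f, of r] by (simp add: \<Psi>_def quotient_simps[OF J])
    qed
  qed (simp add: \<Psi>_def)
  have T_\<Psi>: "T (\<Psi> p) = m p" if p: "p \<in> P" for p
  proof -
    have nf: "fc.nf (monomial (snd p)) = monomial (snd p)"
      by (rule fc.nf_unique[OF pv.span_base]) (use p k is_ideal_0[OF J] in \<open>auto simp: P_def\<close>)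
    have "T (\<Psi> p) = (\<Sum>q\<in>P. if q = p then m p else 0)"
      unfolding T_def
    proof (rule sum.cong)
      fix q assume q: "q \<in> P"
      have "fc.nf (rep (\<Psi> p (monomial (fst q)))) = cscale (lookup (monomial (fst q)) (fst p)) (monomial (snd p))"
        using e_mem[OF q] by (simp add: \<Psi>_def fc.nf_rep fc.nf_scale nf)
      then have "lookup (fc.nf (rep (\<Psi> p (monomial (fst q))))) (snd q) = (if q = p then 1 else 0)"
        by (cases p, cases q) (auto simp: lookup_cscale monomial_def lookup_single when_def)
      then show "cscale (lookup (fc.nf (rep (\<Psi> p (monomial (fst q))))) (snd q)) (m q) = (if q = p then m p else 0)"
        by simp
    qed simp
    also have "\<dots> = m p" using p P(1) by simp
    finally show ?thesis .
  qed
  have inj: "inj_on \<Psi> P" using m T_\<Psi> by (metis (no_types, lifting) inj_on_def)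
  have img: "T ` \<Psi> ` P = m ` P" unfolding image_image by (rule image_cong[OF refl T_\<Psi>])
  have sub: "\<Psi> ` P \<subseteq> carrier (tangent_space (max_power k))" using carrier by blast
  have "inj_on T (\<Psi> ` P)" using m T_\<Psi> by (auto simp: inj_on_def)
  moreover have "pv.independent (T ` \<Psi> ` P)"
  proof -
    have "m ` P = monomial ` (\<lambda>p. Poly_Mapping.single Vx (g p)) ` P" by (simp add: m_def image_image)
    then show ?thesis unfolding img by (simp add: independent_monomials)
  qed
  ultimately have "lin_indpt (\<Psi> ` P)" by (rule lin_indpt_if_independent[OF sub])
  from li_le_dim(2)[OF fd sub this] show ?thesis
    by (simp add: card_image[OF inj] P(2) tangent_dim_def)
qed

text \<open>The criterion does not mention \<open>v\<close>, so one variable may be replaced by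
  another. It is needed for arbitrary \<open>h\<close>, as the Borel conditions quantify over
  polynomials.\<close>

lemma var_mult_mem_max_power: "var v * h \<in> max_power k \<longleftrightarrow> (\<forall>e\<in>keys h. k \<le> Suc (deg e))"
proof -
  have look: "lookup (var v * h) (Poly_Mapping.single v 1 + e) = lookup h e" for e
  proof -
    have "var v * h = (\<Sum>d\<in>keys h. Poly_Mapping.single (Poly_Mapping.single v 1 + d) (lookup h d))"
      using arg_cong[OF poly_mapping_sum_single[of h], of "\<lambda>f. var v * f"]
      by (simp add: sum_distrib_left var_def monomial_def mult_single)
    then have "lookup (var v * h) (Poly_Mapping.single v 1 + e) = (\<Sum>d\<in>keys h. if d = e then lookup h d else 0)"
      by (simp add: lookup_sum lookup_single when_def)
    then show ?thesis by (simp add: in_keys_iff)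
  qed
  have deg1: "deg (Poly_Mapping.single v 1 + e) = Suc (deg e)" for e
    unfolding deg_add by (cases v) (simp_all add: deg_def lookup_single)
  show ?thesis
  proof
    assume h: "var v * h \<in> max_power k"
    show "\<forall>e\<in>keys h. k \<le> Suc (deg e)"
    proof
      fix e assume "e \<in> keys h"
      then have "Poly_Mapping.single v 1 + e \<in> keys (var v * h)" unfolding in_keys_iff look .
      then have "k \<le> deg (Poly_Mapping.single v 1 + e)" using h by (simp add: max_power_def)
      then show "k \<le> Suc (deg e)" by (simp only: deg1)
    qed
  next
    assume h: "\<forall>e\<in>keys h. k \<le> Suc (deg e)"
    show "var v * h \<in> max_power k"
      unfolding max_power_def
    proof (intro CollectI ballI)
      fix e assume "e \<in> keys (var v * h)"
      then obtain a b where ab: "e = a + b" "a \<in> keys (var v)" "b \<in> keys h" using keys_mult[of "var v" h] by blast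
      then have "a = Poly_Mapping.single v 1" by (simp add: var_def monomial_def)
      then show "k \<le> deg e" using h ab by (simp only: deg1)
    qed
  qed
qed

lemma borel_fixed_max_power: "borel_fixed (max_power k)"
proof -
  have "Idl\<^bsub>polyring\<^esub> (monomial ` {e. k \<le> deg e}) = max_power k"
  proof (rule genideal_eqI[OF ideal_max_power])
    show "monomial ` {e. k \<le> deg e} \<subseteq> max_power k" by (auto simp: monomial_mem_max_power)
    fix A assume A: "is_ideal A" "monomial ` {e. k \<le> deg e} \<subseteq> A"
    show "max_power k \<subseteq> A"
    proof
      fix f assume f: "f \<in> max_power k"
      have "monomial e \<in> A" if "e \<in> keys f" for e using f A(2) that by (auto simp: max_power_def)
      then show "f \<in> A"
        by (subst monomial_expansion) (intro is_ideal_sum[OF A(1)] is_ideal_mult[OF A(1)])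
    qed
  qed
  then have "monomial_ideal (max_power k)" unfolding monomial_ideal_def by (intro exI[of _ "monomial ` {e. k \<le> deg e}"]) auto
  then show ?thesis
    unfolding borel_fixed_def minimal_generators_def by (auto simp: var_mult_mem_max_power)
qed

text \<open>The polynomials all of whose monomials lie in \<open>A\<close> form an ideal containing
  the monomial generators, hence all of \<open>A\<close>.\<close>

lemma monomial_ideal_keys:
  assumes "monomial_ideal A" "f \<in> A" "e \<in> keys f"
  shows "monomial e \<in> A"
proof -
  obtain S where S: "S \<subseteq> range monomial" "A = Idl\<^bsub>polyring\<^esub> S" using assms(1) by (auto simp: monomial_ideal_def)
  have A: "is_ideal A"
  proof -
    have "ring polyring" by unfold_locales
    then show ?thesis unfolding S(2) is_ideal_iff[symmetric] by (rule ring.genideal_ideal) simp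
  qed
  have SA: "S \<subseteq> A" unfolding S(2) genideal_def by auto
  define A' :: "poly3 set" where "A' = {f. \<forall>e\<in>keys f. monomial e \<in> A}"
  have "is_ideal A'"
    unfolding is_ideal_def
  proof (intro conjI ballI allI)
    show "0 \<in> A'" by (simp add: A'_def)
    fix f assume f: "f \<in> A'"
    show "f + g \<in> A'" if "g \<in> A'" for g using f that keys_add[of f g] by (auto simp: A'_def)
    show "r * f \<in> A'" for r
      unfolding A'_def
    proof (intro CollectI ballI)
      fix e assume "e \<in> keys (r * f)"
      then obtain a b where ab: "e = a + b" "b \<in> keys f" using keys_mult[of r f] by blast
      then have "monomial a * monomial b \<in> A" using f by (intro is_ideal_mult[OF A]) (simp add: A'_def)
      then show "monomial e \<in> A" by (simp add: monomial_def mult_single ab(1))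
    qed
  qed
  moreover have "S \<subseteq> A'"
  proof
    fix s assume s: "s \<in> S"
    then obtain d where d: "s = monomial d" using S(1) by auto
    then have "keys s = {d}" by (simp add: monomial_def)
    then show "s \<in> A'" using s SA d by (auto simp: A'_def)
  qed
  ultimately have "A \<subseteq> A'" unfolding S(2) genideal_def is_ideal_iff by auto
  then show ?thesis using assms(2,3) by (auto simp: A'_def)
qed

text \<open>An annihilating polynomial of a variable has a power of that variable among its terms;
  this power lies in \<open>J\<close>, so the coordinate of the zero is nilpotent.\<close>

lemma (in finite_colength) monomial_ideal_zero:
  assumes "monomial_ideal J" and zero: "\<forall>f\<in>J. pt a b c f = 0"
  shows "a = 0 \<and> b = 0 \<and> c = 0"
proof -
  have "pt a b c (var v) = 0" for v
  proof -
    obtain P where P: "P \<noteq> 0" "cpoly P (var v) \<in> J" using exists_annihilating_poly by blast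
    let ?n = "degree P"
    have look: "lookup (var v ^ i) (Poly_Mapping.single v ?n) = (if i = ?n then 1 else 0)" for i
    proof -
      have "(Poly_Mapping.single v i = Poly_Mapping.single v ?n) = (i = ?n)"
        by (metis lookup_single_eq)
      then show ?thesis by (simp add: var_power monomial_def lookup_single when_def)
    qed
    have "cpoly P (var v) = (\<Sum>i<Suc ?n. cscale (coeff P i) (var v ^ i))"
      by (rule cpoly_altdef) (auto intro: coeff_eq_0)
    then have "lookup (cpoly P (var v)) (Poly_Mapping.single v ?n) = (\<Sum>i<Suc ?n. coeff P i * (if i = ?n then 1 else 0))"
      by (simp only: lookup_sum lookup_cscale look)
    also have "\<dots> = coeff P ?n" by simp
    finally have "Poly_Mapping.single v ?n \<in> keys (cpoly P (var v))"
      using P(1) by (simp add: in_keys_iff)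
    from monomial_ideal_keys[OF assms(1) P(2) this] have "var v ^ ?n \<in> J" by (simp add: var_power)
    then have "pt a b c (var v ^ ?n) = 0" using zero by blast
    then show ?thesis by (simp add: pt_simps)
  qed
  from this[of Vx] this[of Vy] this[of Vz] show ?thesis by (simp add: pt_simps)
qed

section \<open>Comparison of the bounds\<close>

lemma choose_closed_forms:
  "2 * ((n + 2) choose 2) = (n + 2) * (n + 1)"
  "6 * ((n + 2) choose 3) = (n + 2) * (n + 1) * n"
  "24 * ((n + 3) choose 4) = (n + 3) * (n + 2) * (n + 1) * n"
proof -
  show c2: "2 * ((n + 2) choose 2) = (n + 2) * (n + 1)" for n
    by (induction n) (simp_all add: eval_nat_numeral)
  show c3: "6 * ((n + 2) choose 3) = (n + 2) * (n + 1) * n" for n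
  proof (induction n)
    case (Suc n)
    have "(Suc n + 2) choose 3 = ((n + 2) choose 3) + ((n + 2) choose 2)" by (simp add: eval_nat_numeral)
    then have "6 * ((Suc n + 2) choose 3) = 6 * ((n + 2) choose 3) + 3 * (2 * ((n + 2) choose 2))" by simp
    then show ?case unfolding Suc.IH c2 by (simp add: algebra_simps)
  qed simp
  show "24 * ((n + 3) choose 4) = (n + 3) * (n + 2) * (n + 1) * n"
  proof (induction n)
    case (Suc n)
    have "(Suc n + 3) choose 4 = ((n + 3) choose 4) + ((Suc n + 2) choose 3)" by (simp add: eval_nat_numeral)
    then have "24 * ((Suc n + 3) choose 4) = 24 * ((n + 3) choose 4) + 4 * (6 * ((Suc n + 2) choose 3))" by simp
    then show ?case unfolding Suc.IH c3 by (simp add: algebra_simps)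
  qed simp
qed

text \<open>The general upper bound at order \<open>k\<close> is thus exactly the number of monomial
  tangent vectors.\<close>

lemma tangent_dim_identity:
  assumes "k \<ge> 1"
  shows "((k + 2) choose 2) * ((k + 1) choose 2) + 2 * ((k + 2) choose 4) = (2 * k + 1) * ((k + 2) choose 3)"
proof -
  obtain n where n: "k = Suc n" using assms by (cases k) auto
  define a b c d where "a = (k + 2) choose 2" and "b = (k + 1) choose 2" and "c = (k + 2) choose 4" and "d = (k + 2) choose 3"
  note defs = this
  have k: "k + 2 = n + 3" "k + 1 = n + 2" "(n + 1) + 2 = n + 3" using n by simp_all
  have "2 * a = (n + 3) * (n + 1 + 1)"
    using choose_closed_forms(1)[of "n + 1"] unfolding defs k .
  moreover have "2 * b = (n + 2) * (n + 1)"
    using choose_closed_forms(1)[of n] unfolding defs k .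
  moreover have "24 * c = (n + 3) * (n + 2) * (n + 1) * n"
    using choose_closed_forms(3)[of n] unfolding defs k .
  moreover have "6 * d = (n + 3) * (n + 1 + 1) * (n + 1)"
    using choose_closed_forms(2)[of "n + 1"] unfolding defs k .
  ultimately have "6 * ((2 * a) * (2 * b)) + 2 * (24 * c) = 4 * ((2 * k + 1) * (6 * d))"
    unfolding n by (simp only:) (simp add: algebra_simps)
  then have "24 * (a * b + 2 * c) = 24 * ((2 * k + 1) * d)" by (simp add: algebra_simps)
  then have "a * b + 2 * c = (2 * k + 1) * d" by (rule mult_left_cancel[THEN iffD1, rotated]) simp
  then show ?thesis unfolding defs .
qed

lemma choose_3_strict_mono: "i < k \<Longrightarrow> (i + 2) choose 3 < (k + 2) choose 3"
  by (rule lift_Suc_mono_less[where f = "\<lambda>i. (i + 2) choose 3"]) (simp_all add: eval_nat_numeral)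

text \<open>Raising the order by one adds a binomial with lower index 3, which is strictly below the
  colength. The summand \<open>d\<close> on the left accumulates this strictness, and
  \<open>k\<close> stays fixed during the induction on \<open>d\<close>.\<close>

lemma choose_4_gap:
  "m + d \<le> k \<Longrightarrow> ((m + d + 2) choose 4) + d \<le> ((m + 2) choose 4) + d * ((k + 2) choose 3)"
proof (induction d)
  case (Suc d)
  have "(m + Suc d + 2) choose 4 = ((m + d + 2) choose 4) + ((m + d + 2) choose 3)"
    by (simp add: eval_nat_numeral)
  moreover have "(m + d + 2) choose 3 < (k + 2) choose 3"
    using Suc.prems by (intro choose_3_strict_mono) simp
  ultimately show ?case using Suc by simp
qed simp

theorem corollary1:
  fixes k :: nat and mk :: "poly3 set"
  assumes "k \<ge> 1"
    and "mk = max_ideal [^]\<^bsub>ideals_set polyring\<^esub> k"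
  shows "mk \<in> hilbert_points ((k + 2) choose 3) \<and>
    (\<forall>J \<in> hilbert_points ((k + 2) choose 3). tangent_dim J \<le> tangent_dim mk) \<and>
    {I \<in> hilbert_points ((k + 2) choose 3). borel_fixed I \<and> tangent_dim I = tangent_dim mk} = {mk}"
proof -
  let ?l = "(k + 2) choose 3"
  have mk: "mk = max_power k" using assms(2) max_ideal_power by simp
  have mk_point: "mk \<in> hilbert_points ?l"
    using finite_colength_hilbert_points[OF finite_colength_max_power[of k]]
    by (simp add: mk card_monomial_image card_deg_less)
  interpret fk: finite_colength "max_power k" "monomial ` {e. deg e < k}" by (rule finite_colength_max_power)
  have not_sub: "\<not> max_power k \<subseteq> vanishing a b c (Suc k)" for a b c
  proof
    assume "max_power k \<subseteq> vanishing a b c (Suc k)"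
    from fk.qdim_UNIV_ge_vanishing[OF ideal_max_power subset_refl this]
    have "(Suc k + 2) choose 3 \<le> (k + 2) choose 3"
      by (simp only: fk.qdim_UNIV card_monomial_image card_deg_less)
    then show False using choose_3_strict_mono[of k "Suc k"] by simp
  qed
  have "((k + 2) choose 2) * ((k + 1) choose 2) \<le> tangent_dim mk"
    unfolding mk by (rule tangent_dim_max_power_ge[OF assms(1) fk.tangent_dim_bound(1)[OF max_power_vanishing not_sub]])
  then have lower: "(2 * k + 1) * ?l \<le> tangent_dim mk + 2 * ((k + 2) choose 4)"
    using tangent_dim_identity[OF assms(1)] by simp
  have upper: "tangent_dim J \<le> tangent_dim mk \<and>
      (tangent_dim J = tangent_dim mk \<longrightarrow> (\<exists>B a b c. finite_colength J B \<and> card B = ?l \<and> J \<subseteq> vanishing a b c k))"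
    if J: "J \<in> hilbert_points ?l" for J
  proof -
    obtain B where B: "finite_colength J B" "card B = ?l" by (rule hilbert_points_finite_colength[OF J])
    interpret fc: finite_colength J B by (rule B)
    obtain m a b c where m: "J \<subseteq> vanishing a b c m" "\<And>a b c. \<not> J \<subseteq> vanishing a b c (Suc m)"
      using fc.exists_multiplicity by blast
    have "(m + 2) choose 3 \<le> ?l"
      using fc.qdim_UNIV_ge_vanishing[OF fc.J subset_refl m(1)] by (simp add: fc.qdim_UNIV B(2))
    then have "m \<le> k" using choose_3_strict_mono[of k m] by (cases "m \<le> k") auto
    then obtain d where d: "k = m + d" using le_Suc_ex by blast
    have "tangent_dim J + 2 * ((m + 2) choose 4) \<le> (2 * m + 1) * ?l"
      using fc.tangent_dim_bound(2)[OF m] B(2) by simp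
    moreover have "((k + 2) choose 4) + d \<le> ((m + 2) choose 4) + d * ?l"
      using choose_4_gap[of m d k] d by simp
    moreover have "(2 * k + 1) * ?l = (2 * m + 1) * ?l + 2 * (d * ?l)"
      unfolding d by (simp add: algebra_simps)
    \<comment> \<open>A positive deficit \<open>d\<close> makes the inequality strict, so equality
      forces order \<open>k\<close>.\<close>
    ultimately have "tangent_dim J + 2 * d \<le> tangent_dim mk" using lower by linarith
    moreover have "J \<subseteq> vanishing a b c k" if "d = 0" using m(1) that d by simp
    ultimately show ?thesis using B by (cases "d = 0") auto
  qed
  have "I = mk" if I: "I \<in> hilbert_points ?l" "borel_fixed I" "tangent_dim I = tangent_dim mk" for I
  proof -
    obtain B a b c where B: "finite_colength I B" "card B = ?l" and sub: "I \<subseteq> vanishing a b c k"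
      using upper[OF I(1)] I(3) by blast
    interpret fc: finite_colength I B by (rule B)
    have "monomial_ideal I" using I(2) by (simp add: borel_fixed_def)
    moreover have "\<forall>f\<in>I. pt a b c f = 0" using sub assms(1) vanishing_pt[of _ a b c k] by auto
    ultimately have "a = 0 \<and> b = 0 \<and> c = 0" by (rule fc.monomial_ideal_zero)
    then have sub': "I \<subseteq> max_power k" using sub vanishing_max_power by auto
    \<comment> \<open>Order \<open>k\<close> already costs the whole colength, so nothing is left
      between \<open>I\<close> and \<open>max_power k\<close>.\<close>
    have "fc.qdim (max_power k) \<le> fc.qdim I"
      using fc.qdim_UNIV_ge_vanishing[OF ideal_max_power sub' max_power_vanishing] by (simp add: fc.qdim_UNIV B(2))
    then show "I = mk"
      unfolding mk using fc.qdim_eq[OF subspace_ideal[OF ideal_max_power] subspace_ideal[OF fc.J] sub' subset_refl] by simp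
  qed
  moreover have "borel_fixed mk" unfolding mk by (rule borel_fixed_max_power)
  ultimately show ?thesis using mk_point upper by blast
qed

end
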